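(* Let $\langle C_\nu\mid\nu\in\mathrm{Sing}^K\rangle$ be a global $\square$ sequence in $K$. Assume $n>3$ and that the set $\{\alpha<\omega_n\mid \alpha\in\mathrm{Cof}(\omega_{n-2})\text{ and }\alpha\text{ is singular in }K\}$ is, in $V$, stationary in $\omega_n$. Then \[T_n=\{\beta\in\mathrm{Cof}(\omega_1)\cap\omega_n\mid \mathrm{ot}(C_\beta)\geq\omega_{n-3}\}\] is stationary in $\omega_n$.
   Context: $K$ is the core model (built from partial or full extenders on its sequence, no extender having generators beyond its critical point), under the assumption that there is no inner model with a measurable $\kappa$ of Mitchell order $o_M(\kappa)=\kappa^{++}$. $\mathrm{Cof}(\lambda)$ is the class of ordinals of ($V$-)cofinality $\lambda$, $\omega_j=\aleph_j$ of $V$, $\mathrm{ot}$ is order type. A global $\square$ sequence in $K$ is a sequence $(C_\beta)$, defined in $K$, indexed by the limit ordinals $\beta$ that are singular in $K$, such that in $K$: $C_\beta$ is a closed cofinal subset of $\beta$; $\mathrm{ot}(C_\beta)<\beta$; and if $\bar\beta$ is a limit point of $C_\beta$ then $\bar\beta$ is singular and $C_{\bar\beta}=C_\beta\cap\bar\beta$. (In the paper this sequence is the one constructed there in $K$.) *)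

theory Defs
  imports Main
begin

text \<open>
  The universe \<open>V\<close> is an arbitrary model of first-order ZFC: a type with a membership relation, where
  Separation and Replacement range over formulas with parameters. Classes are sets of the
  ambient logic. Variables are de Bruijn indices into an environment.
\<close>

datatype fm = Mem nat nat | Equal nat nat | Neg fm | Conj fm fm | All fm

primrec sat :: "('a \<Rightarrow> 'a \<Rightarrow> bool) \<Rightarrow> 'a set \<Rightarrow> (nat \<Rightarrow> 'a) \<Rightarrow> fm \<Rightarrow> bool" where
  "sat m W s (Mem i j) \<longleftrightarrow> m (s i) (s j)"
| "sat m W s (Equal i j) \<longleftrightarrow> s i = s j"
| "sat m W s (Neg p) \<longleftrightarrow> \<not> sat m W s p"
| "sat m W s (Conj p q) \<longleftrightarrow> sat m W s p \<and> sat m W s q"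
| "sat m W s (All p) \<longleftrightarrow> (\<forall>x\<in>W. sat m W (case_nat x s) p)"

definition ZFC_model :: "('a \<Rightarrow> 'a \<Rightarrow> bool) \<Rightarrow> 'a set \<Rightarrow> bool" where
  "ZFC_model m W \<longleftrightarrow>
    \<comment> \<open>Extensionality\<close>
    (\<forall>x\<in>W. \<forall>y\<in>W. (\<forall>z\<in>W. m z x \<longleftrightarrow> m z y) \<longrightarrow> x = y) \<and>
    \<comment> \<open>Foundation\<close>
    (\<forall>x\<in>W. (\<exists>y\<in>W. m y x) \<longrightarrow> (\<exists>y\<in>W. m y x \<and> \<not> (\<exists>z\<in>W. m z x \<and> m z y))) \<and>
    \<comment> \<open>Pairing\<close>
    (\<forall>x\<in>W. \<forall>y\<in>W. \<exists>p\<in>W. \<forall>z\<in>W. m z p \<longleftrightarrow> z = x \<or> z = y) \<and>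
    \<comment> \<open>Union\<close>
    (\<forall>x\<in>W. \<exists>u\<in>W. \<forall>z\<in>W. m z u \<longleftrightarrow> (\<exists>y\<in>W. m z y \<and> m y x)) \<and>
    \<comment> \<open>Power set\<close>
    (\<forall>x\<in>W. \<exists>p\<in>W. \<forall>z\<in>W. m z p \<longleftrightarrow> (\<forall>w\<in>W. m w z \<longrightarrow> m w x)) \<and>
    \<comment> \<open>Infinity\<close>
    (\<exists>x\<in>W. (\<exists>e\<in>W. m e x \<and> \<not> (\<exists>z\<in>W. m z e)) \<and>
       (\<forall>y\<in>W. m y x \<longrightarrow> (\<exists>t\<in>W. m t x \<and> (\<forall>z\<in>W. m z t \<longleftrightarrow> m z y \<or> z = y)))) \<and>
    \<comment> \<open>Separation\<close>
    (\<forall>p s. range s \<subseteq> W \<longrightarrow>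
       (\<forall>x\<in>W. \<exists>y\<in>W. \<forall>z\<in>W. m z y \<longleftrightarrow> m z x \<and> sat m W (case_nat z s) p)) \<and>
    \<comment> \<open>Replacement\<close>
    (\<forall>p s. range s \<subseteq> W \<longrightarrow>
       (\<forall>x\<in>W. (\<forall>u\<in>W. m u x \<longrightarrow> (\<exists>!v. v \<in> W \<and> sat m W (case_nat u (case_nat v s)) p)) \<longrightarrow>
          (\<exists>y\<in>W. \<forall>v\<in>W. m v y \<longleftrightarrow> (\<exists>u\<in>W. m u x \<and> sat m W (case_nat u (case_nat v s)) p)))) \<and>
    \<comment> \<open>Choice\<close>
    (\<forall>x\<in>W. (\<forall>y\<in>W. m y x \<longrightarrow> (\<exists>z\<in>W. m z y)) \<and>
       (\<forall>y\<in>W. \<forall>y'\<in>W. m y x \<and> m y' x \<and> y \<noteq> y' \<longrightarrow> \<not> (\<exists>z\<in>W. m z y \<and> m z y')) \<longrightarrow>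
       (\<exists>c\<in>W. \<forall>y\<in>W. m y x \<longrightarrow> (\<exists>!z. z \<in> W \<and> m z y \<and> m z c)))"

class zfc =
  fixes mem :: "'a \<Rightarrow> 'a \<Rightarrow> bool"  (infix "\<in>\<^sub>V" 50)
  assumes ZFC_UNIV: "ZFC_model mem UNIV"

definition elts :: "'v::zfc \<Rightarrow> 'v set" where
  "elts x = {y. y \<in>\<^sub>V x}"

text \<open>Only meaningful when the class \<open>A\<close> is (coextensive with) an element of the universe.\<close>
definition vset :: "'v::zfc set \<Rightarrow> 'v" where
  "vset A = (THE x. elts x = A)"

definition vpair :: "'v::zfc \<Rightarrow> 'v \<Rightarrow> 'v" where
  "vpair x y = vset {vset {x}, vset {x, y}}"

definition vsucc :: "'v::zfc \<Rightarrow> 'v" where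
  "vsucc x = vset (insert x (elts x))"

text \<open>The union; on successor ordinals this is the predecessor.\<close>
definition vpred :: "'v::zfc \<Rightarrow> 'v" where
  "vpred x = vset (\<Union>y\<in>elts x. elts y)"

definition vnat :: "nat \<Rightarrow> 'v::zfc" where
  "vnat k = (vsucc ^^ k) (vset {})"

definition vminus :: "'v::zfc \<Rightarrow> nat \<Rightarrow> 'v" where
  "vminus n k = (vpred ^^ k) n"


subsection \<open>Ordinals, functions, order types\<close>

text \<open>
  Notions that are \<open>\<Delta>\<^sub>0\<close> are absolute between transitive models and are stated once;
  the others take the class \<open>W\<close> in which they are interpreted (\<open>UNIV\<close> being \<open>V\<close>), except for
  \<open>Cof\<close>, \<open>inf_cardinal\<close>, \<open>aleph\<close> and \<open>stationary\<close>, which are always those of \<open>V\<close>.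
\<close>

definition Ord :: "'v::zfc \<Rightarrow> bool" where
  "Ord \<alpha> \<longleftrightarrow> (\<forall>x\<in>elts \<alpha>. elts x \<subseteq> elts \<alpha>) \<and> (\<forall>x\<in>elts \<alpha>. \<forall>y\<in>elts x. elts y \<subseteq> elts x)"

definition ord_le :: "'v::zfc \<Rightarrow> 'v \<Rightarrow> bool"  (infix "\<le>\<^sub>V" 50) where
  "\<alpha> \<le>\<^sub>V \<beta> \<longleftrightarrow> \<alpha> \<in>\<^sub>V \<beta> \<or> \<alpha> = \<beta>"

definition Limit :: "'v::zfc \<Rightarrow> bool" where
  "Limit \<alpha> \<longleftrightarrow> Ord \<alpha> \<and> elts \<alpha> \<noteq> {} \<and> (\<forall>\<xi>\<in>elts \<alpha>. \<exists>\<eta>\<in>elts \<alpha>. \<xi> \<in>\<^sub>V \<eta>)"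

definition omega :: "'v::zfc" where
  "omega = (THE w. Limit w \<and> (\<forall>v\<in>elts w. \<not> Limit v))"

definition function_on :: "'v::zfc \<Rightarrow> 'v \<Rightarrow> bool" where
  "function_on f a \<longleftrightarrow>
    (\<forall>p\<in>elts f. \<exists>x y. x \<in>\<^sub>V a \<and> p = vpair x y) \<and> (\<forall>x\<in>elts a. \<exists>!y. vpair x y \<in>\<^sub>V f)"

definition maps_to :: "'v::zfc \<Rightarrow> 'v \<Rightarrow> 'v \<Rightarrow> bool" where
  "maps_to f a b \<longleftrightarrow> function_on f a \<and> (\<forall>x y. vpair x y \<in>\<^sub>V f \<longrightarrow> y \<in>\<^sub>V b)"

definition enumerates :: "'v::zfc \<Rightarrow> 'v \<Rightarrow> 'v set \<Rightarrow> bool" where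
  "enumerates f \<gamma> A \<longleftrightarrow> function_on f \<gamma> \<and> {y. \<exists>\<xi>. vpair \<xi> y \<in>\<^sub>V f} = A \<and>
    (\<forall>\<xi> y \<xi>' y'. vpair \<xi> y \<in>\<^sub>V f \<and> vpair \<xi>' y' \<in>\<^sub>V f \<and> \<xi> \<in>\<^sub>V \<xi>' \<longrightarrow> y \<in>\<^sub>V y')"

text \<open>The order type, computed in \<open>W\<close>, of a set of ordinals.\<close>
definition ot :: "'v::zfc set \<Rightarrow> 'v \<Rightarrow> 'v" where
  "ot W c = (THE \<gamma>. Ord \<gamma> \<and> (\<exists>f\<in>W. enumerates f \<gamma> (elts c)))"

definition cofinal_map :: "'v::zfc \<Rightarrow> 'v \<Rightarrow> 'v \<Rightarrow> bool" where
  "cofinal_map f \<gamma> \<alpha> \<longleftrightarrow> maps_to f \<gamma> \<alpha> \<and>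
    (\<forall>\<xi>\<in>elts \<alpha>. \<exists>\<zeta> \<eta>. vpair \<zeta> \<eta> \<in>\<^sub>V f \<and> \<xi> \<le>\<^sub>V \<eta>)"

definition Sing :: "'v::zfc set \<Rightarrow> 'v set" where
  "Sing W = {\<alpha>. Limit \<alpha> \<and> (\<exists>\<gamma>\<in>elts \<alpha>. \<exists>f\<in>W. cofinal_map f \<gamma> \<alpha>)}"

definition Cof :: "'v::zfc \<Rightarrow> 'v set" where
  "Cof \<mu> = {\<alpha>. Ord \<alpha> \<and> Ord \<mu> \<and> (\<exists>f. cofinal_map f \<mu> \<alpha>) \<and>
                  (\<forall>\<gamma>\<in>elts \<mu>. \<not> (\<exists>f. cofinal_map f \<gamma> \<alpha>))}"


subsection \<open>Cardinals\<close>

definition cardinal :: "'v::zfc set \<Rightarrow> 'v \<Rightarrow> bool" where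
  "cardinal W \<kappa> \<longleftrightarrow> Ord \<kappa> \<and>
    \<not> (\<exists>\<gamma>\<in>elts \<kappa>. \<exists>f\<in>W. maps_to f \<gamma> \<kappa> \<and> (\<forall>y\<in>elts \<kappa>. \<exists>x. vpair x y \<in>\<^sub>V f))"

definition card_succ :: "'v::zfc set \<Rightarrow> 'v \<Rightarrow> 'v" where
  "card_succ W \<kappa> = (THE \<mu>. \<kappa> \<in>\<^sub>V \<mu> \<and> cardinal W \<mu> \<and> (\<forall>\<nu>\<in>elts \<mu>. cardinal W \<nu> \<longrightarrow> \<nu> \<le>\<^sub>V \<kappa>))"

definition inf_cardinal :: "'v::zfc \<Rightarrow> bool" where
  "inf_cardinal \<kappa> \<longleftrightarrow> cardinal UNIV \<kappa> \<and> omega \<le>\<^sub>V \<kappa>"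

text \<open>
  The index is an ordinal of the universe, so that \<open>\<omega>\<^sub>n\<close> makes sense for all
  \<open>n \<in> \<omega>\<close> of \<open>V\<close>, which may be nonstandard.
\<close>
definition aleph :: "'v::zfc \<Rightarrow> 'v" where
  "aleph i = (THE \<kappa>. inf_cardinal \<kappa> \<and> (\<exists>f. enumerates f i {\<mu>. \<mu> \<in>\<^sub>V \<kappa> \<and> inf_cardinal \<mu>}))"


subsection \<open>Closed unbounded and stationary sets\<close>

definition limit_point :: "'v::zfc \<Rightarrow> 'v \<Rightarrow> bool" where
  "limit_point \<delta> c \<longleftrightarrow> Limit \<delta> \<and> (\<forall>\<xi>\<in>elts \<delta>. \<exists>\<eta>\<in>elts c. \<eta> \<in>\<^sub>V \<delta> \<and> \<xi> \<in>\<^sub>V \<eta>)"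

definition club :: "'v::zfc \<Rightarrow> 'v \<Rightarrow> bool" where
  "club c \<beta> \<longleftrightarrow> elts c \<subseteq> elts \<beta> \<and> (\<forall>\<xi>\<in>elts \<beta>. \<exists>\<eta>\<in>elts c. \<xi> \<le>\<^sub>V \<eta>) \<and>
    (\<forall>\<delta>\<in>elts \<beta>. limit_point \<delta> c \<longrightarrow> \<delta> \<in>\<^sub>V c)"

definition stationary :: "'v::zfc set \<Rightarrow> 'v \<Rightarrow> bool" where
  "stationary S \<kappa> \<longleftrightarrow> S \<subseteq> elts \<kappa> \<and> (\<forall>c. club c \<kappa> \<longrightarrow> S \<inter> elts c \<noteq> {})"


subsection \<open>Inner models and Mitchell order\<close>

definition inner_model :: "'v::zfc set \<Rightarrow> bool" where
  "inner_model W \<longleftrightarrow> (\<exists>p s. W = {x. sat mem UNIV (case_nat x s) p}) \<and>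
    (\<forall>x\<in>W. elts x \<subseteq> W) \<and> {\<alpha>. Ord \<alpha>} \<subseteq> W \<and> ZFC_model mem W"

definition in_class :: "'v::zfc set \<Rightarrow> 'v \<Rightarrow> bool" where
  "in_class A U \<longleftrightarrow> (\<exists>X\<in>elts U. elts X = A)"

definition normal_measure :: "'v::zfc set \<Rightarrow> 'v \<Rightarrow> 'v \<Rightarrow> bool" where
  "normal_measure W \<kappa> U \<longleftrightarrow> U \<in> W \<and> Ord \<kappa> \<and> omega \<in>\<^sub>V \<kappa> \<and>
    (\<forall>X\<in>elts U. elts X \<subseteq> elts \<kappa>) \<and>
    (\<forall>X\<in>elts U. \<forall>Y\<in>W. elts X \<subseteq> elts Y \<and> elts Y \<subseteq> elts \<kappa> \<longrightarrow> Y \<in>\<^sub>V U) \<and>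
    (\<forall>X\<in>W. elts X \<subseteq> elts \<kappa> \<longrightarrow> (X \<in>\<^sub>V U \<longleftrightarrow> \<not> in_class (elts \<kappa> - elts X) U)) \<and>
    (\<forall>\<xi>\<in>elts \<kappa>. \<not> in_class {\<xi>} U) \<and>
    \<comment> \<open>\<open>\<kappa>\<close>-completeness\<close>
    (\<forall>\<gamma>\<in>elts \<kappa>. \<forall>f\<in>W. maps_to f \<gamma> U \<longrightarrow>
       in_class {\<xi> \<in> elts \<kappa>. \<forall>\<alpha> X. vpair \<alpha> X \<in>\<^sub>V f \<longrightarrow> \<xi> \<in>\<^sub>V X} U) \<and>
    \<comment> \<open>closure under diagonal intersections\<close>
    (\<forall>f\<in>W. maps_to f \<kappa> U \<longrightarrow>
       in_class {\<xi> \<in> elts \<kappa>. \<forall>\<alpha> X. vpair \<alpha> X \<in>\<^sub>V f \<and> \<alpha> \<in>\<^sub>V \<xi> \<longrightarrow> \<xi> \<in>\<^sub>V X} U)"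

text \<open>
  \<open>U \<in> Ult(W, U')\<close>. In the ultrapower by a normal measure on \<open>\<kappa>\<close> every \<open>X \<subseteq> \<kappa>\<close> is represented
  by \<open>\<xi> \<mapsto> X \<inter> \<xi>\<close>, so this says that \<open>U\<close> consists of the subsets of \<open>\<kappa>\<close> in the element
  represented by \<open>f\<close>.
\<close>
definition mitchell_less :: "'v::zfc set \<Rightarrow> 'v \<Rightarrow> 'v \<Rightarrow> 'v \<Rightarrow> bool" where
  "mitchell_less W \<kappa> U U' \<longleftrightarrow> (\<exists>f\<in>W. function_on f \<kappa> \<and>
    (\<forall>X\<in>W. elts X \<subseteq> elts \<kappa> \<longrightarrow>
       (X \<in>\<^sub>V U \<longleftrightarrow>
        in_class {\<xi> \<in> elts \<kappa>. \<exists>y. vpair \<xi> y \<in>\<^sub>V f \<and> in_class (elts X \<inter> elts \<xi>) y} U')))"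

text \<open>
  \<open>o(\<kappa>) = \<theta>\<close> in \<open>W\<close>: the function \<open>r\<close> is the rank function of the Mitchell order,
  \<open>r(U) = sup {r(U') + 1 | U' < U}\<close>, and \<open>\<theta> = sup {r(U) + 1}\<close>.
\<close>
definition mitchell_order :: "'v::zfc set \<Rightarrow> 'v \<Rightarrow> 'v \<Rightarrow> bool" where
  "mitchell_order W \<kappa> \<theta> \<longleftrightarrow> Ord \<kappa> \<and> Ord \<theta> \<and> (\<exists>r\<in>W.
    (\<forall>U. normal_measure W \<kappa> U \<longrightarrow> (\<exists>!\<xi>. vpair U \<xi> \<in>\<^sub>V r)) \<and>
    (\<forall>U \<xi>. normal_measure W \<kappa> U \<and> vpair U \<xi> \<in>\<^sub>V r \<longrightarrow> Ord \<xi> \<and>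
       elts \<xi> = {\<eta>. \<exists>U' \<zeta>. normal_measure W \<kappa> U' \<and> mitchell_less W \<kappa> U' U \<and>
                            vpair U' \<zeta> \<in>\<^sub>V r \<and> \<eta> \<le>\<^sub>V \<zeta>}) \<and>
    elts \<theta> = {\<eta>. \<exists>U \<xi>. normal_measure W \<kappa> U \<and> vpair U \<xi> \<in>\<^sub>V r \<and> \<eta> \<le>\<^sub>V \<xi>})"


subsection \<open>Global square\<close>

text \<open>The values of \<open>C\<close> outside \<open>Sing K\<close> are irrelevant. The first conjunct is definability over \<open>K\<close>.\<close>
definition global_square :: "'v::zfc set \<Rightarrow> ('v \<Rightarrow> 'v) \<Rightarrow> bool" where
  "global_square K C \<longleftrightarrow>
    (\<exists>p s. range s \<subseteq> K \<and>
       (\<forall>\<beta>\<in>Sing K. \<forall>c\<in>K. c = C \<beta> \<longleftrightarrow> sat mem K (case_nat c (case_nat \<beta> s)) p)) \<and>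
    (\<forall>\<beta>\<in>Sing K. C \<beta> \<in> K \<and> club (C \<beta>) \<beta> \<and> ot K (C \<beta>) \<in>\<^sub>V \<beta> \<and>
       (\<forall>\<delta>\<in>elts \<beta>. limit_point \<delta> (C \<beta>) \<longrightarrow>
          \<delta> \<in> Sing K \<and> elts (C \<delta>) = elts (C \<beta>) \<inter> elts \<delta>))"

end

theory Submission
  imports Defs
begin

text \<open>
  Given a club \<open>d\<close> in \<open>\<omega>\<^sub>n\<close>, stationarity yields a \<open>K\<close>-singular limit point \<open>\<alpha>\<close> of \<open>d\<close> of cofinality
  \<open>\<mu> = \<omega>\<^sub>n\<^sub>-\<^sub>2 > \<omega>\<^sub>1\<close>. The common limit points of \<open>d\<close> and \<open>C\<^sub>\<alpha>\<close> that lie above the element of \<open>C\<^sub>\<alpha>\<close> of index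
  \<open>\<omega>\<^sub>n\<^sub>-\<^sub>3\<close> are cofinal in \<open>\<alpha>\<close>, so they have order type at least \<open>\<mu>\<close>, and the supremum \<open>\<beta>\<close> of the first
  \<open>\<omega>\<^sub>1\<close> of them lies in \<open>d\<close>. By coherence \<open>C\<^sub>\<beta> = C\<^sub>\<alpha> \<inter> \<beta>\<close>, which has order type at least \<open>\<omega>\<^sub>n\<^sub>-\<^sub>3\<close>, and
  \<open>\<beta>\<close> has cofinality \<open>\<omega>\<^sub>1\<close> because \<open>\<omega>\<^sub>1\<close> is regular.

  As \<open>V\<close> is only a first-order model of ZFC, possibly with nonstandard natural numbers, every
  instance of Separation, Replacement and induction needs a defining formula. Closure rules for
  predicates and terms that are definable with parameters supply these.
\<close>

section \<open>Definability with parameters\<close>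

text \<open>The difficulty is that \<beta> has to be of small cofinality while its square set is
  long. Length is therefore secured in advance, by staying above one fixed element of the square set
  of \<alpha>, and the small cofinality is produced afterwards. From n > 3 one gets n-3 \<ge> 1, so
  the aleph of index n-2 exceeds both \<open>omega1\<close> and the aleph of index n-3. The former
  guarantees that a common limit point of index \<open>omega1\<close> exists, which keeps the
  supremum of its predecessors below \<alpha>; the latter guarantees the fixed element. Both rest on
  the clause of \<open>Cof\<close> that excludes cofinal maps from smaller ordinals: it forces every
  cofinal subset of \<alpha> to be long. Since the naturals and ordinals of V cannot be identified
  with those of the ambient logic, order types, alephs, the countability of \<omega> \<times>
  \<omega> and countable unions are all treated inside V.\<close>

primrec ren :: "(nat \<Rightarrow> nat) \<Rightarrow> fm \<Rightarrow> fm" where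
  "ren f (Mem i j) = Mem (f i) (f j)"
| "ren f (Equal i j) = Equal (f i) (f j)"
| "ren f (Neg p) = Neg (ren f p)"
| "ren f (Conj p q) = Conj (ren f p) (ren f q)"
| "ren f (All p) = All (ren (case_nat 0 (\<lambda>i. Suc (f i))) p)"

text \<open>Under a quantifier the renaming is lifted: index 0 is the bound variable and stays
  fixed, all other images move up by one. Environments can thus be rearranged without inspecting
  formulas.\<close>

lemma sat_ren: "sat m W s (ren f p) \<longleftrightarrow> sat m W (\<lambda>i. s (f i)) p"
proof (induction p arbitrary: f s)
  case (All p)
  have "(\<lambda>i. case_nat x s (case_nat 0 (\<lambda>i. Suc (f i)) i)) = case_nat x (\<lambda>i. s (f i))" for x
    by (auto split: nat.split)
  then show ?case
    using All by simp
qed auto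

text \<open>Variables of the environment sit at the even indices, parameters at the odd ones.\<close>

definition mix :: "(nat \<Rightarrow> 'a) \<Rightarrow> (nat \<Rightarrow> 'a) \<Rightarrow> nat \<Rightarrow> 'a" where
  "mix s t i = (if even i then s (i div 2) else t (i div 2))"

text \<open>Predicates act on whole environments, so that quantifiers are those of the ambient logic
  and formulas never have to be written out. The parameters \<open>t\<close> are fixed before
  \<open>s\<close> varies.\<close>

definition definable :: "((nat \<Rightarrow> 'v::zfc) \<Rightarrow> bool) \<Rightarrow> bool" where
  "definable \<phi> \<longleftrightarrow> (\<exists>p t. \<forall>s. \<phi> s \<longleftrightarrow> sat mem UNIV (mix s t) p)"

text \<open>The language has no function symbols, so a term is represented by its graph; slot 0 is
  reserved for the candidate value.\<close>

definition dterm :: "((nat \<Rightarrow> 'v::zfc) \<Rightarrow> 'v) \<Rightarrow> bool" where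
  "dterm \<tau> \<longleftrightarrow> definable (\<lambda>s. s 0 = \<tau> (\<lambda>i. s (Suc i)))"

lemma definable_iff_cong: "definable \<phi> \<Longrightarrow> (\<And>s. \<psi> s \<longleftrightarrow> \<phi> s) \<Longrightarrow> definable \<psi>"
  by (simp add: definable_def)

lemma definable_not: "definable \<phi> \<Longrightarrow> definable (\<lambda>s. \<not> \<phi> s)"
  unfolding definable_def by (metis sat.simps(3))

lemma definable_conj:
  assumes "definable \<phi>" "definable \<psi>"
  shows "definable (\<lambda>s. \<phi> s \<and> \<psi> s)"
proof -
  from assms obtain p t q u where
    p: "\<And>s. \<phi> s \<longleftrightarrow> sat mem UNIV (mix s t) p" and q: "\<And>s. \<psi> s \<longleftrightarrow> sat mem UNIV (mix s u) q"
    unfolding definable_def by metis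
  \<comment> \<open>Each conjunct brings its own parameters, which are interleaved as
    \<open>mix t u\<close>. Parameter j moves from index 2j+1 to 4j+1 for the first formula and to
    4j+3 for the second.\<close>
  let ?f = "\<lambda>i. if even i then i else 4 * (i div 2) + 1"
  let ?g = "\<lambda>i. if even i then i else 4 * (i div 2) + 3"
  have 1: "(\<lambda>i. mix s (mix t u) (?f i)) = mix s t" for s
  proof
    fix i
    show "mix s (mix t u) (?f i) = mix s t i"
      by (cases "even i") (auto simp: mix_def elim!: oddE)
  qed
  have 2: "(\<lambda>i. mix s (mix t u) (?g i)) = mix s u" for s
  proof
    fix i
    have "(4 * j + 3) div 2 = 2 * j + 1" for j :: nat
      by presburger
    then show "mix s (mix t u) (?g i) = mix s u i"
      by (cases "even i") (auto simp: mix_def elim!: oddE)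
  qed
  have "(\<phi> s \<and> \<psi> s) \<longleftrightarrow> sat mem UNIV (mix s (mix t u)) (Conj (ren ?f p) (ren ?g q))" for s
    by (simp only: sat.simps sat_ren 1 2 p q)
  then show ?thesis
    unfolding definable_def by blast
qed

lemma definable_all:
  assumes "definable (\<lambda>s. \<phi> (s 0) (\<lambda>i. s (Suc i)))"
  shows "definable (\<lambda>s. \<forall>x. \<phi> x s)"
proof -
  from assms obtain p t where
    p: "\<And>s. \<phi> (s 0) (\<lambda>i. s (Suc i)) \<longleftrightarrow> sat mem UNIV (mix s t) p"
    unfolding definable_def by metis
  \<comment> \<open>\<open>All\<close> puts the bound variable in front of the mixed environment
    instead of in front of \<open>s\<close>. Hence variable j+1, expected at index 2j+2, is found at
    2j+1, and a parameter expected at an odd index i is found at i+1.\<close>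
  let ?f = "\<lambda>i. if i = 0 then 0 else if even i then i - 1 else Suc i"
  have 1: "(\<lambda>i. case_nat x (mix s t) (?f i)) = mix (case_nat x s) t" for x s
  proof
    fix i
    show "case_nat x (mix s t) (?f i) = mix (case_nat x s) t i"
    proof (cases "i = 0 \<or> odd i")
      case False
      then obtain j where "i = 2 * Suc j"
        by (metis evenE not0_implies_Suc mult_0_right)
      then show ?thesis by (simp add: mix_def)
    qed (auto simp: mix_def)
  qed
  have "\<phi> x s \<longleftrightarrow> sat mem UNIV (mix (case_nat x s) t) p" for x s
    using p[of "case_nat x s"] by simp
  then have "(\<forall>x. \<phi> x s) \<longleftrightarrow> sat mem UNIV (mix s t) (All (ren ?f p))" for s
    by (simp only: sat.simps sat_ren 1) simp
  then show ?thesis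
    unfolding definable_def by blast
qed

lemma definable_ren:
  assumes "definable \<phi>"
  shows "definable (\<lambda>s. \<phi> (\<lambda>i. s (f i)))"
proof -
  from assms obtain p t where p: "\<And>s. \<phi> s \<longleftrightarrow> sat mem UNIV (mix s t) p"
    unfolding definable_def by metis
  let ?f = "\<lambda>i. if even i then 2 * f (i div 2) else i"
  have 1: "(\<lambda>i. mix s t (?f i)) = mix (\<lambda>i. s (f i)) t" for s
    by (auto simp: mix_def)
  have "\<phi> (\<lambda>i. s (f i)) \<longleftrightarrow> sat mem UNIV (mix s t) (ren ?f p)" for s
    by (simp only: sat_ren 1 p)
  then show ?thesis
    unfolding definable_def by blast
qed

lemma definable_disj: "definable \<phi> \<Longrightarrow> definable \<psi> \<Longrightarrow> definable (\<lambda>s. \<phi> s \<or> \<psi> s)"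
  using definable_not[OF definable_conj[OF definable_not[of \<phi>] definable_not[of \<psi>]]] by simp

lemma definable_imp: "definable \<phi> \<Longrightarrow> definable \<psi> \<Longrightarrow> definable (\<lambda>s. \<phi> s \<longrightarrow> \<psi> s)"
  using definable_not[OF definable_conj[of \<phi>, OF _ definable_not[of \<psi>]]] by simp

lemma definable_iff: "definable \<phi> \<Longrightarrow> definable \<psi> \<Longrightarrow> definable (\<lambda>s. \<phi> s \<longleftrightarrow> \<psi> s)"
  unfolding iff_conv_conj_imp by (intro definable_conj definable_imp)

lemma definable_ex:
  assumes "definable (\<lambda>s. \<phi> (s 0) (\<lambda>i. s (Suc i)))"
  shows "definable (\<lambda>s. \<exists>x. \<phi> x s)"
  using definable_not[OF definable_all[of "\<lambda>x s. \<not> \<phi> x s", OF definable_not[OF assms]]] by simp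

lemma definable_atom_mem: "definable (\<lambda>s. s i \<in>\<^sub>V s j)"
  unfolding definable_def by (rule exI[of _ "Mem (2*i) (2*j)"]) (simp add: mix_def)

lemma definable_atom_eq: "definable (\<lambda>s. s i = s j)"
  unfolding definable_def by (rule exI[of _ "Equal (2*i) (2*j)"]) (simp add: mix_def)

lemma dterm_var: "dterm (\<lambda>s. s i)"
  unfolding dterm_def by (rule definable_atom_eq)

lemma dterm_const: "dterm (\<lambda>s. c)"
  unfolding dterm_def definable_def
  by (rule exI[of _ "Equal 0 1"], rule exI[of _ "\<lambda>_. c"]) (simp add: mix_def)

lemma definable_const: "definable (\<lambda>s :: nat \<Rightarrow> 'v::zfc. b)"
  using definable_atom_eq[of 0 0, where 'a='v] definable_not[OF definable_atom_eq[of 0 0, where 'a='v]] by (cases b) simp_all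

lemma dterm_ren: "dterm \<tau> \<Longrightarrow> dterm (\<lambda>s. \<tau> (\<lambda>i. s (f i)))"
  unfolding dterm_def
  using definable_ren[of "\<lambda>s. s 0 = \<tau> (\<lambda>i. s (Suc i))" "case_nat 0 (\<lambda>i. Suc (f i))"] by simp

text \<open>A composition is unfolded into an existential quantifier over the value of the inner
  term, whose graph is definable.\<close>

lemma definable_subst1:
  assumes "definable (\<lambda>s. P (s 0))" "dterm \<tau>"
  shows "definable (\<lambda>s. P (\<tau> s))"
proof -
  have "definable (\<lambda>s. \<exists>x. x = \<tau> s \<and> P x)"
    by (rule definable_ex, rule definable_conj) (use assms in \<open>auto simp: dterm_def\<close>)
  then show ?thesis by simp
qed

lemma definable_subst2:
  assumes "definable (\<lambda>s. P (s 0) (s (Suc 0)))" "dterm \<tau>" "dterm \<sigma>"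
  shows "definable (\<lambda>s. P (\<tau> s) (\<sigma> s))"
proof -
  have "definable (\<lambda>s. \<exists>y. y = \<sigma> s \<and> (\<exists>x. x = \<tau> s \<and> P x y))"
    \<comment> \<open>\<open>\<tau>\<close> is evaluated inside the quantifier over
      \<open>y\<close>, hence the shift of its variables.\<close>
    using assms dterm_ren[OF assms(2), of Suc]
    by (intro definable_ex definable_conj) (auto simp: dterm_def)
  then show ?thesis by simp
qed

lemma definable_mem: "dterm \<tau> \<Longrightarrow> dterm \<sigma> \<Longrightarrow> definable (\<lambda>s. \<tau> s \<in>\<^sub>V \<sigma> s)"
  by (rule definable_subst2[where P="\<lambda>x y. x \<in>\<^sub>V y"]) (rule definable_atom_mem)

lemma definable_elts: "dterm \<tau> \<Longrightarrow> dterm \<sigma> \<Longrightarrow> definable (\<lambda>s. \<tau> s \<in> elts (\<sigma> s))"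
  using definable_mem by (simp add: elts_def)

lemma definable_eq: "dterm \<tau> \<Longrightarrow> dterm \<sigma> \<Longrightarrow> definable (\<lambda>s. \<tau> s = \<sigma> s)"
  by (rule definable_subst2[where P="(=)"]) (rule definable_atom_eq)

lemma definable_ball:
  assumes "dterm \<tau>" "definable (\<lambda>s. \<phi> (s 0) (\<lambda>i. s (Suc i)))"
  shows "definable (\<lambda>s. \<forall>x\<in>elts (\<tau> s). \<phi> x s)"
  unfolding Ball_def by (intro definable_all definable_imp definable_elts assms(2) dterm_var dterm_ren[OF assms(1)])

lemma definable_bex:
  assumes "dterm \<tau>" "definable (\<lambda>s. \<phi> (s 0) (\<lambda>i. s (Suc i)))"
  shows "definable (\<lambda>s. \<exists>x\<in>elts (\<tau> s). \<phi> x s)"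
  unfolding Bex_def by (intro definable_ex definable_conj definable_elts assms(2) dterm_var dterm_ren[OF assms(1)])

lemma definable_subset: "dterm \<tau> \<Longrightarrow> dterm \<sigma> \<Longrightarrow> definable (\<lambda>s. elts (\<tau> s) \<subseteq> elts (\<sigma> s))"
  by (rule definable_subst2[where P="\<lambda>x y. elts x \<subseteq> elts y"])
    (simp_all only: subset_iff, intro definable_all definable_imp definable_elts dterm_var)

lemma definable_le: "dterm \<tau> \<Longrightarrow> dterm \<sigma> \<Longrightarrow> definable (\<lambda>s. \<tau> s \<le>\<^sub>V \<sigma> s)"
  unfolding ord_le_def by (intro definable_disj definable_mem definable_eq)

text \<open>Used with \<open>intro\<close>, the collection follows the syntax of a predicate down to
  its atoms and so decides most definability goals in one line.\<close>

lemmas definable_basic = dterm_var dterm_const definable_not definable_conj definable_disj definable_imp definable_iff definable_all definable_ex definable_mem definable_elts definable_eq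
  definable_ball definable_bex definable_subset definable_le

section \<open>Sets\<close>

definition small :: "'v::zfc set \<Rightarrow> bool" where
  "small A \<longleftrightarrow> (\<exists>x. elts x = A)"

lemmas ZFC = ZFC_UNIV[unfolded ZFC_model_def]
lemmas ZFC_ext = ZFC[THEN conjunct1, simplified]
lemmas ZFC_foundation = ZFC[THEN conjunct2, THEN conjunct1, simplified]
lemmas ZFC_pairing = ZFC[THEN conjunct2, THEN conjunct2, THEN conjunct1, simplified]
lemmas ZFC_union = ZFC[THEN conjunct2, THEN conjunct2, THEN conjunct2, THEN conjunct1, simplified]
lemmas ZFC_power = ZFC[THEN conjunct2, THEN conjunct2, THEN conjunct2, THEN conjunct2, THEN conjunct1, simplified]
lemmas ZFC_infinity = ZFC[THEN conjunct2, THEN conjunct2, THEN conjunct2, THEN conjunct2, THEN conjunct2, THEN conjunct1, simplified]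
lemmas ZFC_separation = ZFC[THEN conjunct2, THEN conjunct2, THEN conjunct2, THEN conjunct2, THEN conjunct2, THEN conjunct2, THEN conjunct1, simplified]
lemmas ZFC_replacement = ZFC[THEN conjunct2, THEN conjunct2, THEN conjunct2, THEN conjunct2, THEN conjunct2, THEN conjunct2, THEN conjunct2, THEN conjunct1, simplified]
lemmas ZFC_choice = ZFC[THEN conjunct2, THEN conjunct2, THEN conjunct2, THEN conjunct2, THEN conjunct2, THEN conjunct2, THEN conjunct2, THEN conjunct2, simplified]

lemma mem_elts: "x \<in>\<^sub>V y \<longleftrightarrow> x \<in> elts y"
  by (simp add: elts_def)

lemma elts_inject: "elts x = elts y \<Longrightarrow> x = (y::'v::zfc)"
  using ZFC_ext by (auto simp: elts_def set_eq_iff)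

lemma elts_vset: "small A \<Longrightarrow> elts (vset A) = A"
  unfolding small_def vset_def by (metis (mono_tags, lifting) elts_inject theI)

lemma vset_elts: "vset (elts x) = x"
  by (rule elts_inject) (rule elts_vset, auto simp: small_def)

lemma small_elts: "small (elts x)"
  by (auto simp: small_def)

lemma foundation:
  fixes x :: "'v::zfc"
  assumes "y \<in> elts x"
  shows "\<exists>y\<in>elts x. \<forall>z\<in>elts x. z \<notin> elts y"
  using ZFC_foundation assms by (fastforce simp: elts_def)

lemma small_pair: "small {x, y :: 'v::zfc}"
proof -
  obtain p where "\<forall>z. z \<in>\<^sub>V p \<longleftrightarrow> z = x \<or> z = y"
    using ZFC_pairing by metis
  then have "elts p = {x, y}" by (auto simp: elts_def)
  then show ?thesis by (auto simp: small_def)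
qed

lemma small_single: "small {x :: 'v::zfc}"
  using small_pair[of x x] by simp

lemma small_Union: "small (\<Union>y\<in>elts (x::'v::zfc). elts y)"
proof -
  obtain u where "\<forall>z. z \<in>\<^sub>V u \<longleftrightarrow> (\<exists>y. z \<in>\<^sub>V y \<and> y \<in>\<^sub>V x)"
    using ZFC_union by metis
  then have "elts u = (\<Union>y\<in>elts x. elts y)" by (auto simp: elts_def)
  then show ?thesis by (auto simp: small_def)
qed

lemma small_Pow: "small {z. elts z \<subseteq> elts (x::'v::zfc)}"
proof -
  obtain p where "\<forall>z. z \<in>\<^sub>V p \<longleftrightarrow> (\<forall>w. w \<in>\<^sub>V z \<longrightarrow> w \<in>\<^sub>V x)"
    using ZFC_power by metis
  then have "elts p = {z. elts z \<subseteq> elts x}" by (auto simp: elts_def)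
  then show ?thesis by (auto simp: small_def)
qed

lemma small_Un:
  assumes "small A" "small B"
  shows "small (A \<union> B)"
proof -
  obtain a b where "A = elts a" "B = elts b"
    using assms by (auto simp: small_def)
  then show ?thesis
    using small_Union[of "vset {a, b}"] by (simp add: elts_vset small_pair)
qed

text \<open>As \<open>P\<close> looks at variable 0 alone, all even indices may be collapsed onto
  the element being tested; the odd ones become the parameters of the Separation instance.\<close>

lemma small_sep:
  assumes "definable (\<lambda>s. P (s 0))"
  shows "small {z \<in> elts (x::'v::zfc). P z}"
proof -
  from assms obtain p t where p: "\<And>s. P (s 0) \<longleftrightarrow> sat mem UNIV (mix s t) p"
    unfolding definable_def by metis
  obtain y where y: "\<And>z. z \<in>\<^sub>V y \<longleftrightarrow> z \<in>\<^sub>V x \<and>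
      sat mem UNIV (case_nat z t) (ren (\<lambda>i. if even i then 0 else Suc (i div 2)) p)"
    using ZFC_separation by metis
  have "(\<lambda>i. case_nat z t (if even i then 0 else Suc (i div 2))) = mix (\<lambda>_. z) t" for z
    by (auto simp: mix_def)
  then have "elts y = {z \<in> elts x. P z}"
    using y p[of "\<lambda>_. _"] by (simp add: sat_ren elts_def)
  then show ?thesis by (auto simp: small_def)
qed

lemma small_sep': "definable (\<lambda>s. P (s 0)) \<Longrightarrow> {z. P z} \<subseteq> elts x \<Longrightarrow> small {z. P z}"
  using small_sep[of P x] by (metis (no_types, lifting) Collect_cong mem_Collect_eq subsetD)

text \<open>Same collapse as for Separation with two variables: index 0 is the argument and every
  other even index is the value.\<close>

lemma small_repl_ex1:
  assumes "definable (\<lambda>s. R (s 0) (s (Suc 0)))" "\<And>u. u \<in> elts x \<Longrightarrow> \<exists>!v. R u v"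
  shows "small {v. \<exists>u\<in>elts (x::'v::zfc). R u v}"
proof -
  from assms(1) obtain p t where p: "\<And>s. R (s 0) (s (Suc 0)) \<longleftrightarrow> sat mem UNIV (mix s t) p"
    unfolding definable_def by metis
  let ?p = "ren (\<lambda>i. if i = 0 then 0 else if even i then 1 else Suc (Suc (i div 2))) p"
  have e: "(\<lambda>i. case_nat u (case_nat v t) (if i = 0 then 0 else if even i then 1 else Suc (Suc (i div 2))))
      = mix (case_nat u (\<lambda>_. v)) t" for u v
  proof
    fix i
    show "case_nat u (case_nat v t) (if i = 0 then 0 else if even i then 1 else Suc (Suc (i div 2)))
      = mix (case_nat u (\<lambda>_. v)) t i"
    proof (cases "i = 0 \<or> odd i")
      case False
      then obtain j where "i = 2 * Suc j"
        by (metis evenE not0_implies_Suc mult_0_right)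
      then show ?thesis by (simp add: mix_def)
    qed (auto simp: mix_def)
  qed
  then have q: "sat mem UNIV (case_nat u (case_nat v t)) ?p \<longleftrightarrow> R u v" for u v
    unfolding sat_ren e using p[of "case_nat u (\<lambda>_. v)"] by simp
  have "\<forall>u. u \<in>\<^sub>V x \<longrightarrow> (\<exists>!v. sat mem UNIV (case_nat u (case_nat v t)) ?p)"
    using assms(2) q by (simp add: mem_elts)
  then obtain y where "\<forall>v. v \<in>\<^sub>V y \<longleftrightarrow> (\<exists>u. u \<in>\<^sub>V x \<and> sat mem UNIV (case_nat u (case_nat v t)) ?p)"
    using ZFC_replacement[THEN spec, THEN spec, THEN spec, THEN mp] by blast
  then have "elts y = {v. \<exists>u\<in>elts x. R u v}"
    using q by (auto simp: elts_def)
  then show ?thesis by (auto simp: small_def)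
qed

text \<open>Replacement asks for a value at every argument. Separating first the arguments that have
  a value makes it available for partial functions.\<close>

lemma small_repl:
  assumes "definable (\<lambda>s. R (s 0) (s (Suc 0)))" "\<And>u v w. u \<in> elts x \<Longrightarrow> R u v \<Longrightarrow> R u w \<Longrightarrow> v = w"
  shows "small {v. \<exists>u\<in>elts (x::'v::zfc). R u v}"
proof -
  let ?x = "vset {u \<in> elts x. \<exists>v. R u v}"
  have x: "elts ?x = {u \<in> elts x. \<exists>v. R u v}"
    by (rule elts_vset, rule small_sep, rule definable_ex)
      (rule definable_ren[OF assms(1), of "case_nat (Suc 0) (\<lambda>i. 0)", simplified])
  have "small {v. \<exists>u\<in>elts ?x. R u v}"
    by (rule small_repl_ex1[OF assms(1)]) (use assms(2) x in auto)
  also have "{v. \<exists>u\<in>elts ?x. R u v} = {v. \<exists>u\<in>elts x. R u v}"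
    using x by auto
  finally show ?thesis .
qed

text \<open>By extensionality the graph of such a term says that the candidate value has exactly the
  elements described by \<open>Q\<close>. This is the entry point for every new set-valued
  operation.\<close>

lemma dterm_vset:
  assumes "\<And>s. elts (\<tau> s) = {z. Q z s}" "definable (\<lambda>s. Q (s 0) (\<lambda>i. s (Suc i)))"
  shows "dterm \<tau>"
proof -
  have "y = \<tau> s \<longleftrightarrow> (\<forall>z. z \<in> elts y \<longleftrightarrow> Q z s)" for y s
    using assms(1)[of s] elts_inject by (metis (no_types, lifting) Collect_mem_eq mem_Collect_eq Collect_cong)
  moreover have "definable (\<lambda>s. \<forall>z. z \<in> elts (s 0) \<longleftrightarrow> Q z (\<lambda>i. s (Suc i)))"
    using definable_ren[OF assms(2), of "case_nat 0 (\<lambda>i. Suc (Suc i))"]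
    by (intro definable_all definable_iff definable_elts dterm_var) simp
  ultimately show ?thesis
    unfolding dterm_def by (rule_tac definable_iff_cong) auto
qed

section \<open>Definable operations: pairs, successors, products and application\<close>

lemma dterm_pair:
  assumes "dterm \<tau>" "dterm \<sigma>" shows "dterm (\<lambda>s. vset {\<tau> s, \<sigma> s})"
  by (rule dterm_vset[where Q="\<lambda>z s. z = \<tau> s \<or> z = \<sigma> s"])
    (auto simp: elts_vset small_pair intro!: definable_disj definable_eq dterm_var assms[THEN dterm_ren])

lemma dterm_vpair: "dterm \<tau> \<Longrightarrow> dterm \<sigma> \<Longrightarrow> dterm (\<lambda>s. vpair (\<tau> s) (\<sigma> s))"
  unfolding vpair_def using dterm_pair[of \<tau> \<tau>] dterm_pair[of \<tau> \<sigma>] dterm_pair[of "\<lambda>s. vset {\<tau> s}"] by simp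

lemma vpair_inject: "vpair x y = vpair x' y' \<longleftrightarrow> x = x' \<and> y = y'"
proof -
  have "vset {a, b} = vset {c, d} \<longleftrightarrow> {a, b} = {c, d}" for a b c d :: 'a
    by (metis elts_vset small_pair)
  moreover have "vpair x y = vset {vset {x, x}, vset {x, y}}" for x y :: 'a
    by (simp add: vpair_def)
  ultimately show ?thesis
    by (simp only: doubleton_eq_iff) blast
qed

lemma elts_vsucc: "elts (vsucc x) = insert x (elts x)"
  unfolding vsucc_def using small_Un[OF small_single small_elts, of x x] by (simp add: elts_vset)

lemma dterm_vsucc:
  assumes "dterm \<tau>" shows "dterm (\<lambda>s. vsucc (\<tau> s))"
  by (rule dterm_vset[where Q="\<lambda>z s. z = \<tau> s \<or> z \<in> elts (\<tau> s)"])
    (auto simp: elts_vsucc intro!: definable_disj definable_eq definable_elts dterm_var assms[THEN dterm_ren])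

lemma small_empty: "small ({} :: 'v::zfc set)"
  using small_sep[of "\<lambda>_. False"] by (simp add: definable_const)

definition vtimes :: "'v::zfc \<Rightarrow> 'v \<Rightarrow> 'v" where
  "vtimes a b = vset {p. \<exists>x\<in>elts a. \<exists>y\<in>elts b. p = vpair x y}"

lemma elts_vtimes: "elts (vtimes a b) = {p. \<exists>x\<in>elts a. \<exists>y\<in>elts b. p = vpair x y}"
proof -
  define u where "u = vset (elts a \<union> elts b)"
  define P where "P = vset {z. elts z \<subseteq> elts u}"
  \<comment> \<open>A Kuratowski pair over \<open>u\<close> is a set of subsets of \<open>u\<close>,
    hence a member of the second power set, from which the product is separated.\<close>
  define PP where "PP = vset {z. elts z \<subseteq> elts P}"
  have u: "elts u = elts a \<union> elts b"
    unfolding u_def by (simp add: elts_vset small_Un small_elts)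
  have P: "elts P = {z. elts z \<subseteq> elts u}" "elts PP = {z. elts z \<subseteq> elts P}"
    unfolding P_def PP_def by (rule elts_vset[OF small_Pow])+
  have "{p. \<exists>x\<in>elts a. \<exists>y\<in>elts b. p = vpair x y} \<subseteq> elts PP"
    by (auto simp: P u vpair_def elts_vset small_pair small_single)
  then show ?thesis
    unfolding vtimes_def by (intro elts_vset small_sep' definable_basic dterm_vpair)
qed

text \<open>Unlike a definite description, this union has no junk values, so application is definable
  for all arguments.\<close>

definition app :: "'v::zfc \<Rightarrow> 'v \<Rightarrow> 'v" where
  "app f x = vset (\<Union>y\<in>{y. vpair x y \<in> elts f}. elts y)"

text \<open>Second components of Kuratowski pairs lie in the double union of \<open>f\<close>, which
  bounds the class for Separation.\<close>

lemma small_image: "small {y. vpair x y \<in> elts f}"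
proof -
  obtain u where u: "elts u = (\<Union>p\<in>elts f. elts p)"
    using small_Union[of f] unfolding small_def by metis
  obtain w where w: "elts w = (\<Union>p\<in>elts u. elts p)"
    using small_Union[of u] unfolding small_def by metis
  have "y \<in> elts w" if "vpair x y \<in> elts f" for y
  proof -
    have "vset {x, y} \<in> elts u"
      using that u by (force simp: vpair_def elts_vset small_pair)
    then show ?thesis
      using w by (force simp: elts_vset small_pair)
  qed
  then show ?thesis
    by (intro small_sep'[of _ w] definable_basic dterm_vpair) auto
qed

lemma elts_app: "elts (app f x) = {z. \<exists>y. vpair x y \<in> elts f \<and> z \<in> elts y}"
proof -
  have "small (\<Union>y\<in>{y. vpair x y \<in> elts f}. elts y)"
    using small_Union[of "vset {y. vpair x y \<in> elts f}"] by (simp add: elts_vset small_image)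
  then show ?thesis
    by (auto simp: app_def elts_vset)
qed

lemma dterm_app:
  assumes "dterm \<tau>" "dterm \<sigma>"
  shows "dterm (\<lambda>s. app (\<tau> s) (\<sigma> s))"
  by (rule dterm_vset[OF elts_app]) (intro definable_basic dterm_vpair assms[THEN dterm_ren])

lemmas definable_rules = definable_basic dterm_vpair dterm_vsucc dterm_app

section \<open>Ordinals\<close>

lemma mem_irrefl: "x \<notin> elts x"
  using foundation[of x "vset {x}"] by (auto simp: elts_vset small_single)

lemma elts_empty: "elts (vset {}) = {}"
  by (rule elts_vset[OF small_empty])

lemma Ord_mem: "Ord \<alpha> \<Longrightarrow> x \<in> elts \<alpha> \<Longrightarrow> Ord x"
  unfolding Ord_def by blast

lemma Ord_trans: "Ord \<alpha> \<Longrightarrow> x \<in> elts y \<Longrightarrow> y \<in> elts \<alpha> \<Longrightarrow> x \<in> elts \<alpha>"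
  unfolding Ord_def by blast

lemma Ord_not_sym: "Ord \<alpha> \<Longrightarrow> \<beta> \<in> elts \<alpha> \<Longrightarrow> \<alpha> \<notin> elts \<beta>"
  using Ord_trans mem_irrefl by blast

lemma OrdI: "(\<And>x y. x \<in> elts y \<Longrightarrow> y \<in> elts \<alpha> \<Longrightarrow> x \<in> elts \<alpha>) \<Longrightarrow> (\<And>x. x \<in> elts \<alpha> \<Longrightarrow> Ord x) \<Longrightarrow> Ord \<alpha>"
  unfolding Ord_def by blast

lemma definable_Ord: "dterm \<tau> \<Longrightarrow> definable (\<lambda>s. Ord (\<tau> s))"
  by (rule definable_subst1[where P=Ord]) (unfold Ord_def, intro definable_rules)

text \<open>Foundation, applied to the part of \<open>a\<close> cut out by \<open>P\<close>. As
  \<open>a\<close> need not be transitive, minimality can only refer to those members of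
  \<open>y\<close> that lie in \<open>a\<close>.\<close>

lemma set_least:
  fixes P :: "'v::zfc \<Rightarrow> bool"
  assumes "definable (\<lambda>s. P (s 0))" "x \<in> elts a" "P x"
  shows "\<exists>y\<in>elts a. P y \<and> (\<forall>z\<in>elts y. z \<in> elts a \<longrightarrow> \<not> P z)"
proof -
  have e: "elts (vset {z \<in> elts a. P z}) = {z \<in> elts a. P z}"
    by (intro elts_vset small_sep assms)
  show ?thesis
    using foundation[of x "vset {z \<in> elts a. P z}"] assms by (fastforce simp: e)
qed

lemma Ord_least:
  assumes "definable (\<lambda>s. P (s 0))" "Ord \<alpha>" "P \<alpha>"
  shows "\<exists>\<beta>. Ord \<beta> \<and> P \<beta> \<and> \<beta> \<le>\<^sub>V \<alpha> \<and> (\<forall>\<gamma>\<in>elts \<beta>. \<not> P \<gamma>)"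
proof (cases "\<exists>\<gamma>\<in>elts \<alpha>. P \<gamma>")
  case True
  then obtain \<beta> where "\<beta> \<in> elts \<alpha>" "P \<beta>" "\<forall>z\<in>elts \<beta>. z \<in> elts \<alpha> \<longrightarrow> \<not> P z"
    using set_least[OF assms(1)] by blast
  then show ?thesis
    using assms(2) Ord_mem Ord_trans unfolding ord_le_def mem_elts by blast
next
  case False
  then show ?thesis
    using assms by (auto simp: ord_le_def)
qed

text \<open>Seen from outside, V may be ill-founded, and an arbitrary predicate may fail without
  failing at a least ordinal. Definability makes the failures below an ordinal a set, to which
  Foundation applies.\<close>

lemma Ord_induct:
  assumes "definable (\<lambda>s. P (s 0))" "Ord \<alpha>"
    "\<And>\<alpha>. Ord \<alpha> \<Longrightarrow> (\<And>\<beta>. \<beta> \<in> elts \<alpha> \<Longrightarrow> P \<beta>) \<Longrightarrow> P \<alpha>"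
  shows "P \<alpha>"
proof (rule ccontr)
  assume "\<not> P \<alpha>"
  then obtain \<beta> where "Ord \<beta>" "\<not> P \<beta>" "\<And>\<gamma>. \<gamma> \<in> elts \<beta> \<Longrightarrow> P \<gamma>"
    using Ord_least[of "\<lambda>x. \<not> P x", OF definable_not[OF assms(1)] assms(2)] by blast
  then show False
    using assms(3) by blast
qed

text \<open>Take \<alpha> least among the ordinals incomparable with something, then \<beta> least
  among those incomparable with this \<alpha>. By minimality each of the two contains all elements
  of the other, so extensionality identifies them.\<close>

lemma Ord_linear:
  assumes "Ord \<alpha>" "Ord \<beta>"
  shows "\<alpha> \<in> elts \<beta> \<or> \<alpha> = \<beta> \<or> \<beta> \<in> elts \<alpha>"
proof (rule ccontr)
  let ?cmp = "\<lambda>\<alpha> \<beta>. \<alpha> \<in> elts \<beta> \<or> \<alpha> = \<beta> \<or> \<beta> \<in> elts \<alpha>"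
  define C where "C \<alpha> \<longleftrightarrow> (\<exists>\<beta>. Ord \<beta> \<and> \<not> ?cmp \<alpha> \<beta>)" for \<alpha> :: 'a
  assume "\<not> ?cmp \<alpha> \<beta>"
  with assms have "C \<alpha>" unfolding C_def by blast
  moreover have "definable (\<lambda>s. C (s 0))"
    unfolding C_def by (intro definable_rules definable_Ord)
  ultimately obtain \<alpha> where a: "Ord \<alpha>" "C \<alpha>" "\<forall>\<gamma>\<in>elts \<alpha>. \<not> C \<gamma>"
    using Ord_least[of C] assms(1) by blast
  from a(2) obtain \<beta>' where b': "Ord \<beta>'" "\<not> ?cmp \<alpha> \<beta>'"
    unfolding C_def by (elim exE conjE)
  have "definable (\<lambda>s. \<not> ?cmp \<alpha> (s 0))"
    by (intro definable_rules)
  from Ord_least[where P="\<lambda>\<beta>. \<not> ?cmp \<alpha> \<beta>", OF this b']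
  obtain \<beta> where b: "Ord \<beta>" "\<not> ?cmp \<alpha> \<beta>" "\<forall>\<gamma>\<in>elts \<beta>. \<not> \<not> ?cmp \<alpha> \<gamma>"
    by (elim exE conjE)
  have "\<gamma> \<in> elts \<beta>" if g: "\<gamma> \<in> elts \<alpha>" for \<gamma>
  proof -
    have "?cmp \<gamma> \<beta>"
      using bspec[OF a(3) g] b(1) unfolding C_def by blast
    then show ?thesis
      using Ord_trans[OF a(1) _ g] b(2) g by metis
  qed
  moreover have "\<gamma> \<in> elts \<alpha>" if g: "\<gamma> \<in> elts \<beta>" for \<gamma>
    using b(3)[rule_format, OF g] Ord_trans[OF b(1) _ g] b(2) g by metis
  ultimately have "elts \<alpha> = elts \<beta>"
    by blast
  then have "\<alpha> = \<beta>"
    by (rule elts_inject)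
  with b(2) show False by blast
qed

lemma Ord_subset_le: "Ord \<alpha> \<Longrightarrow> Ord \<beta> \<Longrightarrow> elts \<alpha> \<subseteq> elts \<beta> \<Longrightarrow> \<alpha> \<le>\<^sub>V \<beta>"
  using Ord_linear[of \<alpha> \<beta>] mem_irrefl by (auto simp: ord_le_def mem_elts)

lemma Ord_not_mem_iff: "Ord \<alpha> \<Longrightarrow> Ord \<beta> \<Longrightarrow> \<alpha> \<notin> elts \<beta> \<longleftrightarrow> \<beta> \<le>\<^sub>V \<alpha>"
  using Ord_linear[of \<alpha> \<beta>] Ord_not_sym[of \<beta> \<alpha>] mem_irrefl[of \<beta>] by (auto simp: ord_le_def mem_elts)

lemma le_mem_trans: "Ord \<gamma> \<Longrightarrow> \<alpha> \<le>\<^sub>V \<beta> \<Longrightarrow> \<beta> \<in> elts \<gamma> \<Longrightarrow> \<alpha> \<in> elts \<gamma>"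
  using Ord_trans by (auto simp: ord_le_def mem_elts)

lemma mem_le_trans: "Ord \<gamma> \<Longrightarrow> \<alpha> \<in> elts \<beta> \<Longrightarrow> \<beta> \<le>\<^sub>V \<gamma> \<Longrightarrow> \<alpha> \<in> elts \<gamma>"
  using Ord_trans by (auto simp: ord_le_def mem_elts)

lemma le_trans: "Ord \<gamma> \<Longrightarrow> \<alpha> \<le>\<^sub>V \<beta> \<Longrightarrow> \<beta> \<le>\<^sub>V \<gamma> \<Longrightarrow> \<alpha> \<le>\<^sub>V \<gamma>"
  using Ord_trans by (auto simp: ord_le_def mem_elts)

lemma le_refl: "\<alpha> \<le>\<^sub>V \<alpha>"
  by (simp add: ord_le_def)

lemma mem_imp_le: "\<alpha> \<in> elts \<beta> \<Longrightarrow> \<alpha> \<le>\<^sub>V \<beta>"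
  by (simp add: ord_le_def mem_elts)

lemma Ord_vsucc: "Ord \<alpha> \<Longrightarrow> Ord (vsucc \<alpha>)"
  by (rule OrdI) (auto simp: elts_vsucc intro: Ord_mem Ord_trans)

lemma Ord_empty: "Ord (vset {})"
  by (rule OrdI) (auto simp: elts_empty)

lemma mem_vsucc: "x \<in> elts (vsucc \<alpha>) \<longleftrightarrow> x \<le>\<^sub>V \<alpha>"
  by (auto simp: elts_vsucc ord_le_def mem_elts)

lemma vsucc_inject:
  assumes "Ord \<alpha>" "vsucc \<alpha> = vsucc \<beta>" shows "\<alpha> = \<beta>"
  using assms(2) Ord_not_sym[OF assms(1), of \<beta>] elts_vsucc[of \<alpha>] elts_vsucc[of \<beta>]
  by (metis insert_iff)

lemma vsucc_ne_empty: "vsucc \<alpha> \<noteq> vset {}"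
  using elts_vsucc[of \<alpha>] elts_empty by (metis insert_not_empty)

lemma empty_mem_Ord:
  assumes "Ord \<alpha>" "\<xi> \<in> elts \<alpha>" shows "vset {} \<in> elts \<alpha>"
  using Ord_linear[OF Ord_empty assms(1)] assms(2) by (auto simp: elts_empty)

lemma Limit_Ord: "Limit \<alpha> \<Longrightarrow> Ord \<alpha>"
  by (simp add: Limit_def)

lemma Limit_vsucc:
  assumes "Limit \<alpha>" "\<xi> \<in> elts \<alpha>" shows "vsucc \<xi> \<in> elts \<alpha>"
proof -
  obtain \<eta> where e: "\<eta> \<in> elts \<alpha>" "\<xi> \<in> elts \<eta>" and a: "Ord \<alpha>"
    using assms unfolding Limit_def mem_elts by blast
  then have "vsucc \<xi> \<le>\<^sub>V \<eta>"
    by (intro Ord_subset_le) (auto simp: elts_vsucc intro: Ord_vsucc Ord_mem Ord_trans)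
  then show ?thesis
    using le_mem_trans a e by blast
qed

lemma Limit_empty: "Limit \<alpha> \<Longrightarrow> vset {} \<in> elts \<alpha>"
  using empty_mem_Ord unfolding Limit_def by blast

lemma not_Limit_vsucc: "\<not> Limit (vsucc \<alpha>)"
proof
  assume "Limit (vsucc \<alpha>)"
  from Limit_vsucc[OF this, of \<alpha>] mem_irrefl[of "vsucc \<alpha>"] show False
    by (simp add: elts_vsucc)
qed

lemma Limit_or_vsucc:
  assumes "Ord \<alpha>" "\<alpha> \<noteq> vset {}" "\<not> Limit \<alpha>"
  obtains \<beta> where "\<alpha> = vsucc \<beta>"
proof -
  have "elts \<alpha> \<noteq> {}"
    using assms(2) elts_inject elts_empty by metis
  with assms obtain \<beta> where b: "\<beta> \<in> elts \<alpha>" "\<And>\<eta>. \<eta> \<in> elts \<alpha> \<Longrightarrow> \<beta> \<notin> elts \<eta>"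
    unfolding Limit_def mem_elts by blast
  have "elts \<alpha> = elts (vsucc \<beta>)"
    using b assms(1) Ord_linear[of \<beta>] Ord_mem[OF assms(1)] Ord_trans[OF assms(1)]
    by (auto simp: elts_vsucc)
  then show ?thesis
    using that elts_inject by blast
qed

section \<open>Limit ordinals and the natural numbers of the model\<close>

lemma definable_Limit: "dterm \<tau> \<Longrightarrow> definable (\<lambda>s. Limit (\<tau> s))"
proof (rule definable_subst1[where P=Limit])
  have "Limit \<alpha> \<longleftrightarrow> Ord \<alpha> \<and> (\<exists>x. x \<in> elts \<alpha>) \<and> (\<forall>\<xi>\<in>elts \<alpha>. \<exists>\<eta>\<in>elts \<alpha>. \<xi> \<in>\<^sub>V \<eta>)" for \<alpha> :: 'a
    by (auto simp: Limit_def)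
  then show "definable (\<lambda>s. Limit (s 0 :: 'a))"
    by (simp only:) (intro definable_rules definable_Ord)
qed

lemma Limit_exists: "\<exists>w::'v::zfc. Limit w"
proof -
  obtain I e :: 'v where I: "e \<in> elts I" "\<forall>z. z \<notin> elts e"
    "\<forall>y. y \<in> elts I \<longrightarrow> (\<exists>t. t \<in> elts I \<and> (\<forall>z. z \<in> elts t \<longleftrightarrow> z \<in> elts y \<or> z = y))"
    using ZFC_infinity unfolding mem_elts by metis
  have e: "e = vset {}"
    using I(2) by (intro elts_inject) (auto simp: elts_empty)
  have s: "vsucc y \<in> elts I" if "y \<in> elts I" for y
  proof -
    obtain t where t: "t \<in> elts I" "\<forall>z. z \<in> elts t \<longleftrightarrow> z \<in> elts y \<or> z = y"
      using I(3) \<open>y \<in> elts I\<close> by blast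
    have "t = vsucc y"
      using t(2) by (intro elts_inject) (auto simp: elts_vsucc)
    with t show ?thesis by simp
  qed
  \<comment> \<open>The set given by Infinity may contain foreign elements. The ordinals in it that
    are also subsets of it form a transitive part still closed under successor.\<close>
  define w where "w = vset {y \<in> elts I. Ord y \<and> elts y \<subseteq> elts I}"
  have w: "elts w = {y \<in> elts I. Ord y \<and> elts y \<subseteq> elts I}"
    unfolding w_def by (intro elts_vset small_sep definable_rules definable_Ord)
  have "Ord w"
    by (rule OrdI) (auto simp: w intro: Ord_mem Ord_trans)
  moreover have "vset {} \<in> elts w"
    using I e by (simp add: w Ord_empty elts_empty)
  moreover have "vsucc y \<in> elts w" if "y \<in> elts w" for y
    using that s by (auto simp: w Ord_vsucc elts_vsucc)
  ultimately have "Limit w"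
    unfolding Limit_def mem_elts by (metis elts_vsucc insertI1 emptyE)
  then show ?thesis by blast
qed

lemma omega: "Limit (omega :: 'v::zfc)" "\<And>v. v \<in> elts (omega :: 'v) \<Longrightarrow> \<not> Limit v"
proof -
  obtain a :: 'v where "Limit a"
    using Limit_exists by blast
  then obtain w :: 'v where w: "Limit w" "\<And>v. v \<in> elts w \<Longrightarrow> \<not> Limit v"
    using Ord_least[where P=Limit, OF definable_Limit[OF dterm_var] Limit_Ord] by blast
  have *: "Limit (omega :: 'v) \<and> (\<forall>v\<in>elts (omega :: 'v). \<not> Limit v)"
    unfolding omega_def
  proof (rule theI)
    show "Limit w \<and> (\<forall>v\<in>elts w. \<not> Limit v)"
      using w by blast
  next
    fix u :: 'v assume "Limit u \<and> (\<forall>v\<in>elts u. \<not> Limit v)"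
    then show "u = w"
      using w Ord_linear[of u w] Limit_Ord by blast
  qed
  show "Limit (omega :: 'v)"
    using * by blast
  show "\<And>v. v \<in> elts (omega :: 'v) \<Longrightarrow> \<not> Limit v"
    using * by blast
qed

lemmas Ord_omega = Limit_Ord[OF omega(1)]

lemma omega_cases:
  assumes "k \<in> elts omega"
  obtains "k = vset {}" | j where "k = vsucc j" "j \<in> elts omega"
proof (cases "k = vset {}")
  case False
  then obtain j where j: "k = vsucc j"
    using Limit_or_vsucc omega(2) Ord_mem[OF Ord_omega] assms by metis
  then have "j \<in> elts omega"
    using assms Ord_trans[OF Ord_omega, of j k] by (simp add: elts_vsucc)
  with j show ?thesis
    by (rule that(2))
qed (use that in blast)

text \<open>The members of \<open>omega\<close> are the possibly nonstandard naturals of V, so this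
  is ordinal induction for a definable predicate, with \<open>omega_cases\<close> splitting zero
  from successors.\<close>

lemma omega_induct:
  assumes "definable (\<lambda>s. P (s 0))" "k \<in> elts omega" "P (vset {})"
    "\<And>k. k \<in> elts omega \<Longrightarrow> P k \<Longrightarrow> P (vsucc k)"
  shows "P k"
proof -
  have "k \<in> elts omega \<longrightarrow> P k"
  proof (rule Ord_induct[where P="\<lambda>k. k \<in> elts omega \<longrightarrow> P k"])
    show "definable (\<lambda>s. s 0 \<in> elts omega \<longrightarrow> P (s 0))"
      by (intro definable_rules assms(1))
    show "Ord k"
      using assms(2) Ord_mem Ord_omega by blast
    show "\<alpha> \<in> elts omega \<longrightarrow> P \<alpha>" if "\<And>\<beta>. \<beta> \<in> elts \<alpha> \<Longrightarrow> \<beta> \<in> elts omega \<longrightarrow> P \<beta>" for \<alpha>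
      using that assms(3,4) omega_cases[of \<alpha>] by (metis elts_vsucc insertI1)
  qed
  with assms(2) show ?thesis by blast
qed

section \<open>Order types\<close>

text \<open>Domain, codomain and members that are not pairs are left free, which suits partial
  maps.\<close>

definition functional :: "'v::zfc \<Rightarrow> bool" where
  "functional f \<longleftrightarrow> (\<forall>x y z. vpair x y \<in> elts f \<longrightarrow> vpair x z \<in> elts f \<longrightarrow> y = z)"

lemma app_eq:
  assumes "functional f" "vpair x y \<in> elts f"
  shows "app f x = y"
  by (rule elts_inject) (use assms in \<open>auto simp: elts_app functional_def\<close>)

lemma function_on_iff:
  "function_on f a \<longleftrightarrow> functional f \<and> (\<forall>x\<in>elts a. \<exists>y. vpair x y \<in> elts f) \<and>
    (\<forall>p\<in>elts f. \<exists>x\<in>elts a. \<exists>y. p = vpair x y)" (is "?l \<longleftrightarrow> ?r")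
proof
  assume ?l
  then show ?r
    unfolding function_on_def functional_def mem_elts by (metis vpair_inject)
next
  assume ?r
  then show ?l
    unfolding function_on_def functional_def mem_elts by metis
qed

lemma function_on_vpair_iff:
  assumes "function_on f a" shows "vpair x y \<in> elts f \<longleftrightarrow> x \<in> elts a \<and> y = app f x"
  using assms app_eq[of f x] unfolding function_on_iff by (metis vpair_inject)

text \<open>Replacement turns a definable term into a set function; restrictions and extensions of
  enumerations are built this way.\<close>

lemma function_exists:
  assumes "dterm (\<lambda>s. F (s 0))"
  obtains f where "function_on f a" "\<And>x. x \<in> elts a \<Longrightarrow> app f x = F x"
proof -
  have D: "definable (\<lambda>s. s (Suc 0) = vpair (s 0) (F (s 0)))"
    using dterm_ren[OF assms, of "\<lambda>_. 0"] by (intro definable_rules)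
  define f where "f = vset {p. \<exists>x\<in>elts a. p = vpair x (F x)}"
  have f: "elts f = {p. \<exists>x\<in>elts a. p = vpair x (F x)}"
    unfolding f_def using D by (intro elts_vset small_repl) auto
  have "function_on f a"
    unfolding function_on_def mem_elts f by (auto simp: vpair_inject)
  moreover from this have "app f x = F x" if "x \<in> elts a" for x
    using that function_on_vpair_iff[of f a x "F x"] f by auto
  ultimately show ?thesis
    using that by blast
qed

lemma enumerates_iff:
  "enumerates f \<gamma> A \<longleftrightarrow> function_on f \<gamma> \<and> app f ` elts \<gamma> = A \<and>
    (\<forall>\<xi>\<in>elts \<gamma>. \<forall>\<eta>\<in>elts \<gamma>. \<xi> \<in> elts \<eta> \<longrightarrow> app f \<xi> \<in> elts (app f \<eta>))"
proof (cases "function_on f \<gamma>")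
  case True
  then show ?thesis
    unfolding enumerates_def mem_elts function_on_vpair_iff[OF True] by auto
qed (simp add: enumerates_def)

lemma enumerates_strict:
  assumes "enumerates f \<gamma> A" "\<xi> \<in> elts \<gamma>" "\<eta> \<in> elts \<gamma>" "\<And>x. x \<in> A \<Longrightarrow> Ord x" "Ord \<gamma>"
  shows "app f \<xi> \<in> elts (app f \<eta>) \<longleftrightarrow> \<xi> \<in> elts \<eta>"
proof -
  have "Ord \<xi>" "Ord \<eta>" "Ord (app f \<xi>)" "Ord (app f \<eta>)"
    using assms Ord_mem by (auto simp: enumerates_iff)
  then show ?thesis
    using assms Ord_linear[of \<xi> \<eta>] mem_irrefl Ord_not_sym unfolding enumerates_iff by metis
qed

lemma definable_enumerates:
  fixes Q :: "'v::zfc \<Rightarrow> (nat \<Rightarrow> 'v) \<Rightarrow> bool"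
  assumes "dterm \<tau>" "dterm \<sigma>" "definable (\<lambda>s. Q (s 0) (\<lambda>i. s (Suc i)))"
  shows "definable (\<lambda>s. enumerates (\<tau> s) (\<sigma> s) {y. Q y s})"
proof -
  have "definable (\<lambda>s. function_on (\<tau> s) (\<sigma> s))"
    unfolding function_on_def Ex1_def
    by (intro definable_rules assms assms(1)[THEN dterm_ren] assms(2)[THEN dterm_ren])
  then show ?thesis
    unfolding enumerates_def set_eq_iff mem_Collect_eq
    by (intro definable_rules assms(3) assms(1)[THEN dterm_ren])
qed

text \<open>By induction \<open>g\<close> runs no faster than \<open>f\<close>. If f(\<xi>) =
  g(\<zeta>), then every \<eta> < \<xi> satisfies g(\<eta>) \<le> f(\<eta>) < g(\<zeta>), hence
  \<eta> < \<zeta>; so \<xi> \<le> \<zeta>, which puts \<xi> into \<gamma>' and gives g(\<xi>) \<le>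
  f(\<xi>).\<close>

lemma enumerates_le:
  assumes f: "enumerates f \<gamma> A" and g: "enumerates g \<gamma>' B" and AB: "A \<subseteq> B"
    and B: "\<And>x. x \<in> B \<Longrightarrow> Ord x" and "Ord \<gamma>" "Ord \<gamma>'"
  shows "\<gamma> \<le>\<^sub>V \<gamma>'"
proof (rule Ord_subset_le)
  have "\<xi> \<in> elts \<gamma> \<longrightarrow> \<xi> \<in> elts \<gamma>' \<and> app g \<xi> \<le>\<^sub>V app f \<xi>" if "Ord \<xi>" for \<xi>
  proof (rule Ord_induct[where P="\<lambda>\<xi>. \<xi> \<in> elts \<gamma> \<longrightarrow> \<xi> \<in> elts \<gamma>' \<and> app g \<xi> \<le>\<^sub>V app f \<xi>", OF _ that])
    show "definable (\<lambda>s. s 0 \<in> elts \<gamma> \<longrightarrow> s 0 \<in> elts \<gamma>' \<and> app g (s 0) \<le>\<^sub>V app f (s 0))"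
      by (intro definable_rules)
  next
    fix \<xi> assume "Ord \<xi>" and IH: "\<And>\<beta>. \<beta> \<in> elts \<xi> \<Longrightarrow> \<beta> \<in> elts \<gamma> \<longrightarrow> \<beta> \<in> elts \<gamma>' \<and> app g \<beta> \<le>\<^sub>V app f \<beta>"
    show "\<xi> \<in> elts \<gamma> \<longrightarrow> \<xi> \<in> elts \<gamma>' \<and> app g \<xi> \<le>\<^sub>V app f \<xi>"
    proof
      assume x: "\<xi> \<in> elts \<gamma>"
      then have fx: "app f \<xi> \<in> B"
        using f AB by (auto simp: enumerates_iff)
      then obtain \<zeta> where z: "\<zeta> \<in> elts \<gamma>'" "app f \<xi> = app g \<zeta>"
        using g by (auto simp: enumerates_iff)
      have "\<eta> \<in> elts \<zeta>" if e: "\<eta> \<in> elts \<xi>" for \<eta>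
      proof -
        have eg: "\<eta> \<in> elts \<gamma>"
          using Ord_trans[OF \<open>Ord \<gamma>\<close>] x e by blast
        then have "app f \<eta> \<in> elts (app f \<xi>)"
          using f x e by (auto simp: enumerates_iff)
        then have "app g \<eta> \<in> elts (app g \<zeta>)"
          using le_mem_trans[of "app f \<xi>" "app g \<eta>" "app f \<eta>"] B[OF fx] IH[OF e] eg z(2) by auto
        then show ?thesis
          using enumerates_strict[OF g _ z(1) B \<open>Ord \<gamma>'\<close>] IH[OF e] eg by blast
      qed
      then have le: "\<xi> \<le>\<^sub>V \<zeta>"
        using Ord_subset_le[OF \<open>Ord \<xi>\<close>] Ord_mem[OF \<open>Ord \<gamma>'\<close> z(1)] by blast
      then have x': "\<xi> \<in> elts \<gamma>'"
        using le_mem_trans[OF \<open>Ord \<gamma>'\<close>] z(1) by blast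
      have "app g \<xi> \<le>\<^sub>V app g \<zeta>"
        using le g x' z(1) by (auto simp: enumerates_iff ord_le_def mem_elts)
      with x' z(2) show "\<xi> \<in> elts \<gamma>' \<and> app g \<xi> \<le>\<^sub>V app f \<xi>"
        by simp
    qed
  qed
  then show "elts \<gamma> \<subseteq> elts \<gamma>'"
    using Ord_mem[OF \<open>Ord \<gamma>\<close>] by blast
qed fact+

lemma enumerates_unique:
  assumes "enumerates f \<gamma> A" "enumerates g \<gamma>' A" "\<And>x. x \<in> A \<Longrightarrow> Ord x" "Ord \<gamma>" "Ord \<gamma>'"
  shows "\<gamma> = \<gamma>'"
  using enumerates_le[OF assms(1,2)] enumerates_le[OF assms(2,1)] assms(3-5) Ord_not_sym[of \<gamma> \<gamma>']
  by (auto simp: ord_le_def mem_elts)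

lemma enumerates_restrict:
  assumes f: "enumerates f \<gamma> A" and A: "\<And>x. x \<in> A \<Longrightarrow> Ord x" and "Ord \<gamma>" "\<zeta> \<in> elts \<gamma>"
  shows "\<exists>g. enumerates g \<zeta> {y \<in> A. y \<in> elts (app f \<zeta>)}"
proof -
  obtain g where g: "function_on g \<zeta>" "\<And>x. x \<in> elts \<zeta> \<Longrightarrow> app g x = app f x"
    by (rule function_exists[of "app f" \<zeta>]) (intro definable_rules, blast)
  have z: "\<xi> \<in> elts \<gamma>" if "\<xi> \<in> elts \<zeta>" for \<xi>
    using that Ord_trans assms by blast
  have "app f ` elts \<zeta> = {y \<in> A. y \<in> elts (app f \<zeta>)}"
    using f z enumerates_strict[OF f _ assms(4) A assms(3)] \<open>\<zeta> \<in> elts \<gamma>\<close> by (auto simp: enumerates_iff)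
  then have "app g ` elts \<zeta> = {y \<in> A. y \<in> elts (app f \<zeta>)}"
    using g(2) by auto
  then have "enumerates g \<zeta> {y \<in> A. y \<in> elts (app f \<zeta>)}"
    unfolding enumerates_iff using g f z by (auto simp: enumerates_iff)
  then show ?thesis by blast
qed

text \<open>The order type of the part of \<open>c\<close> below \<open>x\<close>, as a relation: it
  is definable and usable before existence is known, whereas \<open>ot\<close> is a definite
  description.\<close>

definition seg_type :: "'v::zfc \<Rightarrow> 'v \<Rightarrow> 'v \<Rightarrow> bool" where
  "seg_type c x \<gamma> \<longleftrightarrow> Ord \<gamma> \<and> (\<exists>f. enumerates f \<gamma> {y. y \<in> elts c \<and> y \<in> elts x})"

lemma definable_seg_type: "dterm \<tau> \<Longrightarrow> dterm \<sigma> \<Longrightarrow> definable (\<lambda>s. seg_type c (\<tau> s) (\<sigma> s))"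
  by (rule definable_subst2[where P="seg_type c"]) (unfold seg_type_def, intro definable_rules definable_Ord definable_enumerates)

lemma seg_type_unique:
  assumes "\<And>x. x \<in> elts c \<Longrightarrow> Ord x" "seg_type c x \<gamma>" "seg_type c x \<gamma>'"
  shows "\<gamma> = \<gamma>'"
  using assms enumerates_unique[of _ \<gamma> "{y. y \<in> elts c \<and> y \<in> elts x}" _ \<gamma>']
  unfolding seg_type_def by blast

lemma seg_type_app:
  assumes c: "\<And>x. x \<in> elts c \<Longrightarrow> Ord x" and h: "enumerates h \<gamma> {u. u \<in> elts c \<and> u \<in> elts y}"
    and "Ord \<gamma>" "Ord y" "\<delta> \<in> elts \<gamma>"
  shows "seg_type c (app h \<delta>) \<delta>" "app h \<delta> \<in> elts c" "app h \<delta> \<in> elts y"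
proof -
  show z: "app h \<delta> \<in> elts c" "app h \<delta> \<in> elts y"
    using h \<open>\<delta> \<in> elts \<gamma>\<close> by (auto simp: enumerates_iff)
  have "{u \<in> {u. u \<in> elts c \<and> u \<in> elts y}. u \<in> elts (app h \<delta>)} = {u. u \<in> elts c \<and> u \<in> elts (app h \<delta>)}"
    using z(2) Ord_trans[OF \<open>Ord y\<close>] by blast
  then have "\<exists>g. enumerates g \<delta> {u. u \<in> elts c \<and> u \<in> elts (app h \<delta>)}"
    using enumerates_restrict[OF h _ \<open>Ord \<gamma>\<close> \<open>\<delta> \<in> elts \<gamma>\<close>] c by simp
  then show "seg_type c (app h \<delta>) \<delta>"
    unfolding seg_type_def using Ord_mem[OF \<open>Ord \<gamma>\<close> \<open>\<delta> \<in> elts \<gamma>\<close>] by simp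
qed

lemma seg_type_pred:
  assumes c: "\<And>x. x \<in> elts c \<Longrightarrow> Ord x" and "seg_type c y \<gamma>" "Ord y" "\<delta> \<in> elts \<gamma>"
  obtains z where "z \<in> elts c" "z \<in> elts y" "seg_type c z \<delta>"
proof -
  obtain h where "enumerates h \<gamma> {u. u \<in> elts c \<and> u \<in> elts y}" and "Ord \<gamma>"
    using assms(2) unfolding seg_type_def by blast
  from that[OF seg_type_app(2,3,1)[OF c this \<open>Ord y\<close> \<open>\<delta> \<in> elts \<gamma>\<close>]] show ?thesis .
qed

lemma seg_type_mono:
  assumes c: "\<And>x. x \<in> elts c \<Longrightarrow> Ord x" and y: "seg_type c y \<gamma>" and z: "seg_type c z \<gamma>'"
    and "Ord z" "y \<in> elts c" "y \<in> elts z"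
  shows "\<gamma> \<in> elts \<gamma>'"
proof -
  obtain h where h: "enumerates h \<gamma>' {u. u \<in> elts c \<and> u \<in> elts z}" and "Ord \<gamma>'"
    using z unfolding seg_type_def by blast
  have "y \<in> app h ` elts \<gamma>'"
    using h assms(5,6) by (simp add: enumerates_iff)
  then obtain \<delta> where d: "\<delta> \<in> elts \<gamma>'" "app h \<delta> = y"
    by blast
  then have "seg_type c y \<delta>"
    using seg_type_app(1)[OF c h \<open>Ord \<gamma>'\<close> \<open>Ord z\<close>] by blast
  then have "\<gamma> = \<delta>"
    using seg_type_unique[OF c y] by blast
  with d show ?thesis by simp
qed

text \<open>A collapse: each y in c below x is sent to the type of the part of c below y. The values
  form an ordinal because segments of segments are segments, and the inverse of this map is the
  required enumeration.\<close>

lemma seg_type_step: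
  assumes c: "\<And>x. x \<in> elts c \<Longrightarrow> Ord x" and "Ord x"
    and IH: "\<And>y. y \<in> elts c \<Longrightarrow> y \<in> elts x \<Longrightarrow> \<exists>\<gamma>. seg_type c y \<gamma>"
  shows "\<exists>\<gamma>. seg_type c x \<gamma>"
proof -
  define \<gamma> where "\<gamma> = vset {\<gamma>. \<exists>y\<in>elts c. y \<in> elts x \<and> seg_type c y \<gamma>}"
  have \<gamma>: "\<delta> \<in> elts \<gamma> \<longleftrightarrow> (\<exists>y\<in>elts c. y \<in> elts x \<and> seg_type c y \<delta>)" for \<delta>
  proof -
    have "small {\<gamma>. \<exists>y\<in>elts c. y \<in> elts x \<and> seg_type c y \<gamma>}"
    proof (rule small_repl)
      show "definable (\<lambda>s. s 0 \<in> elts x \<and> seg_type c (s 0) (s (Suc 0)))"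
        by (intro definable_rules definable_seg_type)
    qed (use seg_type_unique[OF c] in blast)
    then show ?thesis
      unfolding \<gamma>_def by (simp add: elts_vset)
  qed
  define f where "f = vset {p. \<exists>y\<in>elts c. y \<in> elts x \<and> (\<exists>\<gamma>. seg_type c y \<gamma> \<and> p = vpair \<gamma> y)}"
  have f: "p \<in> elts f \<longleftrightarrow> (\<exists>y\<in>elts c. y \<in> elts x \<and> (\<exists>\<gamma>. seg_type c y \<gamma> \<and> p = vpair \<gamma> y))" for p
  proof -
    have "small {p. \<exists>y\<in>elts c. y \<in> elts x \<and> (\<exists>\<gamma>. seg_type c y \<gamma> \<and> p = vpair \<gamma> y)}"
    proof (rule small_repl)
      show "definable (\<lambda>s. s 0 \<in> elts x \<and> (\<exists>\<gamma>. seg_type c (s 0) \<gamma> \<and> s (Suc 0) = vpair \<gamma> (s 0)))"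
        by (intro definable_rules definable_seg_type)
    qed (use seg_type_unique[OF c] in blast)
    then show ?thesis
      unfolding f_def by (simp add: elts_vset)
  qed
  have o: "Ord \<gamma>"
  proof (rule OrdI)
    fix \<delta> \<gamma>' assume d: "\<delta> \<in> elts \<gamma>'" and "\<gamma>' \<in> elts \<gamma>"
    then obtain y where y: "y \<in> elts c" "y \<in> elts x" "seg_type c y \<gamma>'"
      using \<gamma> by blast
    obtain z where "z \<in> elts c" "z \<in> elts y" "seg_type c z \<delta>"
      using seg_type_pred[OF c y(3) c[OF y(1)] d] .
    then show "\<delta> \<in> elts \<gamma>"
      using \<gamma> y(2) Ord_trans[OF \<open>Ord x\<close>] by blast
  next
    show "Ord \<delta>" if "\<delta> \<in> elts \<gamma>" for \<delta>
      using \<gamma> that unfolding seg_type_def by blast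
  qed
  have inv: "y = z" if "y \<in> elts c" "z \<in> elts c" "seg_type c y \<gamma>'" "seg_type c z \<gamma>'" for y z \<gamma>'
    using that Ord_linear[OF c[OF that(1)] c[OF that(2)]] seg_type_mono[OF c that(3,4)]
      seg_type_mono[OF c that(4,3)] mem_irrefl[of \<gamma>'] c by blast
  have fn: "function_on f \<gamma>"
  proof -
    have "functional f"
      unfolding functional_def f vpair_inject using inv by metis
    moreover have "\<exists>y. vpair \<delta> y \<in> elts f" if "\<delta> \<in> elts \<gamma>" for \<delta>
      using that unfolding f \<gamma> by blast
    moreover have "\<exists>\<delta>\<in>elts \<gamma>. \<exists>y. p = vpair \<delta> y" if "p \<in> elts f" for p
      using that \<gamma> unfolding f by blast
    ultimately show ?thesis
      unfolding function_on_iff by blast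
  qed
  have ap: "app f \<delta> \<in> elts c \<and> app f \<delta> \<in> elts x \<and> seg_type c (app f \<delta>) \<delta>" if "\<delta> \<in> elts \<gamma>" for \<delta>
    using function_on_vpair_iff[OF fn, of \<delta> "app f \<delta>"] that unfolding f vpair_inject by blast
  have "app f ` elts \<gamma> = {y. y \<in> elts c \<and> y \<in> elts x}"
  proof (intro equalityI subsetI)
    fix y assume y: "y \<in> {y. y \<in> elts c \<and> y \<in> elts x}"
    then obtain \<delta> where d: "seg_type c y \<delta>"
      using IH by blast
    with y have "\<delta> \<in> elts \<gamma>"
      using \<gamma> by blast
    with ap inv d y show "y \<in> app f ` elts \<gamma>" by blast
  qed (use ap in blast)
  moreover have "app f \<xi> \<in> elts (app f \<eta>)" if x: "\<xi> \<in> elts \<gamma>" "\<eta> \<in> elts \<gamma>" "\<xi> \<in> elts \<eta>" for \<xi> \<eta>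
  proof -
    note 1 = ap[OF x(1)] ap[OF x(2)]
    have "app f \<xi> \<noteq> app f \<eta>"
      using 1 seg_type_unique[of c "app f \<xi>" \<xi> \<eta>] c x(3) mem_irrefl[of \<xi>] by auto
    moreover have "app f \<eta> \<notin> elts (app f \<xi>)"
      using 1 seg_type_mono[of c "app f \<eta>" \<eta> "app f \<xi>" \<xi>] c Ord_not_sym[OF Ord_mem[OF o x(2)] x(3)] by blast
    ultimately show ?thesis
      using Ord_linear[of "app f \<xi>" "app f \<eta>"] 1 c by blast
  qed
  ultimately have "enumerates f \<gamma> {y. y \<in> elts c \<and> y \<in> elts x}"
    unfolding enumerates_iff using fn by blast
  with o show ?thesis
    unfolding seg_type_def by blast
qed

lemma order_type_exists:
  assumes c: "\<And>x. x \<in> elts c \<Longrightarrow> Ord x"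
  obtains \<gamma> f where "Ord \<gamma>" "enumerates f \<gamma> (elts c)"
proof -
  \<comment> \<open>Successors are collected so that the union \<open>x\<close> lies strictly above
    all of \<open>c\<close>, even if \<open>c\<close> has a largest element.\<close>
  define u where "u = vset {y. \<exists>z\<in>elts c. y = vsucc z}"
  have u: "elts u = {y. \<exists>z\<in>elts c. y = vsucc z}"
    unfolding u_def by (rule elts_vset, rule small_repl[where R="\<lambda>z y. y = vsucc z"]) (intro definable_rules, simp)
  define x where "x = vset (\<Union>y\<in>elts u. elts y)"
  have x: "y \<in> elts x \<longleftrightarrow> (\<exists>z\<in>elts c. y \<le>\<^sub>V z)" for y
    unfolding x_def elts_vset[OF small_Union] mem_vsucc[symmetric] by (auto simp: u)
  have "Ord x"
  proof (rule OrdI)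
    show "Ord y" if "y \<in> elts x" for y
      using that x c Ord_mem unfolding ord_le_def mem_elts by blast
    show "y \<in> elts x" if "y \<in> elts z" "z \<in> elts x" for y z
      using that x c Ord_trans unfolding ord_le_def mem_elts by blast
  qed
  then have "\<exists>\<gamma>. seg_type c x \<gamma>"
  proof (rule Ord_induct[where P="\<lambda>x. \<exists>\<gamma>. seg_type c x \<gamma>", rotated])
    show "definable (\<lambda>s. \<exists>\<gamma>. seg_type c (s 0) \<gamma>)"
      by (intro definable_rules definable_seg_type)
  qed (use seg_type_step[OF c] in blast)
  moreover have "{y. y \<in> elts c \<and> y \<in> elts x} = elts c"
    using x le_refl by blast
  ultimately show ?thesis
    using that unfolding seg_type_def by auto
qed

section \<open>Surjections, cofinal maps and cardinals\<close>

lemma dterm_if: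
  assumes "definable \<phi>" "dterm \<tau>" "dterm \<sigma>"
  shows "dterm (\<lambda>s. if \<phi> s then \<tau> s else \<sigma> s)"
proof -
  have "definable (\<lambda>s. (\<phi> (\<lambda>i. s (Suc i)) \<and> s 0 = \<tau> (\<lambda>i. s (Suc i))) \<or>
      (\<not> \<phi> (\<lambda>i. s (Suc i)) \<and> s 0 = \<sigma> (\<lambda>i. s (Suc i))))"
    by (intro definable_disj definable_conj definable_not definable_ren[OF assms(1)] assms(2,3)[unfolded dterm_def])
  then show ?thesis
    unfolding dterm_def by (rule definable_iff_cong) auto
qed

lemma definable_functional: "dterm \<tau> \<Longrightarrow> definable (\<lambda>s. functional (\<tau> s))"
  by (rule definable_subst1[where P=functional]) (unfold functional_def, intro definable_rules)

text \<open>The first description also records that every member is a pair, as needed for functions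
  and for subsets of a product; the second is the convenient form for reading off values.\<close>

lemma relation_exists:
  assumes "definable (\<lambda>s. R (s 0) (s (Suc 0)))"
  shows "\<exists>f. (\<forall>p. p \<in> elts f \<longleftrightarrow> (\<exists>x\<in>elts a. \<exists>y\<in>elts b. p = vpair x y \<and> R x y)) \<and>
    (\<forall>x y. vpair x y \<in> elts f \<longleftrightarrow> x \<in> elts a \<and> y \<in> elts b \<and> R x y)"
proof -
  have D: "definable (\<lambda>s. \<exists>x\<in>elts a. \<exists>y\<in>elts b. s 0 = vpair x y \<and> R x y)"
    by (intro definable_rules definable_subst2[where P=R, OF assms])
  have "small {p. \<exists>x\<in>elts a. \<exists>y\<in>elts b. p = vpair x y \<and> R x y}"
    by (rule small_sep'[OF D, where x="vtimes a b"]) (auto simp: elts_vtimes)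
  then obtain f where "elts f = {p. \<exists>x\<in>elts a. \<exists>y\<in>elts b. p = vpair x y \<and> R x y}"
    unfolding small_def by blast
  then show ?thesis
    by (intro exI[of _ f]) (auto simp: vpair_inject)
qed

text \<open>The surjection may be partial and may take values outside \<open>b\<close>.\<close>

definition psurj :: "'v::zfc \<Rightarrow> 'v \<Rightarrow> bool" where
  "psurj a b \<longleftrightarrow> (\<exists>f. functional f \<and> (\<forall>y\<in>elts b. \<exists>x\<in>elts a. vpair x y \<in> elts f))"

lemma definable_psurj: "dterm \<tau> \<Longrightarrow> dterm \<sigma> \<Longrightarrow> definable (\<lambda>s. psurj (\<tau> s) (\<sigma> s))"
  by (rule definable_subst2[where P=psurj]) (unfold psurj_def, intro definable_rules definable_functional)

lemma psurjI:
  assumes "definable (\<lambda>s. R (s 0) (s (Suc 0)))"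
    "\<And>x y z. x \<in> elts a \<Longrightarrow> y \<in> elts b \<Longrightarrow> z \<in> elts b \<Longrightarrow> R x y \<Longrightarrow> R x z \<Longrightarrow> y = z"
    "\<And>y. y \<in> elts b \<Longrightarrow> \<exists>x\<in>elts a. R x y"
  shows "psurj a b"
proof -
  obtain f where f: "\<And>x y. vpair x y \<in> elts f \<longleftrightarrow> x \<in> elts a \<and> y \<in> elts b \<and> R x y"
    using relation_exists[OF assms(1), of a b] by blast
  show ?thesis
    unfolding psurj_def
  proof (intro exI[of _ f] conjI)
    show "functional f"
      unfolding functional_def f using assms(2) by blast
    show "\<forall>y\<in>elts b. \<exists>x\<in>elts a. vpair x y \<in> elts f"
      unfolding f using assms(3) by blast
  qed
qed

lemma psurj_subset: "elts b \<subseteq> elts a \<Longrightarrow> psurj a b"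
  by (rule psurjI[where R="(=)"]) (intro definable_rules, auto)

lemma psurj_trans:
  assumes "psurj a b" "psurj b c" shows "psurj a c"
proof -
  obtain f where f: "functional f" "\<forall>y\<in>elts b. \<exists>x\<in>elts a. vpair x y \<in> elts f"
    using assms(1) unfolding psurj_def by blast
  obtain g where g: "functional g" "\<forall>z\<in>elts c. \<exists>y\<in>elts b. vpair y z \<in> elts g"
    using assms(2) unfolding psurj_def by blast
  show ?thesis
  proof (rule psurjI[where R="\<lambda>x z. \<exists>y. vpair x y \<in> elts f \<and> vpair y z \<in> elts g"])
    show "definable (\<lambda>s. \<exists>y. vpair (s 0) y \<in> elts f \<and> vpair y (s (Suc 0)) \<in> elts g)"
      by (intro definable_rules)
    show "y = z" if "\<exists>u. vpair x u \<in> elts f \<and> vpair u y \<in> elts g" "\<exists>u. vpair x u \<in> elts f \<and> vpair u z \<in> elts g"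
      for x y z
      using that f(1) g(1) unfolding functional_def by metis
    show "\<exists>x\<in>elts a. \<exists>u. vpair x u \<in> elts f \<and> vpair u y \<in> elts g" if "y \<in> elts c" for y
      using that f(2) g(2) by blast
  qed
qed

text \<open>Arguments without an \<open>R\<close>-value in \<open>b\<close> receive the default
  value 0. Such extra values harm neither surjectivity nor cofinality, so partial maps can be used
  throughout.\<close>

lemma total_map_exists:
  assumes "definable (\<lambda>s. R (s 0) (s (Suc 0)))" "vset {} \<in> elts b"
    "\<And>x y z. x \<in> elts a \<Longrightarrow> y \<in> elts b \<Longrightarrow> z \<in> elts b \<Longrightarrow> R x y \<Longrightarrow> R x z \<Longrightarrow> y = z"
  shows "\<exists>f. maps_to f a b \<and> (\<forall>x\<in>elts a. \<forall>y\<in>elts b. R x y \<longrightarrow> vpair x y \<in> elts f)"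
proof -
  define R' where "R' x y \<longleftrightarrow> R x y \<or> (\<not> (\<exists>z\<in>elts b. R x z) \<and> y = vset {})" for x y
  have "definable (\<lambda>s. R' (s 0) (s (Suc 0)))"
    unfolding R'_def by (intro definable_rules definable_subst2[where P=R, OF assms(1)])
  from relation_exists[OF this, of a b] obtain f where
    f: "\<And>p. p \<in> elts f \<longleftrightarrow> (\<exists>x\<in>elts a. \<exists>y\<in>elts b. p = vpair x y \<and> R' x y)"
    "\<And>x y. vpair x y \<in> elts f \<longleftrightarrow> x \<in> elts a \<and> y \<in> elts b \<and> R' x y"
    by blast
  have "functional f"
    unfolding functional_def f(2) R'_def using assms(3) by blast
  moreover have "\<exists>y. vpair x y \<in> elts f" if "x \<in> elts a" for x
    unfolding f(2) R'_def using assms(2) that by blast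
  moreover have "\<exists>x\<in>elts a. \<exists>y. p = vpair x y" if "p \<in> elts f" for p
    using that f(1) by blast
  ultimately have "function_on f a"
    unfolding function_on_iff by blast
  then have "maps_to f a b"
    unfolding maps_to_def mem_elts using f(2) by blast
  moreover have "vpair x y \<in> elts f" if "x \<in> elts a" "y \<in> elts b" "R x y" for x y
    unfolding f(2) R'_def using that by blast
  ultimately show ?thesis by blast
qed

lemma maps_to_functional:
  "maps_to f a b \<Longrightarrow> functional f \<and> (\<forall>x y. vpair x y \<in> elts f \<longrightarrow> x \<in> elts a \<and> y \<in> elts b)"
  unfolding maps_to_def mem_elts using function_on_vpair_iff function_on_iff by blast

text \<open>Partial surjections compose and restrict freely. To regain a total map, values outside
  \<kappa> are dropped and gaps are filled with 0, which lies in \<kappa> since \<kappa> has the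
  element \<gamma>.\<close>

lemma cardinal_iff: "cardinal UNIV \<kappa> \<longleftrightarrow> Ord \<kappa> \<and> (\<forall>\<gamma>\<in>elts \<kappa>. \<not> psurj \<gamma> \<kappa>)"
proof -
  have "(\<exists>f. maps_to f \<gamma> \<kappa> \<and> (\<forall>y\<in>elts \<kappa>. \<exists>x. vpair x y \<in>\<^sub>V f)) \<longleftrightarrow> psurj \<gamma> \<kappa>"
    if "Ord \<kappa>" "\<gamma> \<in> elts \<kappa>" for \<gamma>
  proof
    assume "\<exists>f. maps_to f \<gamma> \<kappa> \<and> (\<forall>y\<in>elts \<kappa>. \<exists>x. vpair x y \<in>\<^sub>V f)"
    then obtain f where "maps_to f \<gamma> \<kappa>" "\<forall>y\<in>elts \<kappa>. \<exists>x. vpair x y \<in> elts f"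
      unfolding mem_elts by blast
    then show "psurj \<gamma> \<kappa>"
      unfolding psurj_def using maps_to_functional[of f \<gamma> \<kappa>] by blast
  next
    assume "psurj \<gamma> \<kappa>"
    then obtain g where g: "functional g" "\<forall>y\<in>elts \<kappa>. \<exists>x\<in>elts \<gamma>. vpair x y \<in> elts g"
      unfolding psurj_def by blast
    have "\<exists>f. maps_to f \<gamma> \<kappa> \<and> (\<forall>x\<in>elts \<gamma>. \<forall>y\<in>elts \<kappa>. vpair x y \<in> elts g \<longrightarrow> vpair x y \<in> elts f)"
    proof (rule total_map_exists)
      show "definable (\<lambda>s. vpair (s 0) (s (Suc 0)) \<in> elts g)"
        by (intro definable_rules)
    qed (use empty_mem_Ord that g(1) functional_def in \<open>blast+\<close>)
    then show "\<exists>f. maps_to f \<gamma> \<kappa> \<and> (\<forall>y\<in>elts \<kappa>. \<exists>x. vpair x y \<in>\<^sub>V f)"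
      unfolding mem_elts using g(2) by blast
  qed
  then have "(\<exists>\<gamma>\<in>elts \<kappa>. \<exists>f\<in>UNIV. maps_to f \<gamma> \<kappa> \<and> (\<forall>y\<in>elts \<kappa>. \<exists>x. vpair x y \<in>\<^sub>V f)) \<longleftrightarrow>
      (\<exists>\<gamma>\<in>elts \<kappa>. psurj \<gamma> \<kappa>)" if "Ord \<kappa>"
    using that by simp
  then show ?thesis
    unfolding cardinal_def by blast
qed

lemma inf_cardinal_iff: "inf_cardinal \<kappa> \<longleftrightarrow> Ord \<kappa> \<and> (\<forall>\<gamma>\<in>elts \<kappa>. \<not> psurj \<gamma> \<kappa>) \<and> omega \<le>\<^sub>V \<kappa>"
  by (simp add: inf_cardinal_def cardinal_iff)

lemma definable_inf_cardinal: "dterm \<tau> \<Longrightarrow> definable (\<lambda>s. inf_cardinal (\<tau> s))"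
  by (rule definable_subst1[where P=inf_cardinal]) (unfold inf_cardinal_iff, intro definable_rules definable_Ord definable_psurj)

lemma cofinal_mapI:
  assumes "definable (\<lambda>s. R (s 0) (s (Suc 0)))" "Ord \<alpha>" "elts \<alpha> \<noteq> {}"
    "\<And>x y z. x \<in> elts \<gamma> \<Longrightarrow> y \<in> elts \<alpha> \<Longrightarrow> z \<in> elts \<alpha> \<Longrightarrow> R x y \<Longrightarrow> R x z \<Longrightarrow> y = z"
    "\<And>\<xi>. \<xi> \<in> elts \<alpha> \<Longrightarrow> \<exists>\<zeta>\<in>elts \<gamma>. \<exists>\<eta>\<in>elts \<alpha>. R \<zeta> \<eta> \<and> \<xi> \<le>\<^sub>V \<eta>"
  shows "\<exists>f. cofinal_map f \<gamma> \<alpha>"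
proof -
  have "vset {} \<in> elts \<alpha>"
    using assms(2,3) empty_mem_Ord by blast
  then have "\<exists>f. maps_to f \<gamma> \<alpha> \<and> (\<forall>x\<in>elts \<gamma>. \<forall>y\<in>elts \<alpha>. R x y \<longrightarrow> vpair x y \<in> elts f)"
    by (rule total_map_exists[OF assms(1)]) (rule assms(4))
  then obtain f where f: "maps_to f \<gamma> \<alpha>"
    "\<forall>x\<in>elts \<gamma>. \<forall>y\<in>elts \<alpha>. R x y \<longrightarrow> vpair x y \<in> elts f"
    by blast
  have "cofinal_map f \<gamma> \<alpha>"
    unfolding cofinal_map_def mem_elts using f assms(5) by blast
  then show ?thesis by blast
qed

lemma cofinal_mapD:
  assumes "cofinal_map f \<gamma> \<alpha>"
  shows "functional f" "\<And>x y. vpair x y \<in> elts f \<Longrightarrow> x \<in> elts \<gamma> \<and> y \<in> elts \<alpha>"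
    "\<And>\<xi>. \<xi> \<in> elts \<alpha> \<Longrightarrow> \<exists>\<zeta> \<eta>. vpair \<zeta> \<eta> \<in> elts f \<and> \<xi> \<le>\<^sub>V \<eta>"
  using assms maps_to_functional[of f \<gamma> \<alpha>] unfolding cofinal_map_def mem_elts by blast+

text \<open>Hilbert's hotel: 0 goes to the new point \<kappa>, k+1 goes to k for natural k, and all
  ordinals from \<omega> on stay fixed.\<close>

lemma psurj_vsucc:
  assumes "Ord \<kappa>" "omega \<le>\<^sub>V \<kappa>"
  shows "psurj \<kappa> (vsucc \<kappa>)"
proof -
  have w: "k \<in> elts \<kappa>" if "k \<in> elts omega" for k
    using that mem_le_trans assms by blast
  show ?thesis
  proof (rule psurjI[where R="\<lambda>x y. (x = vset {} \<and> y = \<kappa>) \<or> (y \<in> elts omega \<and> x = vsucc y)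
        \<or> (x \<notin> elts omega \<and> y = x)"])
    show "definable (\<lambda>s. (s 0 = vset {} \<and> s (Suc 0) = \<kappa>) \<or> (s (Suc 0) \<in> elts omega \<and> s 0 = vsucc (s (Suc 0)))
        \<or> (s 0 \<notin> elts omega \<and> s (Suc 0) = s 0))"
      by (intro definable_rules)
  next
    fix y assume "y \<in> elts (vsucc \<kappa>)"
    then consider "y = \<kappa>" | "y \<in> elts omega" | "y \<in> elts \<kappa>" "y \<notin> elts omega"
      by (auto simp: elts_vsucc)
    then show "\<exists>x\<in>elts \<kappa>. (x = vset {} \<and> y = \<kappa>) \<or> (y \<in> elts omega \<and> x = vsucc y) \<or> (x \<notin> elts omega \<and> y = x)"
      using w Limit_empty[OF omega(1)] Limit_vsucc[OF omega(1)] by cases blast+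
  next
    fix x y z
    have "vset {} \<in> elts omega" "\<And>y. y \<in> elts omega \<Longrightarrow> vsucc y \<in> elts omega"
      using Limit_empty[OF omega(1)] Limit_vsucc[OF omega(1)] by blast+
    moreover have "Ord y" if "y \<in> elts omega" for y
      using that Ord_mem Ord_omega by blast
    moreover have "vset {} \<noteq> vsucc y" for y :: 'a
      using vsucc_ne_empty by metis
    moreover assume "(x = vset {} \<and> y = \<kappa>) \<or> (y \<in> elts omega \<and> x = vsucc y) \<or> (x \<notin> elts omega \<and> y = x)"
      "(x = vset {} \<and> z = \<kappa>) \<or> (z \<in> elts omega \<and> x = vsucc z) \<or> (x \<notin> elts omega \<and> z = x)"
    ultimately show "y = z"
      using vsucc_ne_empty by (elim disjE conjE) (auto dest: vsucc_inject[rotated])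
  qed
qed

text \<open>An infinite ordinal can be mapped onto its successor, so no infinite successor ordinal
  is a cardinal.\<close>

lemma inf_cardinal_Limit:
  assumes "inf_cardinal \<kappa>" shows "Limit \<kappa>"
proof (rule ccontr)
  assume nl: "\<not> Limit \<kappa>"
  have k: "Ord \<kappa>" "\<And>\<gamma>. \<gamma> \<in> elts \<kappa> \<Longrightarrow> \<not> psurj \<gamma> \<kappa>" "omega \<le>\<^sub>V \<kappa>"
    using assms unfolding inf_cardinal_iff by blast+
  then have w: "omega \<in> elts \<kappa>"
    using nl omega(1) unfolding ord_le_def mem_elts by metis
  then obtain \<delta> where d: "\<kappa> = vsucc \<delta>"
    using Limit_or_vsucc[OF k(1) _ nl] elts_empty by (metis emptyE)
  then have "omega \<le>\<^sub>V \<delta>" "\<delta> \<in> elts \<kappa>"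
    using w by (auto simp: mem_vsucc le_refl)
  moreover from this have "Ord \<delta>"
    using k(1) Ord_mem by blast
  ultimately show False
    using psurj_vsucc k(2) d by blast
qed

lemma omega_inf_cardinal: "inf_cardinal omega"
proof -
  have "\<not> psurj k omega" if "k \<in> elts omega" for k :: 'a
  proof (rule omega_induct[where P="\<lambda>k. \<not> psurj k omega", OF _ that])
    show "definable (\<lambda>s. \<not> psurj (s 0) (omega :: 'a))"
      by (intro definable_rules definable_psurj)
    show "\<not> psurj (vset {}) (omega :: 'a)"
      unfolding psurj_def using Limit_empty[OF omega(1)] by (auto simp: elts_empty)
  next
    fix k :: 'a assume "k \<in> elts omega" and IH: "\<not> psurj k omega"
    show "\<not> psurj (vsucc k) omega"
    proof
      assume "psurj (vsucc k) omega"
      then obtain f where f: "functional f" "\<forall>y\<in>elts omega. \<exists>x\<in>elts (vsucc k). vpair x y \<in> elts f"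
        unfolding psurj_def by blast
      have fu: "y = z" if "vpair x y \<in> elts f" "vpair x z \<in> elts f" for x y z
        using that f(1) unfolding functional_def by blast
      \<comment> \<open>\<open>m\<close> is the value at the argument \<open>k\<close> that is to be
        removed. The default \<open>omega\<close> stands for the case of no natural value there:
        then all naturals lie below \<open>m\<close> and nothing is shifted.\<close>
      obtain m where m: "m \<in> elts omega \<or> m = omega"
        "\<And>y. y \<in> elts omega \<Longrightarrow> vpair k y \<in> elts f \<Longrightarrow> y = m"
      proof (cases "\<exists>y\<in>elts omega. vpair k y \<in> elts f")
        case True
        then obtain y where y: "y \<in> elts omega" "vpair k y \<in> elts f" by blast
        show ?thesis
          by (rule that[of y]) (use y fu in blast)+
      qed (use that[of omega] in blast)
      have om: "Ord m"
        using m(1) Ord_omega Ord_mem by blast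
      \<comment> \<open>Values below \<open>m\<close> are kept and those above \<open>m\<close> are
        lowered by one, which closes the gap left by \<open>m\<close>. The clause on
        \<open>vsucc y\<close> rules out a mixed pair of cases in the check of
        single-valuedness.\<close>
      have "psurj k omega"
      proof (rule psurjI[where R="\<lambda>x y. (y \<in> elts m \<and> vpair x y \<in> elts f) \<or> (y \<notin> elts m \<and> vpair x (vsucc y) \<in> elts f \<and> vsucc y \<notin> elts m)"])
        show "definable (\<lambda>s. (s (Suc 0) \<in> elts m \<and> vpair (s 0) (s (Suc 0)) \<in> elts f) \<or>
            (s (Suc 0) \<notin> elts m \<and> vpair (s 0) (vsucc (s (Suc 0))) \<in> elts f \<and> vsucc (s (Suc 0)) \<notin> elts m))"
          by (intro definable_rules)
      next
        fix x y z :: 'a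
        assume "x \<in> elts k" "y \<in> elts omega" "z \<in> elts omega"
        then have "Ord y"
          using Ord_mem Ord_omega by blast
        moreover assume "(y \<in> elts m \<and> vpair x y \<in> elts f) \<or> (y \<notin> elts m \<and> vpair x (vsucc y) \<in> elts f \<and> vsucc y \<notin> elts m)"
          "(z \<in> elts m \<and> vpair x z \<in> elts f) \<or> (z \<notin> elts m \<and> vpair x (vsucc z) \<in> elts f \<and> vsucc z \<notin> elts m)"
        ultimately show "y = z"
          using fu[of x y z] fu[of x "vsucc y" "vsucc z"] fu[of x y "vsucc z"] fu[of x "vsucc y" z]
            vsucc_inject[of y z] by fastforce
      next
        fix y :: 'a assume y: "y \<in> elts omega"
        then have oy: "Ord y"
          using Ord_mem Ord_omega by blast
        have sy: "vsucc y \<in> elts omega"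
          using y Limit_vsucc[OF omega(1)] by blast
        show "\<exists>x\<in>elts k. (y \<in> elts m \<and> vpair x y \<in> elts f) \<or> (y \<notin> elts m \<and> vpair x (vsucc y) \<in> elts f \<and> vsucc y \<notin> elts m)"
        proof (cases "y \<in> elts m")
          case True
          obtain x where x: "x \<in> elts (vsucc k)" "vpair x y \<in> elts f"
            using f(2) y by blast
          then have "x \<noteq> k"
            using m(2)[OF y] True mem_irrefl by blast
          with x True show ?thesis
            by (auto simp: elts_vsucc)
        next
          case False
          obtain x where x: "x \<in> elts (vsucc k)" "vpair x (vsucc y) \<in> elts f"
            using f(2) sy by blast
          have "x \<noteq> k"
            using m(2)[OF sy] x(2) False elts_vsucc[of y] by auto
          moreover have "vsucc y \<notin> elts m"
            using False Ord_trans[OF om, of y "vsucc y"] by (auto simp: elts_vsucc)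
          ultimately show ?thesis
            using x False by (auto simp: elts_vsucc)
        qed
      qed
      with IH show False by blast
    qed
  qed
  then show ?thesis
    unfolding inf_cardinal_iff using Ord_omega le_refl by blast
qed

section \<open>Successor cardinals and alephs\<close>

text \<open>A surjection from \<open>\<kappa>\<close> onto an ordinal is determined by the prewellorder it induces on its domain,
  so Replacement applied to the subsets of \<open>\<kappa> \<times> \<kappa>\<close> yields the set of all ordinals onto which
  \<open>\<kappa>\<close> can be mapped.\<close>

definition prewo :: "'v::zfc \<Rightarrow> 'v \<Rightarrow> 'v \<Rightarrow> 'v \<Rightarrow> bool" where
  "prewo \<kappa> f r \<beta> \<longleftrightarrow> Ord \<beta> \<and> functional f \<and>
    (\<forall>x u. vpair x u \<in> elts f \<longrightarrow> x \<in> elts \<kappa> \<and> u \<in> elts \<beta>) \<and>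
    (\<forall>u\<in>elts \<beta>. \<exists>x. vpair x u \<in> elts f) \<and>
    (\<forall>x y. vpair x y \<in> elts r \<longleftrightarrow> (\<exists>u v. vpair x u \<in> elts f \<and> vpair y v \<in> elts f \<and> u \<le>\<^sub>V v))"

lemma prewoD:
  assumes "prewo \<kappa> f r \<beta>"
  shows "Ord \<beta>" "functional f" "\<And>x u. vpair x u \<in> elts f \<Longrightarrow> u \<in> elts \<beta>"
    "\<And>u. u \<in> elts \<beta> \<Longrightarrow> \<exists>x. vpair x u \<in> elts f"
    "\<And>x y. vpair x y \<in> elts r \<longleftrightarrow> (\<exists>u v. vpair x u \<in> elts f \<and> vpair y v \<in> elts f \<and> u \<le>\<^sub>V v)"
  using assms unfolding prewo_def by blast+

text \<open>The reflexive points of \<open>r\<close> recover the domain of \<open>f\<close>, so any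
  two maps inducing \<open>r\<close> have the same domain.\<close>

lemma prewo_domain:
  assumes "prewo \<kappa> f r \<beta>"
  shows "vpair x x \<in> elts r \<longleftrightarrow> (\<exists>u. vpair x u \<in> elts f)"
  unfolding prewoD(5)[OF assms] using le_refl by blast

text \<open>The value at x is the set of values at strictly earlier points, and \<open>r\<close>
  alone determines which points are earlier. Induction on the value therefore shows that both maps
  agree.\<close>

lemma prewo_value:
  assumes f: "prewo \<kappa> f r \<beta>" and g: "prewo \<kappa> g r \<beta>'"
    and "vpair x u \<in> elts f" "vpair x u' \<in> elts g"
  shows "u = u'"
proof -
  note f' = prewoD[OF f]
  note g' = prewoD[OF g]
  have r: "u \<le>\<^sub>V v \<longleftrightarrow> u' \<le>\<^sub>V v'" if "vpair x u \<in> elts f" "vpair y v \<in> elts f"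
    "vpair x u' \<in> elts g" "vpair y v' \<in> elts g" for x y u v u' v'
  proof -
    have "vpair x y \<in> elts r \<longleftrightarrow> u \<le>\<^sub>V v"
      using that(1,2) f'(2) unfolding f'(5) functional_def by metis
    moreover have "vpair x y \<in> elts r \<longleftrightarrow> u' \<le>\<^sub>V v'"
      using that(3,4) g'(2) unfolding g'(5) functional_def by metis
    ultimately show ?thesis by simp
  qed
  have dom: "(\<exists>u. vpair x u \<in> elts f) \<longleftrightarrow> (\<exists>u. vpair x u \<in> elts g)" for x
    using prewo_domain[OF f] prewo_domain[OF g] by simp
  have nle: "\<not> u \<le>\<^sub>V v \<longleftrightarrow> v \<in> elts u" if "Ord u" "Ord v" for u v :: 'a
    using Ord_not_mem_iff[OF that(2,1)] by blast
  have "\<forall>x u'. vpair x u \<in> elts f \<longrightarrow> vpair x u' \<in> elts g \<longrightarrow> u = u'"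
  proof (rule Ord_induct[where P="\<lambda>u. \<forall>x u'. vpair x u \<in> elts f \<longrightarrow> vpair x u' \<in> elts g \<longrightarrow> u = u'"])
    show "definable (\<lambda>s. \<forall>x u'. vpair x (s 0) \<in> elts f \<longrightarrow> vpair x u' \<in> elts g \<longrightarrow> s 0 = u')"
      by (intro definable_rules)
    show "Ord u"
      using f' assms(3) Ord_mem by blast
  next
    fix u assume IH: "\<And>v. v \<in> elts u \<Longrightarrow> \<forall>x u'. vpair x v \<in> elts f \<longrightarrow> vpair x u' \<in> elts g \<longrightarrow> v = u'"
    show "\<forall>x u'. vpair x u \<in> elts f \<longrightarrow> vpair x u' \<in> elts g \<longrightarrow> u = u'"
    proof (intro allI impI)
      fix x u' assume x: "vpair x u \<in> elts f" "vpair x u' \<in> elts g"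
      have ou: "Ord u" "Ord u'"
        using f'(1) g'(1) f'(3)[OF x(1)] g'(3)[OF x(2)] Ord_mem by blast+
      have less: "v \<in> elts u \<longleftrightarrow> w \<in> elts u'" if y: "vpair y v \<in> elts f" "vpair y w \<in> elts g" for y v w
      proof -
        have "Ord v" "Ord w"
          using f'(1) g'(1) f'(3)[OF y(1)] g'(3)[OF y(2)] Ord_mem by blast+
        then show ?thesis
          using r[OF x(1) y(1) x(2) y(2)] nle ou by metis
      qed
      have "v \<in> elts u \<longleftrightarrow> v \<in> elts u'" for v
      proof
        assume v: "v \<in> elts u"
        then obtain y where y: "vpair y v \<in> elts f"
          using f'(4) Ord_trans[OF f'(1) v] f'(3)[OF x(1)] by blast
        then obtain w where w: "vpair y w \<in> elts g"
          using dom by blast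
        with y v IH have "v = w" by blast
        with less[OF y w] v show "v \<in> elts u'" by simp
      next
        assume v: "v \<in> elts u'"
        then obtain y where y: "vpair y v \<in> elts g"
          using g'(4) Ord_trans[OF g'(1) v] g'(3)[OF x(2)] by blast
        then obtain w where w: "vpair y w \<in> elts f"
          using dom by blast
        with less[OF w y] v have "w \<in> elts u" by simp
        moreover from this w y IH have "w = v" by blast
        ultimately show "v \<in> elts u" by simp
      qed
      then show "u = u'"
        by (intro elts_inject) blast
    qed
  qed
  with assms(3,4) show ?thesis by blast
qed

lemma prewo_subset:
  assumes f: "prewo \<kappa> f r \<beta>" and g: "prewo \<kappa> g r \<beta>'"
  shows "elts \<beta> \<subseteq> elts \<beta>'"
proof
  fix u assume "u \<in> elts \<beta>"
  then obtain x where x: "vpair x u \<in> elts f"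
    using prewoD(4)[OF f] by blast
  then obtain w where w: "vpair x w \<in> elts g"
    using prewo_domain[OF f, of x] prewo_domain[OF g, of x] by blast
  show "u \<in> elts \<beta>'"
    using prewo_value[OF f g x w] prewoD(3)[OF g w] by simp
qed

lemma prewo_unique: "prewo \<kappa> f r \<beta> \<Longrightarrow> prewo \<kappa> g r \<beta>' \<Longrightarrow> \<beta> = \<beta>'"
  by (rule elts_inject) (simp add: prewo_subset subset_antisym)

lemma prewo_exists:
  assumes "Ord \<beta>" "psurj \<kappa> \<beta>"
  shows "\<exists>f r. elts r \<subseteq> elts (vtimes \<kappa> \<kappa>) \<and> prewo \<kappa> f r \<beta>"
proof -
  obtain g where g: "functional g" "\<forall>y\<in>elts \<beta>. \<exists>x\<in>elts \<kappa>. vpair x y \<in> elts g"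
    using assms(2) unfolding psurj_def by blast
  have "definable (\<lambda>s. vpair (s 0) (s (Suc 0)) \<in> elts g)"
    by (intro definable_rules)
  from relation_exists[where R="\<lambda>x y. vpair x y \<in> elts g", OF this, of \<kappa> \<beta>]
  obtain f where f: "\<And>x y. vpair x y \<in> elts f \<longleftrightarrow> x \<in> elts \<kappa> \<and> y \<in> elts \<beta> \<and> vpair x y \<in> elts g"
    by blast
  define R where "R x y \<longleftrightarrow> (\<exists>u v. vpair x u \<in> elts f \<and> vpair y v \<in> elts f \<and> u \<le>\<^sub>V v)" for x y
  have "definable (\<lambda>s. R (s 0) (s (Suc 0)))"
    unfolding R_def by (intro definable_rules)
  from relation_exists[OF this, of \<kappa> \<kappa>]
  obtain r where r: "\<And>p. p \<in> elts r \<longleftrightarrow> (\<exists>x\<in>elts \<kappa>. \<exists>y\<in>elts \<kappa>. p = vpair x y \<and> R x y)"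
    "\<And>x y. vpair x y \<in> elts r \<longleftrightarrow> x \<in> elts \<kappa> \<and> y \<in> elts \<kappa> \<and> R x y"
    by blast
  have "elts r \<subseteq> elts (vtimes \<kappa> \<kappa>)"
    unfolding elts_vtimes subset_iff r(1) mem_Collect_eq by blast
  moreover have "functional f"
    using g(1) unfolding functional_def f by blast
  moreover have "\<forall>u\<in>elts \<beta>. \<exists>x. vpair x u \<in> elts f"
    using g(2) unfolding f by blast
  moreover have "R x y \<Longrightarrow> x \<in> elts \<kappa> \<and> y \<in> elts \<kappa>" for x y
    unfolding R_def f by blast
  then have "vpair x y \<in> elts r \<longleftrightarrow> R x y" for x y
    using r(2) by blast
  moreover have "\<forall>x u. vpair x u \<in> elts f \<longrightarrow> x \<in> elts \<kappa> \<and> u \<in> elts \<beta>"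
    using f by simp
  ultimately have "elts r \<subseteq> elts (vtimes \<kappa> \<kappa>) \<and> prewo \<kappa> f r \<beta>"
    unfolding prewo_def R_def[symmetric] using assms(1) by simp
  then show ?thesis by blast
qed

section \<open>Hartogs numbers and the finite levels of the aleph hierarchy\<close>

lemma hartogs:
  obtains h where "Ord h" "\<And>\<beta>. \<beta> \<in> elts h \<longleftrightarrow> Ord \<beta> \<and> psurj \<kappa> \<beta>"
proof -
  define P where "P = vset {r. elts r \<subseteq> elts (vtimes \<kappa> \<kappa>)}"
  have P: "elts P = {r. elts r \<subseteq> elts (vtimes \<kappa> \<kappa>)}"
    unfolding P_def by (rule elts_vset[OF small_Pow])
  have "small {\<beta>. \<exists>r\<in>elts P. \<exists>f. prewo \<kappa> f r \<beta>}"
  proof (rule small_repl)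
    show "definable (\<lambda>s. \<exists>f. prewo \<kappa> f (s 0) (s (Suc 0)))"
      unfolding prewo_def by (intro definable_rules definable_Ord definable_functional)
  qed (use prewo_unique in blast)
  then obtain h where h: "elts h = {\<beta>. \<exists>r\<in>elts P. \<exists>f. prewo \<kappa> f r \<beta>}"
    unfolding small_def by blast
  have m: "\<beta> \<in> elts h \<longleftrightarrow> Ord \<beta> \<and> psurj \<kappa> \<beta>" for \<beta>
  proof
    assume "\<beta> \<in> elts h"
    then obtain r f where f: "prewo \<kappa> f r \<beta>"
      unfolding h by blast
    then have "psurj \<kappa> \<beta>"
      unfolding psurj_def prewo_def by blast
    with f show "Ord \<beta> \<and> psurj \<kappa> \<beta>"
      unfolding prewo_def by blast
  next
    assume "Ord \<beta> \<and> psurj \<kappa> \<beta>"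
    then show "\<beta> \<in> elts h"
      unfolding h P using prewo_exists by blast
  qed
  have "Ord h"
  proof (rule OrdI)
    fix x y assume x: "x \<in> elts y" and "y \<in> elts h"
    then have y: "Ord y" "psurj \<kappa> y"
      using m by blast+
    then have "elts x \<subseteq> elts y"
      using Ord_trans x by blast
    then have "psurj \<kappa> x"
      using psurj_trans[OF y(2)] psurj_subset by blast
    then show "x \<in> elts h"
      using m x y Ord_mem by blast
  qed (use m in blast)
  then show ?thesis
    using that m by blast
qed

text \<open>The matrix of the description defining \<open>aleph\<close>. As a relation it is
  definable, so existence can be shown by internal induction before the description is
  evaluated.\<close>

definition is_aleph :: "'v::zfc \<Rightarrow> 'v \<Rightarrow> bool" where
  "is_aleph i \<kappa> \<longleftrightarrow> inf_cardinal \<kappa> \<and> (\<exists>f. enumerates f i {\<mu>. \<mu> \<in>\<^sub>V \<kappa> \<and> inf_cardinal \<mu>})"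

lemma definable_is_aleph: "dterm \<tau> \<Longrightarrow> dterm \<sigma> \<Longrightarrow> definable (\<lambda>s. is_aleph (\<tau> s) (\<sigma> s))"
  by (rule definable_subst2[where P=is_aleph]) (unfold is_aleph_def, intro definable_rules definable_inf_cardinal definable_enumerates)

lemma inf_cardinal_Ord: "inf_cardinal \<kappa> \<Longrightarrow> Ord \<kappa>"
  by (simp add: inf_cardinal_iff)

lemma is_aleph_app:
  assumes "inf_cardinal \<kappa>" and f: "enumerates f i {\<mu>. \<mu> \<in>\<^sub>V \<kappa> \<and> inf_cardinal \<mu>}" and "Ord i" "\<zeta> \<in> elts i"
  shows "is_aleph \<zeta> (app f \<zeta>)" "app f \<zeta> \<in> elts \<kappa>"
proof -
  have m: "app f \<zeta> \<in> elts \<kappa>" "inf_cardinal (app f \<zeta>)"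
    using f \<open>\<zeta> \<in> elts i\<close> by (auto simp: enumerates_iff mem_elts)
  have "{y \<in> {\<mu>. \<mu> \<in>\<^sub>V \<kappa> \<and> inf_cardinal \<mu>}. y \<in> elts (app f \<zeta>)} = {\<mu>. \<mu> \<in>\<^sub>V app f \<zeta> \<and> inf_cardinal \<mu>}"
    using Ord_trans[OF inf_cardinal_Ord[OF assms(1)] _ m(1)] unfolding mem_elts by blast
  then have "\<exists>g. enumerates g \<zeta> {\<mu>. \<mu> \<in>\<^sub>V app f \<zeta> \<and> inf_cardinal \<mu>}"
    using enumerates_restrict[OF f _ \<open>Ord i\<close> \<open>\<zeta> \<in> elts i\<close>] inf_cardinal_Ord by auto
  with m show "is_aleph \<zeta> (app f \<zeta>)" "app f \<zeta> \<in> elts \<kappa>"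
    unfolding is_aleph_def by blast+
qed

lemma is_aleph_less:
  assumes "is_aleph i \<kappa>" "Ord i" "\<zeta> \<in> elts i"
  shows "\<exists>\<mu>\<in>elts \<kappa>. is_aleph \<zeta> \<mu>"
  using assms is_aleph_app unfolding is_aleph_def[of i] by blast

lemma is_aleph_below:
  assumes "is_aleph i \<kappa>" "Ord i" "inf_cardinal \<mu>" "\<mu> \<in> elts \<kappa>"
  shows "\<exists>\<zeta>\<in>elts i. is_aleph \<zeta> \<mu>"
proof -
  obtain f where f: "inf_cardinal \<kappa>" "enumerates f i {\<mu>. \<mu> \<in>\<^sub>V \<kappa> \<and> inf_cardinal \<mu>}"
    using assms(1) unfolding is_aleph_def by blast
  then have "\<mu> \<in> app f ` elts i"
    using assms(3,4) by (auto simp: enumerates_iff mem_elts)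
  then show ?thesis
    using is_aleph_app(1)[OF f assms(2)] by blast
qed

lemma is_aleph_index:
  assumes "is_aleph i \<kappa>" "is_aleph j \<kappa>" "Ord i" "Ord j"
  shows "i = j"
  using assms enumerates_unique[of _ i "{\<mu>. \<mu> \<in>\<^sub>V \<kappa> \<and> inf_cardinal \<mu>}" _ j] inf_cardinal_Ord
  unfolding is_aleph_def by blast

text \<open>If one candidate were below the other, cutting the enumeration of the larger at the
  smaller would give the smaller an index below \<open>i\<close>, although a cardinal determines its
  index.\<close>

lemma is_aleph_unique:
  assumes "is_aleph i \<kappa>" "is_aleph i \<kappa>'" "Ord i"
  shows "\<kappa> = \<kappa>'"
proof -
  have no: False if m: "is_aleph i \<mu>" "is_aleph i \<nu>" "\<mu> \<in> elts \<nu>" for \<mu> \<nu>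
  proof -
    obtain \<zeta> where z: "\<zeta> \<in> elts i" "is_aleph \<zeta> \<mu>"
      using is_aleph_below[OF m(2) assms(3) _ m(3)] m(1) unfolding is_aleph_def by blast
    then have "\<zeta> = i"
      using is_aleph_index[OF z(2) m(1)] assms(3) Ord_mem by blast
    with z(1) mem_irrefl show False by blast
  qed
  have "Ord \<kappa>" "Ord \<kappa>'"
    using assms inf_cardinal_Ord unfolding is_aleph_def by blast+
  then show ?thesis
    using Ord_linear no assms(1,2) by blast
qed

lemma is_aleph_zero: "is_aleph (vset {}) omega"
proof -
  have "{\<mu>. \<mu> \<in>\<^sub>V omega \<and> inf_cardinal \<mu>} = ({} :: 'a set)"
    using Ord_not_mem_iff[of _ omega] Ord_omega unfolding inf_cardinal_iff mem_elts by blast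
  moreover have "enumerates (vset {}) (vset {}) ({} :: 'a set)"
    by (simp add: enumerates_iff function_on_iff functional_def elts_empty)
  ultimately show ?thesis
    unfolding is_aleph_def using omega_inf_cardinal by metis
qed

text \<open>A surjection onto \<open>h\<close> from some member of \<open>h\<close> would compose
  with one from \<kappa> onto that member and put \<open>h\<close> into itself. Infinite cardinals
  in \<open>h\<close> are images of \<kappa> and hence at most \<kappa>.\<close>

lemma hartogs_inf_cardinal:
  assumes "inf_cardinal \<kappa>" "Ord h" and h: "\<And>\<beta>. \<beta> \<in> elts h \<longleftrightarrow> Ord \<beta> \<and> psurj \<kappa> \<beta>"
  shows "inf_cardinal h" "\<kappa> \<in> elts h" "\<And>\<mu>. inf_cardinal \<mu> \<Longrightarrow> \<mu> \<in> elts h \<longleftrightarrow> \<mu> \<le>\<^sub>V \<kappa>"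
proof -
  have k: "Ord \<kappa>" "omega \<le>\<^sub>V \<kappa>"
    using assms(1) unfolding inf_cardinal_iff by blast+
  show kh: "\<kappa> \<in> elts h"
    using h k psurj_subset by blast
  have "\<not> psurj \<gamma> h" if "\<gamma> \<in> elts h" for \<gamma>
    using that psurj_trans[of \<kappa> \<gamma> h] h[of h] h[of \<gamma>] assms(2) mem_irrefl by blast
  moreover have "omega \<le>\<^sub>V h"
    using le_mem_trans[OF assms(2) k(2) kh] by (rule mem_imp_le)
  ultimately show "inf_cardinal h"
    unfolding inf_cardinal_iff using assms(2) by blast
  show "\<mu> \<in> elts h \<longleftrightarrow> \<mu> \<le>\<^sub>V \<kappa>" if "inf_cardinal \<mu>" for \<mu>
  proof
    assume "\<mu> \<in> elts h"
    then have "psurj \<kappa> \<mu>"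
      using h by blast
    then have "\<kappa> \<notin> elts \<mu>"
      using that unfolding inf_cardinal_iff by blast
    then show "\<mu> \<le>\<^sub>V \<kappa>"
      using Ord_not_mem_iff[OF k(1) inf_cardinal_Ord[OF that]] by blast
  next
    assume "\<mu> \<le>\<^sub>V \<kappa>"
    then show "\<mu> \<in> elts h"
      using le_mem_trans[OF assms(2) _ kh] by blast
  qed
qed

text \<open>The infinite cardinals below the Hartogs number are those below \<kappa> together with
  \<kappa>, so the given enumeration is extended by \<kappa> at index \<open>i\<close>.\<close>

lemma is_aleph_vsucc:
  assumes k: "is_aleph i \<kappa>" and "Ord i" "Ord h" and h: "\<And>\<beta>. \<beta> \<in> elts h \<longleftrightarrow> Ord \<beta> \<and> psurj \<kappa> \<beta>"
  shows "is_aleph (vsucc i) h"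
proof -
  obtain f where kc: "inf_cardinal \<kappa>" and f: "enumerates f i {\<mu>. \<mu> \<in>\<^sub>V \<kappa> \<and> inf_cardinal \<mu>}"
    using k unfolding is_aleph_def by blast
  note hc = hartogs_inf_cardinal[OF kc assms(3) h]
  have "dterm (\<lambda>s. if s 0 \<in> elts i then app f (s 0) else \<kappa>)"
    by (intro dterm_if definable_rules)
  from function_exists[where F="\<lambda>x. if x \<in> elts i then app f x else \<kappa>", OF this, of "vsucc i"]
  obtain g where g: "function_on g (vsucc i)"
    "\<And>x. x \<in> elts (vsucc i) \<Longrightarrow> app g x = (if x \<in> elts i then app f x else \<kappa>)"
    by blast
  have gi: "app g x = app f x" if "x \<in> elts i" for x
    using g(2)[of x] that by (simp add: elts_vsucc)
  have gk: "app g i = \<kappa>"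
    using g(2)[of i] mem_irrefl[of i] by (simp add: elts_vsucc)
  have fi: "app f ` elts i = {\<mu>. \<mu> \<in>\<^sub>V \<kappa> \<and> inf_cardinal \<mu>}"
    using f by (simp add: enumerates_iff)
  have "app g ` elts (vsucc i) = insert \<kappa> (app f ` elts i)"
    using gi gk by (simp add: elts_vsucc)
  also have "\<dots> = {\<mu>. \<mu> \<in>\<^sub>V h \<and> inf_cardinal \<mu>}"
    unfolding fi mem_elts using hc(3) kc by (auto simp: ord_le_def mem_elts)
  finally have 1: "app g ` elts (vsucc i) = {\<mu>. \<mu> \<in>\<^sub>V h \<and> inf_cardinal \<mu>}" .
  have 2: "app g \<xi> \<in> elts (app g \<eta>)" if "\<xi> \<in> elts (vsucc i)" "\<eta> \<in> elts (vsucc i)" "\<xi> \<in> elts \<eta>" for \<xi> \<eta>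
  proof (cases "\<eta> = i")
    case True
    then have "app f \<xi> \<in> elts \<kappa>"
      using fi that(3) unfolding mem_elts by blast
    then show ?thesis
      using True gi gk that(3) by simp
  next
    case False
    then have e: "\<eta> \<in> elts i"
      using that(2) by (simp add: elts_vsucc)
    then have "\<xi> \<in> elts i"
      using that(3) Ord_trans[OF \<open>Ord i\<close>] by blast
    with e that(3) f show ?thesis
      by (simp add: gi enumerates_iff)
  qed
  have "enumerates g (vsucc i) {\<mu>. \<mu> \<in>\<^sub>V h \<and> inf_cardinal \<mu>}"
    unfolding enumerates_iff using g(1) 1 2 by blast
  with hc(1) show ?thesis
    unfolding is_aleph_def by blast
qed

text \<open>The indices are naturals of V, so the induction has no limit case.\<close>

lemma is_aleph_aleph:
  assumes "i \<in> elts omega" shows "is_aleph i (aleph i)"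
proof -
  have "Ord i"
    using assms Ord_mem Ord_omega by blast
  have "\<exists>\<kappa>. is_aleph i \<kappa>"
  proof (rule omega_induct[where P="\<lambda>i. \<exists>\<kappa>. is_aleph i \<kappa>", OF _ assms])
    show "definable (\<lambda>s. \<exists>\<kappa>. is_aleph (s 0) \<kappa>)"
      by (intro definable_rules definable_is_aleph)
    show "\<exists>\<kappa>. is_aleph (vset {}) \<kappa>"
      using is_aleph_zero by blast
  next
    fix k assume k: "k \<in> elts omega" "\<exists>\<kappa>. is_aleph k \<kappa>"
    then obtain \<kappa> where "is_aleph k \<kappa>" by blast
    moreover obtain h where "Ord h" "\<And>\<beta>. \<beta> \<in> elts h \<longleftrightarrow> Ord \<beta> \<and> psurj \<kappa> \<beta>"
      by (rule hartogs[of \<kappa>]) blast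
    ultimately have "is_aleph (vsucc k) h"
      using is_aleph_vsucc k(1) Ord_mem Ord_omega by blast
    then show "\<exists>\<kappa>. is_aleph (vsucc k) \<kappa>" by blast
  qed
  then obtain \<kappa> where "is_aleph i \<kappa>" by blast
  then show ?thesis
    using is_aleph_unique[OF _ _ \<open>Ord i\<close>] unfolding aleph_def is_aleph_def[symmetric] by (metis theI)
qed

lemma aleph_inf_cardinal: "i \<in> elts omega \<Longrightarrow> inf_cardinal (aleph i)"
  using is_aleph_aleph unfolding is_aleph_def by blast

lemma aleph_mono:
  assumes "i \<in> elts j" "j \<in> elts omega"
  shows "aleph i \<in> elts (aleph j)"
proof -
  have "Ord j" "Ord i" "i \<in> elts omega"
    using assms Ord_trans[OF Ord_omega] Ord_mem Ord_omega by blast+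
  then show ?thesis
    using is_aleph_less[OF is_aleph_aleph[OF assms(2)] _ assms(1)] is_aleph_aleph[of i] is_aleph_unique[of i] by blast
qed

lemma aleph_empty: "aleph (vset {}) = omega"
  using is_aleph_unique[OF is_aleph_aleph is_aleph_zero Ord_empty] Limit_empty[OF omega(1)] by blast

lemma psurj_aleph_vsucc:
  assumes i: "i \<in> elts omega" and b: "\<beta> \<in> elts (aleph (vsucc i))"
  shows "psurj (aleph i) \<beta>"
proof -
  obtain h where h: "Ord h" "\<And>\<beta>. \<beta> \<in> elts h \<longleftrightarrow> Ord \<beta> \<and> psurj (aleph i) \<beta>"
    by (rule hartogs[of "aleph i"]) blast
  have "Ord i"
    using i Ord_mem Ord_omega by blast
  then have "aleph (vsucc i) = h"
    using is_aleph_unique[OF is_aleph_aleph is_aleph_vsucc[OF is_aleph_aleph[OF i] _ h]]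
      Limit_vsucc[OF omega(1) i] Ord_vsucc by blast
  with b h(2) show ?thesis by blast
qed

section \<open>Regularity of \<open>\<omega>\<^sub>1\<close>\<close>

text \<open>The walk through \<open>\<omega> \<times> \<omega>\<close> along the square shells \<open>max i j = n\<close>, from \<open>(0, n)\<close> over \<open>(n, n)\<close>
  to \<open>(n, 0)\<close> and on to \<open>(0, n + 1)\<close>; it needs no arithmetic beyond successors.\<close>

definition shell_step :: "'v::zfc \<Rightarrow> 'v \<Rightarrow> 'v \<Rightarrow> 'v \<Rightarrow> bool" where
  "shell_step i j i' j' \<longleftrightarrow> (i \<in> elts j \<and> i' = vsucc i \<and> j' = j) \<or>
    (i \<notin> elts j \<and> j = vsucc j' \<and> i' = i) \<or> (j = vset {} \<and> i' = vset {} \<and> j' = vsucc i)"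

text \<open>The first component is the time of the walk, so that the walk becomes a map from time to
  position and serves as the surjection.\<close>

definition shell_closed :: "'v::zfc \<Rightarrow> bool" where
  "shell_closed r \<longleftrightarrow> vpair (vset {}) (vpair (vset {}) (vset {})) \<in> elts r \<and>
    (\<forall>k\<in>elts omega. \<forall>i\<in>elts omega. \<forall>j\<in>elts omega. \<forall>i'\<in>elts omega. \<forall>j'\<in>elts omega.
      vpair k (vpair i j) \<in> elts r \<longrightarrow> shell_step i j i' j' \<longrightarrow> vpair (vsucc k) (vpair i' j') \<in> elts r)"

lemma definable_shell_closed: "definable (\<lambda>s. shell_closed (s 0))"
  unfolding shell_closed_def shell_step_def by (intro definable_rules)

lemma omega_closed: "vset {} \<in> elts omega" "k \<in> elts omega \<Longrightarrow> vsucc k \<in> elts omega"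
  using Limit_empty Limit_vsucc omega(1) by blast+

lemma omega_Ord: "k \<in> elts omega \<Longrightarrow> Ord k"
  using Ord_mem Ord_omega by blast

lemma shell_step_unique:
  assumes "shell_step i j i1 j1" "shell_step i j i2 j2" "j \<in> elts omega"
  shows "i1 = i2 \<and> j1 = j2"
proof (cases "j = vset {}")
  case True
  moreover have "vset {} \<noteq> vsucc m" for m :: 'a
    using vsucc_ne_empty by metis
  ultimately show ?thesis
    using assms unfolding shell_step_def by (auto simp: elts_empty)
next
  case False
  then obtain m where m: "j = vsucc m" "m \<in> elts omega"
    using assms(3) omega_cases by blast
  then have "j1 = m" if "j = vsucc j1" for j1
    using that m(1) vsucc_inject[OF omega_Ord[OF m(2)], of j1] by simp
  then show ?thesis
    using assms(1,2) False unfolding shell_step_def by blast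
qed

text \<open>Recursion along \<open>omega\<close> is replaced by the least closed relation, an
  intersection that Separation yields directly.\<close>

definition shell_walk :: "'v::zfc" where
  "shell_walk = vset {p \<in> elts (vtimes omega (vtimes omega omega)). \<forall>r. shell_closed r \<longrightarrow> p \<in> elts r}"

lemma elts_shell_walk:
  "elts shell_walk = {p \<in> elts (vtimes omega (vtimes omega omega)). \<forall>r. shell_closed r \<longrightarrow> p \<in> elts r}"
  unfolding shell_walk_def
  by (intro elts_vset small_sep definable_rules definable_subst1[where P=shell_closed, OF definable_shell_closed])

lemma omega_triple:
  "vpair k (vpair i j) \<in> elts (vtimes omega (vtimes omega omega)) \<longleftrightarrow>
    k \<in> elts omega \<and> i \<in> elts omega \<and> j \<in> elts omega"
  by (auto simp: elts_vtimes vpair_inject)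

lemma shell_walk_closed: "shell_closed shell_walk"
  unfolding shell_closed_def
proof (intro conjI ballI impI)
  show "vpair (vset {}) (vpair (vset {}) (vset {})) \<in> elts shell_walk"
    unfolding elts_shell_walk mem_Collect_eq omega_triple using omega_closed(1)
    by (simp add: shell_closed_def)
next
  fix k i j i' j' :: 'a
  assume "k \<in> elts omega" "i \<in> elts omega" "j \<in> elts omega" "i' \<in> elts omega" "j' \<in> elts omega"
    and "vpair k (vpair i j) \<in> elts shell_walk" and "shell_step i j i' j'"
  then show "vpair (vsucc k) (vpair i' j') \<in> elts shell_walk"
    unfolding elts_shell_walk mem_Collect_eq omega_triple
    using omega_closed(2) unfolding shell_closed_def by blast
qed

text \<open>Inversion from leastness: an entry that is neither the start nor the result of a step
  could be deleted, and the rest would still be closed.\<close>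

lemma shell_walk_cases:
  assumes "vpair k p \<in> elts shell_walk"
  shows "(k = vset {} \<and> p = vpair (vset {}) (vset {})) \<or>
    (\<exists>l\<in>elts omega. \<exists>i\<in>elts omega. \<exists>j\<in>elts omega. \<exists>i'\<in>elts omega. \<exists>j'\<in>elts omega.
      k = vsucc l \<and> p = vpair i' j' \<and> vpair l (vpair i j) \<in> elts shell_walk \<and> shell_step i j i' j')"
proof (rule ccontr)
  assume n: "\<not> ?thesis"
  define r where "r = vset {z \<in> elts shell_walk. z \<noteq> vpair k p}"
  have r: "z \<in> elts r \<longleftrightarrow> z \<in> elts shell_walk \<and> z \<noteq> vpair k p" for z
  proof -
    have "small {z \<in> elts shell_walk. z \<noteq> vpair k p}"
      by (intro small_sep definable_rules)
    then show ?thesis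
      unfolding r_def by (simp add: elts_vset)
  qed
  note w = shell_walk_closed[unfolded shell_closed_def]
  have "shell_closed r"
    unfolding shell_closed_def
  proof (intro conjI ballI impI)
    show "vpair (vset {}) (vpair (vset {}) (vset {})) \<in> elts r"
      unfolding r vpair_inject using w n by auto
  next
    fix l i j i' j' :: 'a
    assume a: "l \<in> elts omega" "i \<in> elts omega" "j \<in> elts omega" "i' \<in> elts omega" "j' \<in> elts omega"
      and b: "vpair l (vpair i j) \<in> elts r" and c: "shell_step i j i' j'"
    have b': "vpair l (vpair i j) \<in> elts shell_walk"
      using b r by blast
    have "vpair (vsucc l) (vpair i' j') \<in> elts shell_walk"
      using conjunct2[OF w] a b' c by blast
    moreover have "\<not> (k = vsucc l \<and> p = vpair i' j')"
      using n a b' c by blast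
    ultimately show "vpair (vsucc l) (vpair i' j') \<in> elts r"
      unfolding r by (auto simp: vpair_inject)
  qed
  then have "vpair k p \<in> elts r"
    using assms unfolding elts_shell_walk by blast
  then show False
    using r by blast
qed

text \<open>Time k+1 is reached only by a step from the position at time k, and steps are
  deterministic.\<close>

lemma shell_walk_functional: "functional shell_walk"
proof -
  have *: "\<forall>p q. vpair k p \<in> elts shell_walk \<longrightarrow> vpair k q \<in> elts shell_walk \<longrightarrow> p = q"
    if "k \<in> elts omega" for k :: 'a
  proof (rule omega_induct[where P="\<lambda>k. \<forall>p q. vpair k p \<in> elts shell_walk \<longrightarrow> vpair k q \<in> elts shell_walk \<longrightarrow> p = q", OF _ that])
    show "definable (\<lambda>s. \<forall>p q. vpair (s 0) p \<in> elts shell_walk \<longrightarrow> vpair (s 0) q \<in> elts shell_walk \<longrightarrow> p = (q :: 'a))"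
      by (intro definable_rules)
    show "\<forall>p q. vpair (vset {}) p \<in> elts shell_walk \<longrightarrow> vpair (vset {}) q \<in> elts shell_walk \<longrightarrow> p = (q :: 'a)"
    proof (intro allI impI)
      fix p q :: 'a
      assume "vpair (vset {}) p \<in> elts shell_walk" "vpair (vset {}) q \<in> elts shell_walk"
      from this[THEN shell_walk_cases] show "p = q"
        using vsucc_ne_empty by metis
    qed
  next
    fix k :: 'a assume k: "k \<in> elts omega" and
      IH: "\<forall>p q. vpair k p \<in> elts shell_walk \<longrightarrow> vpair k q \<in> elts shell_walk \<longrightarrow> p = q"
    have pred: "\<exists>i\<in>elts omega. \<exists>j\<in>elts omega. \<exists>i' j'. p = vpair i' j' \<and> vpair k (vpair i j) \<in> elts shell_walk \<and> shell_step i j i' j'"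
      if p: "vpair (vsucc k) p \<in> elts shell_walk" for p
    proof -
      obtain l i j i' j' where "l \<in> elts omega" "i \<in> elts omega" "j \<in> elts omega"
        "vsucc k = vsucc l" "p = vpair i' j'" "vpair l (vpair i j) \<in> elts shell_walk" "shell_step i j i' j'"
        using shell_walk_cases[OF p] vsucc_ne_empty[of k] by blast
      moreover from this have "k = l"
        using vsucc_inject[OF omega_Ord[OF k]] by blast
      ultimately show ?thesis by blast
    qed
    show "\<forall>p q. vpair (vsucc k) p \<in> elts shell_walk \<longrightarrow> vpair (vsucc k) q \<in> elts shell_walk \<longrightarrow> p = q"
    proof (intro allI impI)
      fix p q :: 'a
      assume p: "vpair (vsucc k) p \<in> elts shell_walk" and q: "vpair (vsucc k) q \<in> elts shell_walk"
      obtain i j i' j' where 1: "j \<in> elts omega" "p = vpair i' j'" "vpair k (vpair i j) \<in> elts shell_walk" "shell_step i j i' j'"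
        using pred[OF p] by blast
      obtain l m l' m' where 2: "m \<in> elts omega" "q = vpair l' m'" "vpair k (vpair l m) \<in> elts shell_walk" "shell_step l m l' m'"
        using pred[OF q] by blast
      have "vpair i j = vpair l m"
        using IH 1(3) 2(3) by blast
      then have "i = l" "j = m"
        by (simp_all add: vpair_inject)
      then have "i' = l' \<and> j' = m'"
        using shell_step_unique[OF 1(4) _ 1(1)] 2(4) by blast
      then show "p = q"
        using 1(2) 2(2) by simp
    qed
  qed
  show ?thesis
    unfolding functional_def
  proof (intro allI impI)
    fix x y z :: 'a
    assume xy: "vpair x y \<in> elts shell_walk" and xz: "vpair x z \<in> elts shell_walk"
    have "x \<in> elts omega"
      using xy unfolding elts_shell_walk elts_vtimes by (auto simp: vpair_inject)
    with * xy xz show "y = z" by blast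
  qed
qed

lemma psurj_omega_times: "psurj omega (vtimes omega omega)"
proof -
  define Q where "Q i j \<longleftrightarrow> (\<exists>k\<in>elts omega. vpair k (vpair i j) \<in> elts shell_walk)" for i j :: 'a
  have DQ: "dterm \<tau> \<Longrightarrow> dterm \<sigma> \<Longrightarrow> definable (\<lambda>s. Q (\<tau> s) (\<sigma> s))" for \<tau> \<sigma>
    by (rule definable_subst2[where P=Q]) (unfold Q_def, intro definable_rules)
  note w = shell_walk_closed[unfolded shell_closed_def]
  have Q0: "Q (vset {}) (vset {})"
    unfolding Q_def using conjunct1[OF w] omega_closed(1) by blast
  have Qstep: "Q i' j'" if "Q i j" "shell_step i j i' j'"
    "i \<in> elts omega" "j \<in> elts omega" "i' \<in> elts omega" "j' \<in> elts omega" for i j i' j'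
    using that conjunct2[OF w] omega_closed(2) unfolding Q_def by blast
  have up: "i \<le>\<^sub>V n \<longrightarrow> Q i n" if n: "n \<in> elts omega" "Q (vset {}) n" and i: "i \<in> elts omega" for i n
  proof (rule omega_induct[where P="\<lambda>i. i \<le>\<^sub>V n \<longrightarrow> Q i n", OF _ i])
    show "definable (\<lambda>s. s 0 \<le>\<^sub>V n \<longrightarrow> Q (s 0) n)"
      by (intro definable_rules DQ)
    show "vset {} \<le>\<^sub>V n \<longrightarrow> Q (vset {}) n"
      using n by blast
    fix k assume k: "k \<in> elts omega" "k \<le>\<^sub>V n \<longrightarrow> Q k n"
    show "vsucc k \<le>\<^sub>V n \<longrightarrow> Q (vsucc k) n"
    proof
      assume "vsucc k \<le>\<^sub>V n"
      then have "k \<in> elts n"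
        using mem_le_trans[OF omega_Ord[OF n(1)], of k "vsucc k"] by (simp add: elts_vsucc)
      then show "Q (vsucc k) n"
        using Qstep[of k n "vsucc k" n] k n omega_closed(2) mem_imp_le unfolding shell_step_def by blast
    qed
  qed
  \<comment> \<open>The induction is on the height at which the descent starts: one step leads from
    height k+1 to height k, and the hypothesis covers the remainder.\<close>
  have down: "m \<le>\<^sub>V n \<longrightarrow> Q n m \<longrightarrow> (\<forall>j\<in>elts (vsucc m). Q n j)" if n: "n \<in> elts omega" and m: "m \<in> elts omega" for m n
  proof (rule omega_induct[where P="\<lambda>m. m \<le>\<^sub>V n \<longrightarrow> Q n m \<longrightarrow> (\<forall>j\<in>elts (vsucc m). Q n j)", OF _ m])
    show "definable (\<lambda>s. s 0 \<le>\<^sub>V n \<longrightarrow> Q n (s 0) \<longrightarrow> (\<forall>j\<in>elts (vsucc (s 0)). Q n j))"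
      by (intro definable_rules DQ)
    show "vset {} \<le>\<^sub>V n \<longrightarrow> Q n (vset {}) \<longrightarrow> (\<forall>j\<in>elts (vsucc (vset {})). Q n j)"
      by (simp add: elts_vsucc elts_empty)
    fix k assume k: "k \<in> elts omega" "k \<le>\<^sub>V n \<longrightarrow> Q n k \<longrightarrow> (\<forall>j\<in>elts (vsucc k). Q n j)"
    show "vsucc k \<le>\<^sub>V n \<longrightarrow> Q n (vsucc k) \<longrightarrow> (\<forall>j\<in>elts (vsucc (vsucc k)). Q n j)"
    proof (intro impI)
      assume le: "vsucc k \<le>\<^sub>V n" and q: "Q n (vsucc k)"
      have "n \<notin> elts (vsucc k)"
        using Ord_not_mem_iff[OF omega_Ord[OF n] omega_Ord[OF omega_closed(2)[OF k(1)]]] le by blast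
      then have "Q n k"
        using Qstep[of n "vsucc k" n k] q k(1) n omega_closed(2) unfolding shell_step_def by blast
      moreover have "k \<le>\<^sub>V n"
        using le_trans[OF omega_Ord[OF n] _ le, of k] by (simp add: mem_imp_le elts_vsucc)
      ultimately have "\<forall>j\<in>elts (vsucc k). Q n j"
        using k(2) by blast
      with q show "\<forall>j\<in>elts (vsucc (vsucc k)). Q n j"
        unfolding elts_vsucc[of "vsucc k"] by blast
    qed
  qed
  have all_down: "Q n j" if "n \<in> elts omega" "Q (vset {}) n" "j \<le>\<^sub>V n" for n j
  proof -
    have "Q n n"
      using up[OF that(1,2,1)] le_refl by blast
    then show ?thesis
      using down[OF that(1,1)] le_refl[of n] that(3) by (simp add: mem_vsucc)
  qed
  \<comment> \<open>A completed shell ends at (k, 0), from where the third rule enters the next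
    one.\<close>
  have top: "Q (vset {}) n" if "n \<in> elts omega" for n
  proof (rule omega_induct[where P="\<lambda>n. Q (vset {}) n", OF _ that Q0])
    show "definable (\<lambda>s. Q (vset {}) (s 0))"
      by (intro DQ definable_rules)
    fix k assume k: "k \<in> elts omega" "Q (vset {}) k"
    have "vset {} \<le>\<^sub>V k"
      using Ord_subset_le[OF Ord_empty omega_Ord[OF k(1)]] by (simp add: elts_empty)
    then have "Q k (vset {})"
      using all_down k by blast
    then show "Q (vset {}) (vsucc k)"
      using Qstep[of k "vset {}" "vset {}" "vsucc k"] k(1) omega_closed unfolding shell_step_def by blast
  qed
  have all: "Q i j" if "i \<in> elts omega" "j \<in> elts omega" for i j
  proof (cases "j \<in> elts i")
    case True
    then show ?thesis
      using all_down[OF that(1) top[OF that(1)]] mem_imp_le by blast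
  next
    case False
    then have "i \<le>\<^sub>V j"
      using Ord_not_mem_iff[of j i] that omega_Ord by blast
    then show ?thesis
      using up[OF that(2) top[OF that(2)] that(1)] by blast
  qed
  show ?thesis
    unfolding psurj_def
  proof (intro exI conjI ballI)
    show "functional (shell_walk :: 'a)"
      by (rule shell_walk_functional)
    fix p :: 'a assume "p \<in> elts (vtimes omega omega)"
    then obtain i j where "i \<in> elts omega" "j \<in> elts omega" "p = vpair i j"
      unfolding elts_vtimes by blast
    then show "\<exists>k\<in>elts omega. vpair k p \<in> elts shell_walk"
      using all unfolding Q_def by blast
  qed
qed

text \<open>The axiom selects from families of disjoint nonempty sets. Tagging each value with its
  argument makes the fibres of \<open>R\<close> disjoint, and the bound \<open>b\<close> makes them
  sets.\<close>

lemma choice_relation: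
  assumes R: "definable (\<lambda>s. R (s 0) (s (Suc 0)))" and ex: "\<And>x. x \<in> elts a \<Longrightarrow> \<exists>y\<in>elts b. R x y"
  shows "\<exists>f. functional f \<and> (\<forall>x\<in>elts a. \<exists>y\<in>elts b. vpair x y \<in> elts f) \<and>
    (\<forall>x y. vpair x y \<in> elts f \<longrightarrow> R x y)"
proof -
  define P where "P = vset {z. elts z \<subseteq> elts (vtimes a b)}"
  have P: "elts P = {z. elts z \<subseteq> elts (vtimes a b)}"
    unfolding P_def by (rule elts_vset[OF small_Pow])
  define fib where "fib Y x \<longleftrightarrow> (\<forall>p. p \<in> elts Y \<longleftrightarrow> (\<exists>y\<in>elts b. p = vpair x y \<and> R x y))" for Y x
  have definable_fib: "definable (\<lambda>s. \<exists>x\<in>elts a. fib (s 0) x)"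
    unfolding fib_def by (intro definable_rules definable_subst2[where P=R, OF R])
  define F where "F = vset {Y \<in> elts P. \<exists>x\<in>elts a. fib Y x}"
  have F: "Y \<in> elts F \<longleftrightarrow> Y \<in> elts P \<and> (\<exists>x\<in>elts a. fib Y x)" for Y
    unfolding F_def by (simp add: elts_vset small_sep[OF definable_fib])
  have fib_ex: "\<exists>Y\<in>elts F. fib Y x" if x: "x \<in> elts a" for x
  proof -
    have "definable (\<lambda>s. \<exists>y\<in>elts b. s 0 = vpair x y \<and> R x y)"
      by (intro definable_rules definable_subst2[where P=R, OF R])
    then have "small {p. \<exists>y\<in>elts b. p = vpair x y \<and> R x y}"
      by (rule small_sep'[where x="vtimes a b"]) (use x in \<open>auto simp: elts_vtimes\<close>)
    then obtain Y where Y: "elts Y = {p. \<exists>y\<in>elts b. p = vpair x y \<and> R x y}"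
      unfolding small_def by blast
    then have "fib Y x"
      unfolding fib_def by simp
    moreover have "Y \<in> elts P"
      unfolding P elts_vtimes using Y x by blast
    ultimately show ?thesis
      using F x by blast
  qed
  have "\<exists>c. \<forall>Y. Y \<in>\<^sub>V F \<longrightarrow> (\<exists>!z. z \<in>\<^sub>V Y \<and> z \<in>\<^sub>V c)"
  proof (rule ZFC_choice[THEN spec, THEN mp], intro conjI allI impI)
    fix Y assume "Y \<in>\<^sub>V F"
    then obtain x where "x \<in> elts a" "fib Y x"
      using F unfolding mem_elts by blast
    then show "\<exists>z. z \<in>\<^sub>V Y"
      using ex unfolding fib_def mem_elts by blast
  next
    fix Y Y' z assume Y: "Y \<in>\<^sub>V F \<and> Y' \<in>\<^sub>V F \<and> Y \<noteq> Y'" and z: "z \<in>\<^sub>V Y"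
    then obtain x x' where x: "fib Y x" "fib Y' x'"
      using F unfolding mem_elts by blast
    show "\<not> z \<in>\<^sub>V Y'"
    proof
      assume "z \<in>\<^sub>V Y'"
      with z x have "x = x'"
        unfolding fib_def mem_elts by (auto simp: vpair_inject)
      with x have "elts Y = elts Y'"
        unfolding fib_def by blast
      with Y show False
        using elts_inject by blast
    qed
  qed
  then obtain c where c: "\<And>Y. Y \<in> elts F \<Longrightarrow> \<exists>!z. z \<in> elts Y \<and> z \<in> elts c"
    unfolding mem_elts by blast
  have "definable (\<lambda>s. R (s 0) (s (Suc 0)) \<and> vpair (s 0) (s (Suc 0)) \<in> elts c)"
    by (intro definable_rules R)
  from relation_exists[where R="\<lambda>x y. R x y \<and> vpair x y \<in> elts c", OF this, of a b]
  obtain f where f: "\<And>x y. vpair x y \<in> elts f \<longleftrightarrow> x \<in> elts a \<and> y \<in> elts b \<and> R x y \<and> vpair x y \<in> elts c"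
    by blast
  have "functional f"
    unfolding functional_def f
  proof (intro allI impI)
    fix x y z assume y: "x \<in> elts a \<and> y \<in> elts b \<and> R x y \<and> vpair x y \<in> elts c"
      and z: "x \<in> elts a \<and> z \<in> elts b \<and> R x z \<and> vpair x z \<in> elts c"
    obtain Y where Y: "Y \<in> elts F" "fib Y x"
      using fib_ex y by blast
    have "vpair x y \<in> elts Y" "vpair x z \<in> elts Y"
      using Y(2) y z unfolding fib_def by blast+
    then have "vpair x y = vpair x z"
      using c[OF Y(1)] y z by blast
    then show "y = z"
      by (simp add: vpair_inject)
  qed
  moreover have "\<exists>y\<in>elts b. vpair x y \<in> elts f" if x: "x \<in> elts a" for x
  proof -
    obtain Y where Y: "Y \<in> elts F" "fib Y x"
      using fib_ex x by blast
    obtain z where z: "z \<in> elts Y" "z \<in> elts c"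
      using c[OF Y(1)] by blast
    then obtain y where "y \<in> elts b" "z = vpair x y" "R x y"
      using Y(2) unfolding fib_def by blast
    then show ?thesis
      using f x z(2) by blast
  qed
  ultimately show ?thesis
    using f by blast
qed

section \<open>The first uncountable cardinal\<close>

abbreviation omega1 :: "'v::zfc" where
  "omega1 \<equiv> aleph (vsucc (vset {}))"

lemma omega1: "inf_cardinal (omega1 :: 'v::zfc)" "omega \<in> elts (omega1 :: 'v)"
  "\<And>\<beta>. \<beta> \<in> elts (omega1 :: 'v) \<Longrightarrow> psurj omega \<beta>"
proof -
  show "inf_cardinal (omega1 :: 'v)"
    by (intro aleph_inf_cardinal omega_closed)
  show "omega \<in> elts (omega1 :: 'v)"
    using aleph_mono[of "vset {}" "vsucc (vset {})"] omega_closed(2)[OF omega_closed(1)] by (simp add: aleph_empty elts_vsucc)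
  show "psurj omega \<beta>" if "\<beta> \<in> elts omega1" for \<beta> :: 'v
    using psurj_aleph_vsucc[OF omega_closed(1) that] by (simp add: aleph_empty)
qed

text \<open>A countable union of countable sets is countable: if \<open>s\<close> maps \<omega> onto
  \<gamma> and h_\<xi> is a chosen map of \<omega> onto k(\<xi>)+1, then (a, b) is sent to the value
  of h_{s(a)} at b, which covers \<open>omega1\<close>.\<close>

lemma omega1_regular:
  assumes "\<gamma> \<in> elts omega1" shows "\<not> cofinal_map k \<gamma> omega1"
proof
  assume k: "cofinal_map k \<gamma> omega1"
  have L: "Limit (omega1 :: 'a)"
    by (rule inf_cardinal_Limit[OF omega1(1)])
  have fk: "function_on k \<gamma>"
    using k unfolding cofinal_map_def maps_to_def by blast
  have km: "app k \<xi> \<in> elts omega1" if "\<xi> \<in> elts \<gamma>" for \<xi>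
    using cofinal_mapD(2)[OF k, of \<xi> "app k \<xi>"] function_on_vpair_iff[OF fk] that by blast
  have kc: "\<exists>\<xi>\<in>elts \<gamma>. \<eta> \<le>\<^sub>V app k \<xi>" if "\<eta> \<in> elts omega1" for \<eta>
    using cofinal_mapD(3)[OF k that] unfolding function_on_vpair_iff[OF fk] by blast
  obtain s where s: "functional s" "\<forall>\<xi>\<in>elts \<gamma>. \<exists>a\<in>elts omega. vpair a \<xi> \<in> elts s"
    using omega1(3)[OF assms] unfolding psurj_def by blast
  \<comment> \<open>Each chosen map covers the successor of the value of \<open>k\<close>, because a
    cofinal map may attain a point without exceeding it.\<close>
  define R where "R \<xi> h \<longleftrightarrow> functional h \<and> (\<forall>y\<in>elts (vsucc (app k \<xi>)). \<exists>a\<in>elts omega. vpair a y \<in> elts h)" for \<xi> h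
  \<comment> \<open>A set of candidates for the choice: the surjections are cut down to subsets of
    this product.\<close>
  define B where "B = vset {z. elts z \<subseteq> elts (vtimes omega (omega1 :: 'a))}"
  have B: "elts B = {z. elts z \<subseteq> elts (vtimes omega omega1)}"
    unfolding B_def by (rule elts_vset[OF small_Pow])
  have "\<exists>F. functional F \<and> (\<forall>\<xi>\<in>elts \<gamma>. \<exists>h\<in>elts B. vpair \<xi> h \<in> elts F) \<and> (\<forall>\<xi> h. vpair \<xi> h \<in> elts F \<longrightarrow> R \<xi> h)"
  proof (rule choice_relation)
    show "definable (\<lambda>s. R (s 0) (s (Suc 0)))"
      unfolding R_def by (intro definable_rules definable_functional)
    fix \<xi> assume "\<xi> \<in> elts \<gamma>"
    then have m: "vsucc (app k \<xi>) \<in> elts omega1"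
      using km Limit_vsucc[OF L] by blast
    then obtain g where g: "functional g" "\<forall>y\<in>elts (vsucc (app k \<xi>)). \<exists>a\<in>elts omega. vpair a y \<in> elts g"
      using omega1(3)[OF m] unfolding psurj_def by blast
    have "definable (\<lambda>s. vpair (s 0) (s (Suc 0)) \<in> elts g)"
      by (intro definable_rules)
    from relation_exists[where R="\<lambda>x y. vpair x y \<in> elts g", OF this, of omega omega1]
    obtain h where h: "\<And>p. p \<in> elts h \<longleftrightarrow> (\<exists>x\<in>elts omega. \<exists>y\<in>elts omega1. p = vpair x y \<and> vpair x y \<in> elts g)"
      "\<And>x y. vpair x y \<in> elts h \<longleftrightarrow> x \<in> elts omega \<and> y \<in> elts omega1 \<and> vpair x y \<in> elts g"
      by blast
    have "h \<in> elts B"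
      unfolding B elts_vtimes mem_Collect_eq subset_iff h(1) by blast
    moreover have "functional h"
      using g(1) unfolding functional_def h(2) by blast
    moreover have "\<exists>a\<in>elts omega. vpair a y \<in> elts h" if y: "y \<in> elts (vsucc (app k \<xi>))" for y
    proof -
      have "y \<in> elts omega1"
        using Ord_trans[OF Limit_Ord[OF L] y m] .
      then show ?thesis
        using g(2) y unfolding h(2) by blast
    qed
    ultimately show "\<exists>h\<in>elts B. R \<xi> h"
      unfolding R_def by blast
  qed
  then obtain F where F: "functional F" "\<forall>\<xi>\<in>elts \<gamma>. \<exists>h\<in>elts B. vpair \<xi> h \<in> elts F"
    "\<And>\<xi> h. vpair \<xi> h \<in> elts F \<Longrightarrow> R \<xi> h"
    by blast
  define S where "S p y \<longleftrightarrow> (\<exists>a b \<xi> h. p = vpair a b \<and> vpair a \<xi> \<in> elts s \<and> vpair \<xi> h \<in> elts F \<and> vpair b y \<in> elts h)" for p y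
  have "psurj (vtimes omega omega) (omega1 :: 'a)"
  proof (rule psurjI)
    show "definable (\<lambda>s. S (s 0) (s (Suc 0)))"
      unfolding S_def by (intro definable_rules)
  next
    fix p y z :: 'a assume "S p y" "S p z"
    then obtain a b \<xi> h a' b' \<xi>' h' where
      1: "p = vpair a b" "vpair a \<xi> \<in> elts s" "vpair \<xi> h \<in> elts F" "vpair b y \<in> elts h" and
      2: "p = vpair a' b'" "vpair a' \<xi>' \<in> elts s" "vpair \<xi>' h' \<in> elts F" "vpair b' z \<in> elts h'"
      unfolding S_def by blast
    have "a = a'" "b = b'"
      using 1(1) 2(1) by (simp_all add: vpair_inject)
    moreover from this have "\<xi> = \<xi>'"
      using s(1) 1(2) 2(2) unfolding functional_def by blast
    moreover from this have "h = h'"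
      using F(1) 1(3) 2(3) unfolding functional_def by blast
    moreover have "functional h"
      using F(3)[OF 1(3)] unfolding R_def by blast
    ultimately show "y = z"
      using 1(4) 2(4) unfolding functional_def by blast
  next
    fix y :: 'a assume "y \<in> elts omega1"
    then obtain \<xi> where x: "\<xi> \<in> elts \<gamma>" "y \<in> elts (vsucc (app k \<xi>))"
      using kc unfolding mem_vsucc by blast
    obtain a where a: "a \<in> elts omega" "vpair a \<xi> \<in> elts s"
      using s(2) x(1) by blast
    obtain h where h: "vpair \<xi> h \<in> elts F"
      using F(2) x(1) by blast
    obtain b where b: "b \<in> elts omega" "vpair b y \<in> elts h"
      using F(3)[OF h] x(2) unfolding R_def by blast
    have "S (vpair a b) y"
      unfolding S_def using a h b by blast
    moreover have "vpair a b \<in> elts (vtimes omega omega)"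
      unfolding elts_vtimes using a b by blast
    ultimately show "\<exists>p\<in>elts (vtimes omega omega). S p y" by blast
  qed
  then have "psurj omega (omega1 :: 'a)"
    using psurj_trans[OF psurj_omega_times] by blast
  then show False
    using omega1(1,2) unfolding inf_cardinal_iff by blast
qed

section \<open>Limit points and stationary sets\<close>

lemma limit_point_iff:
  "limit_point \<delta> c \<longleftrightarrow> Limit \<delta> \<and> (\<forall>\<xi>\<in>elts \<delta>. \<exists>\<eta>\<in>elts c. \<eta> \<in> elts \<delta> \<and> \<xi> \<in> elts \<eta>)"
  by (simp add: limit_point_def mem_elts)

lemma definable_limit_point: "dterm \<tau> \<Longrightarrow> dterm \<sigma> \<Longrightarrow> definable (\<lambda>s. limit_point (\<tau> s) (\<sigma> s))"
  by (rule definable_subst2[where P=limit_point]) (unfold limit_point_iff, intro definable_rules definable_Limit)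

lemma club_unbounded:
  assumes "club c \<alpha>" "Limit \<alpha>" "\<xi> \<in> elts \<alpha>"
  shows "\<exists>\<eta>\<in>elts c. \<eta> \<in> elts \<alpha> \<and> \<xi> \<in> elts \<eta>"
proof -
  have "vsucc \<xi> \<in> elts \<alpha>"
    using Limit_vsucc[OF assms(2,3)] .
  then obtain \<eta> where e: "\<eta> \<in> elts c" "vsucc \<xi> \<le>\<^sub>V \<eta>"
    using assms(1) unfolding club_def by blast
  then have "\<eta> \<in> elts \<alpha>"
    using assms(1) unfolding club_def by blast
  moreover from this have "\<xi> \<in> elts \<eta>"
    using mem_le_trans[of \<eta> \<xi> "vsucc \<xi>"] e(2) Ord_mem[OF Limit_Ord[OF assms(2)]] by (simp add: elts_vsucc)
  ultimately show ?thesis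
    using e(1) by blast
qed

text \<open>The element of index \<open>l\<close> bounds the supremum of its predecessors. As
  \<open>x\<close> need not be closed, the supremum may be smaller than that element and may lie
  outside \<open>x\<close>.\<close>

lemma enumerates_sup:
  assumes f: "enumerates f \<gamma> (elts x)" and x: "\<And>y. y \<in> elts x \<Longrightarrow> Ord y"
    and "Ord \<gamma>" "l \<in> elts \<gamma>" "Limit l"
  shows "\<exists>\<delta>. \<delta> \<le>\<^sub>V app f l \<and> limit_point \<delta> x \<and> (\<forall>\<xi>\<in>elts l. app f \<xi> \<in> elts \<delta>) \<and>
    (\<forall>\<xi>\<in>elts \<delta>. \<exists>\<zeta>\<in>elts l. \<xi> \<in> elts (app f \<zeta>))"
proof -
  have lg: "\<xi> \<in> elts \<gamma>" if "\<xi> \<in> elts l" for \<xi>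
    using Ord_trans[OF assms(3) that assms(4)] .
  have fx: "app f \<xi> \<in> elts x" if "\<xi> \<in> elts \<gamma>" for \<xi>
    using f that by (auto simp: enumerates_iff)
  have mono: "app f \<xi> \<in> elts (app f \<eta>)" if "\<xi> \<in> elts \<eta>" "\<eta> \<in> elts \<gamma>" for \<xi> \<eta>
    using f that Ord_trans[OF assms(3) that] by (auto simp: enumerates_iff)
  have ol: "Ord (app f l)"
    using x fx assms(4) by blast
  define \<delta> where "\<delta> = vset {\<xi> \<in> elts (app f l). \<exists>\<zeta>\<in>elts l. \<xi> \<in> elts (app f \<zeta>)}"
  have d: "\<xi> \<in> elts \<delta> \<longleftrightarrow> \<xi> \<in> elts (app f l) \<and> (\<exists>\<zeta>\<in>elts l. \<xi> \<in> elts (app f \<zeta>))" for \<xi>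
  proof -
    have "small {\<xi> \<in> elts (app f l). \<exists>\<zeta>\<in>elts l. \<xi> \<in> elts (app f \<zeta>)}"
      by (intro small_sep definable_rules)
    then show ?thesis
      unfolding \<delta>_def by (simp add: elts_vset)
  qed
  have fd: "app f \<xi> \<in> elts \<delta>" if "\<xi> \<in> elts l" for \<xi>
    unfolding d
  proof (intro conjI bexI)
    show "app f \<xi> \<in> elts (app f l)"
      using mono that assms(4) by blast
    show s: "vsucc \<xi> \<in> elts l"
      using Limit_vsucc[OF assms(5) that] .
    show "app f \<xi> \<in> elts (app f (vsucc \<xi>))"
      by (rule mono) (use lg[OF s] in \<open>auto simp: elts_vsucc\<close>)
  qed
  have od: "Ord \<delta>"
  proof (rule OrdI)
    fix \<eta> \<xi> assume e: "\<eta> \<in> elts \<xi>" and "\<xi> \<in> elts \<delta>"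
    then obtain \<zeta> where z: "\<zeta> \<in> elts l" "\<xi> \<in> elts (app f \<zeta>)" "\<xi> \<in> elts (app f l)"
      using d by blast
    then have "Ord (app f \<zeta>)"
      using x fx lg by blast
    then show "\<eta> \<in> elts \<delta>"
      using d z e Ord_trans[OF ol e] Ord_trans[of "app f \<zeta>", OF _ e] by blast
  qed (use d Ord_mem[OF ol] in blast)
  have cof: "\<exists>\<zeta>\<in>elts l. \<xi> \<in> elts (app f \<zeta>)" if "\<xi> \<in> elts \<delta>" for \<xi>
    using d that by blast
  have "Limit \<delta>"
    unfolding Limit_def mem_elts
  proof (intro conjI ballI)
    show "elts \<delta> \<noteq> {}"
      using fd[OF Limit_empty[OF assms(5)]] by blast
    show "\<exists>\<eta>\<in>elts \<delta>. \<xi> \<in> elts \<eta>" if "\<xi> \<in> elts \<delta>" for \<xi>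
      using cof[OF that] fd by blast
  qed (fact od)
  then have "limit_point \<delta> x"
    unfolding limit_point_iff using cof fd fx lg by meson
  moreover have "\<delta> \<le>\<^sub>V app f l"
    by (rule Ord_subset_le[OF od ol]) (use d in blast)
  ultimately show ?thesis
    using cof fd by blast
qed

text \<open>If \<open>x\<close> has more than \<omega> elements in order, the supremum of the first
  \<omega> is bounded in \<alpha>. Otherwise its enumeration, totalized to \<omega>, would be
  cofinal in \<alpha>.\<close>

lemma limit_point_exists:
  assumes "Limit \<alpha>" and nc: "\<not> (\<exists>f. cofinal_map f omega \<alpha>)" and "elts x \<subseteq> elts \<alpha>"
    and un: "\<And>\<xi>. \<xi> \<in> elts \<alpha> \<Longrightarrow> \<exists>y\<in>elts x. \<xi> \<in> elts y"
  shows "\<exists>\<delta>\<in>elts \<alpha>. limit_point \<delta> x"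
proof -
  have oa: "Ord \<alpha>"
    using Limit_Ord[OF assms(1)] .
  have xo: "Ord y" if "y \<in> elts x" for y
    using that assms(3) Ord_mem[OF oa] by blast
  obtain \<gamma> f where g: "Ord \<gamma>" "enumerates f \<gamma> (elts x)"
    by (rule order_type_exists[of x]) (use xo in blast)+
  have fx: "app f ` elts \<gamma> = elts x"
    using g(2) by (simp add: enumerates_iff)
  show ?thesis
  proof (cases "omega \<in> elts \<gamma>")
    case True
    then obtain \<delta> where d: "\<delta> \<le>\<^sub>V app f omega" "limit_point \<delta> x"
      using enumerates_sup[OF g(2) _ g(1) _ omega(1)] xo by blast
    have "app f omega \<in> elts \<alpha>"
      using True fx assms(3) by blast
    then have "\<delta> \<in> elts \<alpha>"
      using le_mem_trans[OF oa d(1)] by blast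
    with d(2) show ?thesis by blast
  next
    case False
    then have le: "\<gamma> \<le>\<^sub>V omega"
      using Ord_not_mem_iff[OF Ord_omega g(1)] by blast
    have "\<exists>f. cofinal_map f omega \<alpha>"
    proof (rule cofinal_mapI[where R="\<lambda>k y. k \<in> elts \<gamma> \<and> y = app f k"])
      show "definable (\<lambda>s. s 0 \<in> elts \<gamma> \<and> s (Suc 0) = app f (s 0))"
        by (intro definable_rules)
      show "elts \<alpha> \<noteq> {}"
        using Limit_empty[OF assms(1)] by blast
      fix \<xi> assume "\<xi> \<in> elts \<alpha>"
      then obtain y where y: "y \<in> elts x" "\<xi> \<in> elts y"
        using un by blast
      then have "y \<in> app f ` elts \<gamma>"
        using fx by simp
      with y(2) obtain k where k: "k \<in> elts \<gamma>" "\<xi> \<in> elts (app f k)"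
        by blast
      moreover have "k \<in> elts omega"
        using mem_le_trans[OF Ord_omega k(1) le] .
      moreover have "app f k \<in> elts \<alpha>"
        using fx assms(3) k(1) by blast
      ultimately show "\<exists>\<zeta>\<in>elts omega. \<exists>\<eta>\<in>elts \<alpha>. (\<zeta> \<in> elts \<gamma> \<and> \<eta> = app f \<zeta>) \<and> \<xi> \<le>\<^sub>V \<eta>"
        using mem_imp_le by blast
    qed (use oa in auto)
    with nc show ?thesis by blast
  qed
qed

text \<open>The elements of \<open>c\<close> that immediately follow an element of \<open>d\<close> form a set whose limit points are
  limit points of both.\<close>

lemma common_limit_point:
  assumes "Limit \<alpha>" and nc: "\<not> (\<exists>f. cofinal_map f omega \<alpha>)" and ca: "elts c \<subseteq> elts \<alpha>"
    and c: "\<And>\<xi>. \<xi> \<in> elts \<alpha> \<Longrightarrow> \<exists>y\<in>elts c. \<xi> \<in> elts y"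
    and d: "\<And>\<xi>. \<xi> \<in> elts \<alpha> \<Longrightarrow> \<exists>y\<in>elts d. y \<in> elts \<alpha> \<and> \<xi> \<in> elts y"
    and x0: "\<xi>0 \<in> elts \<alpha>"
  shows "\<exists>\<delta>\<in>elts \<alpha>. \<xi>0 \<in> elts \<delta> \<and> limit_point \<delta> c \<and> limit_point \<delta> d"
proof -
  have oa: "Ord \<alpha>"
    using Limit_Ord[OF assms(1)] .
  \<comment> \<open>No element of \<open>c\<close> lies strictly between \<open>y\<close> and
    \<open>x\<close>. Requiring \<open>y\<close> above \<xi>0 forces every limit point of the
    resulting set above \<xi>0.\<close>
  define P where "P x y \<longleftrightarrow> \<xi>0 \<in> elts y \<and> y \<in> elts x \<and> (\<forall>z\<in>elts c. y \<in> elts z \<longrightarrow> z \<notin> elts x)" for x y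
  define X where "X = vset {x \<in> elts c. \<exists>y\<in>elts d. P x y}"
  have X: "x \<in> elts X \<longleftrightarrow> x \<in> elts c \<and> (\<exists>y\<in>elts d. P x y)" for x
  proof -
    have "small {x \<in> elts c. \<exists>y\<in>elts d. P x y}"
      unfolding P_def by (intro small_sep definable_rules)
    then show ?thesis
      unfolding X_def by (simp add: elts_vset)
  qed
  have Xa: "elts X \<subseteq> elts \<alpha>"
    using X ca by blast
  have "\<exists>x\<in>elts X. \<xi> \<in> elts x" if x: "\<xi> \<in> elts \<alpha>" for \<xi>
  proof -
    obtain y0 where y0: "y0 \<in> elts \<alpha>" "\<xi> \<in> elts y0"
      using d[OF x] by blast
    obtain y1 where y1: "y1 \<in> elts \<alpha>" "\<xi>0 \<in> elts y1"
      using d[OF x0] by blast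
    have "\<exists>m\<in>elts \<alpha>. y0 \<le>\<^sub>V m \<and> y1 \<le>\<^sub>V m"
      using Ord_linear[of y0 y1] Ord_mem[OF oa] y0(1) y1(1) unfolding ord_le_def mem_elts by blast
    then obtain m where m: "m \<in> elts \<alpha>" "y0 \<le>\<^sub>V m" "y1 \<le>\<^sub>V m"
      by blast
    obtain y where y: "y \<in> elts d" "y \<in> elts \<alpha>" "m \<in> elts y"
      using d[OF m(1)] by blast
    have oy: "Ord y"
      using Ord_mem[OF oa y(2)] .
    have "m \<le>\<^sub>V y"
      using mem_imp_le[OF y(3)] .
    then have xy: "\<xi> \<in> elts y" "\<xi>0 \<in> elts y"
      using mem_le_trans[OF oy y0(2)] mem_le_trans[OF oy y1(2)] le_trans[OF oy m(2)] le_trans[OF oy m(3)] by blast+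
    obtain z where z: "z \<in> elts c" "y \<in> elts z"
      using c[OF y(2)] by blast
    have "definable (\<lambda>s. y \<in> elts (s 0))"
      by (intro definable_rules)
    from set_least[where P="\<lambda>z. y \<in> elts z", OF this z]
    obtain w where w: "w \<in> elts c" "y \<in> elts w" "\<forall>z\<in>elts w. z \<in> elts c \<longrightarrow> y \<notin> elts z"
      by blast
    have "P w y"
      unfolding P_def using xy(2) w by blast
    then have "w \<in> elts X"
      using X w(1) y(1) by blast
    moreover have "\<xi> \<in> elts w"
      using Ord_trans[OF Ord_mem[OF oa] xy(1) w(2)] ca w(1) by blast
    ultimately show ?thesis by blast
  qed
  then obtain \<delta> where \<delta>: "\<delta> \<in> elts \<alpha>" "limit_point \<delta> X"
    using limit_point_exists[OF assms(1) nc Xa] by blast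
  have od: "Ord \<delta>"
    using Ord_mem[OF oa \<delta>(1)] .
  have lim: "Limit \<delta>" and cof: "\<And>\<xi>. \<xi> \<in> elts \<delta> \<Longrightarrow> \<exists>x\<in>elts X. x \<in> elts \<delta> \<and> \<xi> \<in> elts x"
    using \<delta>(2) unfolding limit_point_iff by blast+
  have "limit_point \<delta> c"
    unfolding limit_point_iff using lim cof X by blast
  moreover have "limit_point \<delta> d"
    unfolding limit_point_iff
  proof (intro conjI ballI)
    fix \<xi> assume "\<xi> \<in> elts \<delta>"
    then obtain x where x: "x \<in> elts X" "x \<in> elts \<delta>" "\<xi> \<in> elts x"
      using cof by blast
    \<comment> \<open>The witness y in \<open>d\<close> for the later element x' cannot be below x:
      then x, an element of \<open>c\<close>, would separate y from x'. Hence y \<ge> x >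
      \<xi>.\<close>
    obtain x' where x': "x' \<in> elts X" "x' \<in> elts \<delta>" "x \<in> elts x'"
      using cof[OF x(2)] by blast
    then obtain y where y: "y \<in> elts d" "P x' y"
      using X by blast
    have yx': "y \<in> elts x'"
      using y(2) unfolding P_def by blast
    then have yd: "y \<in> elts \<delta>"
      using Ord_trans[OF od _ x'(2)] by blast
    have oy: "Ord y" "Ord x"
      using Ord_mem[OF od] yd x(2) by blast+
    have "x \<in> elts c"
      using x(1) X by blast
    then have "y \<notin> elts x"
      using y(2) x'(3) unfolding P_def by blast
    then have "x \<le>\<^sub>V y"
      using Ord_not_mem_iff[OF oy] by blast
    then have "\<xi> \<in> elts y"
      using mem_le_trans[OF oy(1) x(3)] by blast
    with y(1) yd show "\<exists>\<eta>\<in>elts d. \<eta> \<in> elts \<delta> \<and> \<xi> \<in> elts \<eta>" by blast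
  qed (fact lim)
  moreover have "\<xi>0 \<in> elts \<delta>"
  proof -
    obtain x where x: "x \<in> elts X" "x \<in> elts \<delta>"
      using cof[OF Limit_empty[OF lim]] by blast
    then obtain y where "P x y"
      using X by blast
    then show ?thesis
      unfolding P_def using Ord_trans[OF od _ x(2)] Ord_trans[OF Ord_mem[OF od x(2)]] by blast
  qed
  ultimately show ?thesis
    using \<delta>(1) by blast
qed

text \<open>Adding the successors of the elements of \<open>d\<close> to its limit points gives a set that is unbounded in
  \<open>\<kappa>\<close> even if \<open>\<kappa>\<close> has cofinality \<open>\<omega>\<close>, and a stationary set of limit ordinals can only meet it in a
  limit point.\<close>

lemma stationary_limit_point:
  assumes S: "stationary S \<kappa>" and "\<And>\<alpha>. \<alpha> \<in> S \<Longrightarrow> Limit \<alpha>" and "Limit \<kappa>" and d: "club d \<kappa>"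
  shows "\<exists>\<alpha>\<in>S. limit_point \<alpha> d"
proof -
  have ok: "Ord \<kappa>"
    using Limit_Ord[OF assms(3)] .
  have dk: "elts d \<subseteq> elts \<kappa>"
    using d unfolding club_def by blast
  define e where "e = vset {x \<in> elts \<kappa>. limit_point x d \<or> (\<exists>y\<in>elts d. x = vsucc y)}"
  have e: "x \<in> elts e \<longleftrightarrow> x \<in> elts \<kappa> \<and> (limit_point x d \<or> (\<exists>y\<in>elts d. x = vsucc y))" for x
  proof -
    have "small {x \<in> elts \<kappa>. limit_point x d \<or> (\<exists>y\<in>elts d. x = vsucc y)}"
      by (intro small_sep definable_rules definable_limit_point)
    then show ?thesis
      unfolding e_def by (simp add: elts_vset)
  qed
  have "club e \<kappa>"
    unfolding club_def mem_elts
  proof (intro conjI ballI impI)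
    show "elts e \<subseteq> elts \<kappa>"
      using e by blast
  next
    fix \<xi> assume "\<xi> \<in> elts \<kappa>"
    then obtain \<eta> where h: "\<eta> \<in> elts d" "\<xi> \<le>\<^sub>V \<eta>"
      using d unfolding club_def by blast
    then have s: "vsucc \<eta> \<in> elts \<kappa>"
      using Limit_vsucc[OF assms(3)] dk by blast
    have "\<xi> \<le>\<^sub>V vsucc \<eta>"
      using h(2) mem_imp_le[of \<xi> "vsucc \<eta>"] by (simp add: mem_vsucc)
    moreover have "vsucc \<eta> \<in> elts e"
      using e s h(1) by blast
    ultimately show "\<exists>\<eta>\<in>elts e. \<xi> \<le>\<^sub>V \<eta>" by blast
  next
    fix \<delta> assume dl: "\<delta> \<in> elts \<kappa>" "limit_point \<delta> e"
    have od: "Ord \<delta>"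
      using Ord_mem[OF ok dl(1)] .
    have lim: "Limit \<delta>" and cof: "\<And>\<xi>. \<xi> \<in> elts \<delta> \<Longrightarrow> \<exists>x\<in>elts e. x \<in> elts \<delta> \<and> \<xi> \<in> elts x"
      using dl(2) unfolding limit_point_iff by blast+
    have "\<exists>\<eta>\<in>elts d. \<eta> \<in> elts \<delta> \<and> \<xi> \<in> elts \<eta>" if x: "\<xi> \<in> elts \<delta>" for \<xi>
    proof -
      \<comment> \<open>Going beyond the successor of \<xi> leaves room for the case x = y+1, where
        y itself must still exceed \<xi>.\<close>
      obtain x where x: "x \<in> elts e" "x \<in> elts \<delta>" "vsucc \<xi> \<in> elts x"
        using cof[OF Limit_vsucc[OF lim x]] by blast
      have ox: "Ord x"
        using Ord_mem[OF od x(2)] .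
      consider "limit_point x d" | y where "y \<in> elts d" "x = vsucc y"
        using x(1) e by blast
      then show ?thesis
      proof cases
        case 1
        have "\<xi> \<in> elts x"
          using Ord_trans[OF ox _ x(3), of \<xi>] by (simp add: elts_vsucc)
        then obtain \<eta> where "\<eta> \<in> elts d" "\<eta> \<in> elts x" "\<xi> \<in> elts \<eta>"
          using 1 unfolding limit_point_iff by blast
        then show ?thesis
          using Ord_trans[OF od _ x(2)] by blast
      next
        case 2
        have yx: "y \<in> elts x"
          using 2(2) by (simp add: elts_vsucc)
        have "vsucc \<xi> \<le>\<^sub>V y"
          using x(3) unfolding 2(2) mem_vsucc .
        then have "\<xi> \<in> elts y"
          using mem_le_trans[OF Ord_mem[OF ox yx], of \<xi> "vsucc \<xi>"] by (simp add: elts_vsucc)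
        then show ?thesis
          using 2(1) Ord_trans[OF od yx x(2)] by blast
      qed
    qed
    then show "\<delta> \<in> elts e"
      unfolding e limit_point_iff using lim dl(1) by blast
  qed
  then obtain \<alpha> where "\<alpha> \<in> S" "\<alpha> \<in> elts e"
    using S unfolding stationary_def by blast
  moreover from this have "\<alpha> \<noteq> vsucc y" for y
    using assms(2) not_Limit_vsucc by metis
  ultimately show ?thesis
    using e by blast
qed

text \<open>A shorter map cofinal in \<beta> is pulled back along the increasing map
  \<open>f\<close> to one cofinal in \<open>omega1\<close>, against regularity.\<close>

lemma Cof_omega1_sup:
  assumes f: "enumerates f \<gamma> (elts x)" and x: "\<And>y. y \<in> elts x \<Longrightarrow> Ord y" and g: "Ord \<gamma>" "omega1 \<in> elts \<gamma>"
    and b: "Limit \<beta>" "\<And>\<xi>. \<xi> \<in> elts omega1 \<Longrightarrow> app f \<xi> \<in> elts \<beta>"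
    and bc: "\<And>\<xi>. \<xi> \<in> elts \<beta> \<Longrightarrow> \<exists>\<zeta>\<in>elts omega1. \<xi> \<in> elts (app f \<zeta>)"
  shows "\<beta> \<in> Cof omega1"
proof -
  have o1: "Ord (omega1 :: 'a)"
    using omega1(1) inf_cardinal_Ord by blast
  have ob: "Ord \<beta>"
    using Limit_Ord[OF b(1)] .
  have ne: "elts (omega1 :: 'a) \<noteq> {}"
    using omega1(2) by blast
  have fo: "Ord (app f \<zeta>)" if "\<zeta> \<in> elts omega1" for \<zeta>
    using b(2)[OF that] Ord_mem[OF ob] by blast
  have mono: "app f \<xi> \<in> elts (app f \<eta>)" if "\<xi> \<in> elts \<eta>" "\<eta> \<in> elts omega1" for \<xi> \<eta>
  proof -
    have "\<eta> \<in> elts \<gamma>"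
      using Ord_trans[OF g(1) that(2) g(2)] .
    then show ?thesis
      using f that(1) Ord_trans[OF g(1) that(1)] unfolding enumerates_iff by blast
  qed
  have "\<exists>k. cofinal_map k omega1 \<beta>"
  proof (rule cofinal_mapI[where R="\<lambda>z y. y = app f z"])
    show "definable (\<lambda>s. s (Suc 0) = app f (s 0))"
      by (intro definable_rules)
    show "elts \<beta> \<noteq> {}"
      using Limit_empty[OF b(1)] by blast
    show "\<exists>\<zeta>\<in>elts omega1. \<exists>\<eta>\<in>elts \<beta>. \<eta> = app f \<zeta> \<and> \<xi> \<le>\<^sub>V \<eta>" if "\<xi> \<in> elts \<beta>" for \<xi>
      using bc[OF that] b(2) mem_imp_le by blast
  qed (use ob in auto)
  moreover have False if d: "\<delta> \<in> elts omega1" and k: "cofinal_map k \<delta> \<beta>" for \<delta> k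
  proof -
    \<comment> \<open>The value y of \<open>k\<close> is replaced by the least index \<zeta> with y
      \<le> f(\<zeta>); leastness makes this single-valued.\<close>
    define R where "R \<xi> \<zeta> \<longleftrightarrow> (\<exists>y. vpair \<xi> y \<in> elts k \<and> y \<le>\<^sub>V app f \<zeta> \<and> (\<forall>z\<in>elts \<zeta>. \<not> y \<le>\<^sub>V app f z))" for \<xi> \<zeta>
    have "\<exists>h. cofinal_map h \<delta> (omega1 :: 'a)"
    proof (rule cofinal_mapI[OF _ o1 ne])
      show "definable (\<lambda>s. R (s 0) (s (Suc 0)))"
        unfolding R_def by (intro definable_rules)
    next
      fix \<xi> \<zeta> \<zeta>' :: 'a
      assume z: "\<zeta> \<in> elts omega1" "\<zeta>' \<in> elts omega1" and "R \<xi> \<zeta>" "R \<xi> \<zeta>'"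
      then obtain y y' where y: "vpair \<xi> y \<in> elts k" "y \<le>\<^sub>V app f \<zeta>" "\<forall>z\<in>elts \<zeta>. \<not> y \<le>\<^sub>V app f z"
        "vpair \<xi> y' \<in> elts k" "y' \<le>\<^sub>V app f \<zeta>'" "\<forall>z\<in>elts \<zeta>'. \<not> y' \<le>\<^sub>V app f z"
        unfolding R_def by blast
      have "y = y'"
        using cofinal_mapD(1)[OF k] y(1,4) unfolding functional_def by blast
      then show "\<zeta> = \<zeta>'"
        using y Ord_linear[of \<zeta> \<zeta>'] Ord_mem[OF o1] z by blast
    next
      fix \<zeta>0 :: 'a assume z0: "\<zeta>0 \<in> elts omega1"
      obtain \<xi> y where xy: "vpair \<xi> y \<in> elts k" "app f \<zeta>0 \<le>\<^sub>V y"
        using cofinal_mapD(3)[OF k b(2)[OF z0]] by blast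
      have m: "\<xi> \<in> elts \<delta>" "y \<in> elts \<beta>"
        using cofinal_mapD(2)[OF k xy(1)] by blast+
      obtain \<zeta>1 where z1: "\<zeta>1 \<in> elts omega1" "y \<in> elts (app f \<zeta>1)"
        using bc[OF m(2)] by blast
      have "definable (\<lambda>s. y \<le>\<^sub>V app f (s 0))"
        by (intro definable_rules)
      from Ord_least[where P="\<lambda>z. y \<le>\<^sub>V app f z", OF this Ord_mem[OF o1 z1(1)] mem_imp_le[OF z1(2)]]
      obtain \<zeta> where z: "Ord \<zeta>" "y \<le>\<^sub>V app f \<zeta>" "\<zeta> \<le>\<^sub>V \<zeta>1" "\<forall>z\<in>elts \<zeta>. \<not> y \<le>\<^sub>V app f z"
        by blast
      have zo: "\<zeta> \<in> elts omega1"
        using le_mem_trans[OF o1 z(3) z1(1)] .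
      have "\<zeta> \<notin> elts \<zeta>0"
      proof
        assume "\<zeta> \<in> elts \<zeta>0"
        then have l: "app f \<zeta> \<in> elts (app f \<zeta>0)"
          using mono z0 by blast
        have "app f \<zeta>0 \<le>\<^sub>V app f \<zeta>"
          using le_trans[OF fo[OF zo] xy(2) z(2)] .
        then show False
          using Ord_not_mem_iff[OF fo[OF zo] fo[OF z0]] l by blast
      qed
      then have "\<zeta>0 \<le>\<^sub>V \<zeta>"
        using Ord_not_mem_iff[OF z(1) Ord_mem[OF o1 z0]] by blast
      moreover have "R \<xi> \<zeta>"
        unfolding R_def using xy(1) z(2,4) by blast
      ultimately show "\<exists>\<xi>\<in>elts \<delta>. \<exists>\<zeta>\<in>elts omega1. R \<xi> \<zeta> \<and> \<zeta>0 \<le>\<^sub>V \<zeta>"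
        using m(1) zo by blast
    qed
    then show False
      using omega1_regular[OF d] by blast
  qed
  ultimately show ?thesis
    unfolding Cof_def using ob o1 by blast
qed

lemma ot_eqI:
  assumes "enumerates f \<gamma> (elts c)" "Ord \<gamma>" "\<And>x. x \<in> elts c \<Longrightarrow> Ord x"
  shows "ot UNIV c = \<gamma>"
  unfolding ot_def
proof (rule the_equality)
  show "Ord \<gamma> \<and> (\<exists>f\<in>UNIV. enumerates f \<gamma> (elts c))"
    using assms by blast
  show "\<gamma>' = \<gamma>" if "Ord \<gamma>' \<and> (\<exists>f\<in>UNIV. enumerates f \<gamma>' (elts c))" for \<gamma>'
    using that enumerates_unique[OF _ assms(1) assms(3) _ assms(2)] by blast
qed

lemma cofinal_enumeration:
  assumes f: "enumerates f \<gamma> (elts c)" "elts c \<subseteq> elts \<alpha>" "Limit \<alpha>"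
    and un: "\<And>\<xi>. \<xi> \<in> elts \<alpha> \<Longrightarrow> \<exists>y\<in>elts c. \<xi> \<in> elts y"
  shows "\<exists>h. cofinal_map h \<gamma> \<alpha>"
proof (rule cofinal_mapI[where R="\<lambda>z y. y = app f z"])
  show "definable (\<lambda>s. s (Suc 0) = app f (s 0))"
    by (intro definable_rules)
  show "elts \<alpha> \<noteq> {}"
    using Limit_empty[OF assms(3)] by blast
  have fc: "app f ` elts \<gamma> = elts c"
    using f(1) by (simp add: enumerates_iff)
  show "\<exists>\<zeta>\<in>elts \<gamma>. \<exists>\<eta>\<in>elts \<alpha>. \<eta> = app f \<zeta> \<and> \<xi> \<le>\<^sub>V \<eta>" if "\<xi> \<in> elts \<alpha>" for \<xi>
  proof -
    obtain y where y: "y \<in> elts c" "\<xi> \<in> elts y"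
      using un[OF \<open>\<xi> \<in> elts \<alpha>\<close>] by blast
    then obtain \<zeta> where "\<zeta> \<in> elts \<gamma>" "y = app f \<zeta>"
      using fc by blast
    with y f(2) show ?thesis
      using mem_imp_le by blast
  qed
qed (use Limit_Ord[OF assms(3)] in auto)

section \<open>Reflection of the square sequence\<close>

text \<open>The combinatorial core, for any club \<open>c\<close> in \<alpha> and any
  \<open>d\<close> accumulating at \<alpha> and closed below it. The last clause covers every set
  with the elements of c \<inter> \<beta>, so that coherence can later insert the square set of
  \<beta>.\<close>

lemma square_reflection:
  assumes c: "club c \<alpha>" and "Limit \<alpha>" and \<mu>: "\<alpha> \<in> Cof \<mu>" "Ord \<mu>" "omega1 \<in> elts \<mu>" "\<nu> \<in> elts \<mu>"
    and d: "limit_point \<alpha> d" "\<And>\<delta>. \<delta> \<in> elts \<alpha> \<Longrightarrow> limit_point \<delta> d \<Longrightarrow> \<delta> \<in> elts d"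
  shows "\<exists>\<beta>\<in>elts \<alpha>. \<beta> \<in> elts d \<and> limit_point \<beta> c \<and> \<beta> \<in> Cof omega1 \<and>
    (\<forall>e. elts e = elts c \<inter> elts \<beta> \<longrightarrow> \<nu> \<le>\<^sub>V ot UNIV e)"
proof -
  have oa: "Ord \<alpha>"
    using Limit_Ord[OF assms(2)] .
  have ca: "elts c \<subseteq> elts \<alpha>"
    using c unfolding club_def by blast
  have co: "Ord x" if "x \<in> elts c" for x
    using that ca Ord_mem[OF oa] by blast
  have cun: "\<exists>y\<in>elts c. \<xi> \<in> elts y" if "\<xi> \<in> elts \<alpha>" for \<xi>
    using club_unbounded[OF c assms(2) that] by blast
  have dun: "\<exists>y\<in>elts d. y \<in> elts \<alpha> \<and> \<xi> \<in> elts y" if "\<xi> \<in> elts \<alpha>" for \<xi>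
    using d(1) that unfolding limit_point_iff by blast
  have short: "\<not> (\<exists>h. cofinal_map h \<gamma> \<alpha>)" if "\<gamma> \<in> elts \<mu>" for \<gamma>
    using \<mu>(1) that unfolding Cof_def by blast
  have om: "omega \<in> elts \<mu>"
    using Ord_trans[OF \<mu>(2) omega1(2) \<mu>(3)] .
  \<comment> \<open>Enumerating an unbounded subset gives a cofinal map, and \<open>Cof\<close>
    forbids such maps from ordinals below \<mu>. This is applied to \<open>c\<close> and to the set
    of common limit points.\<close>
  have long: "\<mu> \<le>\<^sub>V \<gamma>" if "enumerates h \<gamma> (elts x)" "Ord \<gamma>" "elts x \<subseteq> elts \<alpha>"
    "\<And>\<xi>. \<xi> \<in> elts \<alpha> \<Longrightarrow> \<exists>y\<in>elts x. \<xi> \<in> elts y" for h \<gamma> x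
  proof -
    have "\<exists>h. cofinal_map h \<gamma> \<alpha>"
      by (rule cofinal_enumeration[OF that(1,3) assms(2) that(4)])
    then show ?thesis
      using short Ord_not_mem_iff[OF that(2) \<mu>(2)] by blast
  qed
  obtain \<gamma> g where g: "Ord \<gamma>" "enumerates g \<gamma> (elts c)"
    by (rule order_type_exists[of c]) (use co in blast)+
  have "\<mu> \<le>\<^sub>V \<gamma>"
    by (rule long[OF g(2,1) ca cun])
  then have n: "\<nu> \<in> elts \<gamma>"
    by (rule mem_le_trans[OF g(1) \<mu>(4)])
  let ?x = "app g \<nu>"
  have xc: "?x \<in> elts c"
    using g(2) n by (auto simp: enumerates_iff)
  then have xa: "?x \<in> elts \<alpha>"
    using ca by blast
  define e where "e = vset {\<delta> \<in> elts \<alpha>. ?x \<in> elts \<delta> \<and> limit_point \<delta> c \<and> limit_point \<delta> d}"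
  have e: "\<delta> \<in> elts e \<longleftrightarrow> \<delta> \<in> elts \<alpha> \<and> ?x \<in> elts \<delta> \<and> limit_point \<delta> c \<and> limit_point \<delta> d" for \<delta>
  proof -
    have "small {\<delta> \<in> elts \<alpha>. ?x \<in> elts \<delta> \<and> limit_point \<delta> c \<and> limit_point \<delta> d}"
      by (intro small_sep definable_rules definable_limit_point)
    then show ?thesis
      unfolding e_def by (simp add: elts_vset)
  qed
  have ea: "elts e \<subseteq> elts \<alpha>"
    using e by blast
  have eo: "Ord y" if "y \<in> elts e" for y
    using that ea Ord_mem[OF oa] by blast
  have eun: "\<exists>y\<in>elts e. \<xi> \<in> elts y" if x: "\<xi> \<in> elts \<alpha>" for \<xi>
  proof -
    have "\<exists>m\<in>elts \<alpha>. \<xi> \<le>\<^sub>V m \<and> ?x \<le>\<^sub>V m"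
      using Ord_linear[of \<xi> ?x] Ord_mem[OF oa] x xa unfolding ord_le_def mem_elts by blast
    then obtain m where m: "m \<in> elts \<alpha>" "\<xi> \<le>\<^sub>V m" "?x \<le>\<^sub>V m"
      by blast
    obtain \<delta> where \<delta>: "\<delta> \<in> elts \<alpha>" "m \<in> elts \<delta>" "limit_point \<delta> c" "limit_point \<delta> d"
      using common_limit_point[OF assms(2) short[OF om] ca cun dun m(1)] by blast
    have "Ord \<delta>"
      using Ord_mem[OF oa \<delta>(1)] .
    then have "\<xi> \<in> elts \<delta>" "?x \<in> elts \<delta>"
      using le_mem_trans m(2,3) \<delta>(2) by blast+
    with \<delta> e show ?thesis by blast
  qed
  obtain \<theta> f where f: "Ord \<theta>" "enumerates f \<theta> (elts e)"
    by (rule order_type_exists[of e]) (use eo in blast)+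
  have "\<mu> \<le>\<^sub>V \<theta>"
    by (rule long[OF f(2,1) ea eun])
  then have o1: "omega1 \<in> elts \<theta>"
    by (rule mem_le_trans[OF f(1) \<mu>(3)])
  obtain \<beta> where b: "\<beta> \<le>\<^sub>V app f omega1" "limit_point \<beta> e"
    "\<And>\<xi>. \<xi> \<in> elts omega1 \<Longrightarrow> app f \<xi> \<in> elts \<beta>"
    "\<And>\<xi>. \<xi> \<in> elts \<beta> \<Longrightarrow> \<exists>\<zeta>\<in>elts omega1. \<xi> \<in> elts (app f \<zeta>)"
    using enumerates_sup[OF f(2) eo f(1) o1 inf_cardinal_Limit[OF omega1(1)]] by blast
  have "app f omega1 \<in> elts e"
    using f(2) o1 by (auto simp: enumerates_iff)
  then have ba: "\<beta> \<in> elts \<alpha>"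
    using le_mem_trans[OF oa b(1)] ea by blast
  have ob: "Ord \<beta>"
    using Ord_mem[OF oa ba] .
  have lim: "Limit \<beta>" and cof: "\<And>\<xi>. \<xi> \<in> elts \<beta> \<Longrightarrow> \<exists>x\<in>elts e. x \<in> elts \<beta> \<and> \<xi> \<in> elts x"
    using b(2) unfolding limit_point_iff by blast+
  \<comment> \<open>A limit of limit points of y is a limit point of y; used for both
    \<open>c\<close> and \<open>d\<close>.\<close>
  have sub: "limit_point \<beta> y" if y: "\<And>\<delta>. \<delta> \<in> elts e \<Longrightarrow> limit_point \<delta> y" for y
    unfolding limit_point_iff
  proof (intro conjI ballI)
    fix \<xi> assume "\<xi> \<in> elts \<beta>"
    then obtain \<delta> where \<delta>: "\<delta> \<in> elts e" "\<delta> \<in> elts \<beta>" "\<xi> \<in> elts \<delta>"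
      using cof by blast
    then obtain \<eta> where "\<eta> \<in> elts y" "\<eta> \<in> elts \<delta>" "\<xi> \<in> elts \<eta>"
      using y unfolding limit_point_iff by blast
    then show "\<exists>\<eta>\<in>elts y. \<eta> \<in> elts \<beta> \<and> \<xi> \<in> elts \<eta>"
      using Ord_trans[OF ob _ \<delta>(2)] by blast
  qed (fact lim)
  have lc: "limit_point \<beta> c" and ld: "limit_point \<beta> d"
    using sub e by blast+
  have bd: "\<beta> \<in> elts d"
    using d(2)[OF ba ld] .
  have bcof: "\<beta> \<in> Cof omega1"
    by (rule Cof_omega1_sup[OF f(2) eo f(1) o1 lim b(3,4)])
  have xb: "?x \<in> elts \<beta>"
  proof -
    obtain \<delta> where "\<delta> \<in> elts e" "\<delta> \<in> elts \<beta>"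
      using cof[OF Limit_empty[OF lim]] by blast
    then show ?thesis
      using e Ord_trans[OF ob] by blast
  qed
  have "\<nu> \<le>\<^sub>V ot UNIV b'" if b': "elts b' = elts c \<inter> elts \<beta>" for b'
  proof -
    have bo: "Ord y" if "y \<in> elts b'" for y
      using that b' co by blast
    obtain \<theta>' h where h: "Ord \<theta>'" "enumerates h \<theta>' (elts b')"
      by (rule order_type_exists[of b']) (use bo in blast)+
    have ot: "ot UNIV b' = \<theta>'"
      using ot_eqI[OF h(2,1) bo] .
    \<comment> \<open>The elements of \<open>c\<close> preceding the one of index \<nu> have type
      exactly \<nu>, and all of them lie below \<beta>.\<close>
    obtain k where k: "enumerates k \<nu> {y \<in> elts c. y \<in> elts ?x}"
      using enumerates_restrict[OF g(2) co g(1) n] by blast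
    have "{y \<in> elts c. y \<in> elts ?x} \<subseteq> elts b'"
      using b' Ord_trans[OF ob _ xb] by blast
    then have "\<nu> \<le>\<^sub>V \<theta>'"
      using enumerates_le[OF k h(2) _ bo Ord_mem[OF g(1) n] h(1)] by blast
    then show ?thesis
      unfolding ot .
  qed
  with ba bd lc bcof show ?thesis by blast
qed

section \<open>Index arithmetic and the stationarity of T_n\<close>

lemma vpred_vsucc: "Ord x \<Longrightarrow> vpred (vsucc x) = x"
proof -
  assume "Ord x"
  then have "(\<Union>y\<in>elts (vsucc x). elts y) = elts x"
    using Ord_trans by (auto simp: elts_vsucc)
  then show ?thesis
    unfolding vpred_def by (simp add: vset_elts)
qed

text \<open>Since n may be nonstandard, three predecessors are peeled off inside
  \<open>omega\<close>. The bound m \<ge> 1 is what remains of n > 3 and later places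
  \<open>omega1\<close> below the aleph of m+1.\<close>

lemma vminus_cases:
  assumes n: "n \<in>\<^sub>V omega" "vnat 3 \<in>\<^sub>V n"
  obtains m where "vminus n 3 = m" "vminus n 2 = vsucc m" "vsucc (vset {}) \<le>\<^sub>V m" "vsucc m \<in> elts omega"
    "n \<in> elts omega"
proof -
  have down: "\<exists>j. k = vsucc j \<and> j \<in> elts omega \<and> i \<le>\<^sub>V j" if k: "k \<in> elts omega" "vsucc i \<le>\<^sub>V k \<or> i \<in> elts k" for i k :: 'a
  proof -
    have ok: "Ord k"
      using omega_Ord[OF k(1)] .
    have ik: "i \<in> elts k"
      using k(2) mem_le_trans[OF ok, of i "vsucc i"] by (auto simp: elts_vsucc)
    then have "k \<noteq> vset {}"
      by (auto simp: elts_empty)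
    then obtain j where "k = vsucc j" "j \<in> elts omega"
      using omega_cases[OF k(1)] by blast
    with ik show ?thesis
      by (auto simp: mem_vsucc)
  qed
  have v3: "vnat 3 = vsucc (vsucc (vsucc (vset {} :: 'a)))"
    by (simp add: vnat_def numeral_3_eq_3)
  obtain n1 where n1: "n = vsucc n1" "n1 \<in> elts omega" "vsucc (vsucc (vsucc (vset {}))) \<le>\<^sub>V n1"
    using down[of n "vnat 3"] n unfolding mem_elts v3 by blast
  obtain n2 where n2: "n1 = vsucc n2" "n2 \<in> elts omega" "vsucc (vsucc (vset {})) \<le>\<^sub>V n2"
    using down[OF n1(2)] n1(3) by blast
  obtain n3 where n3: "n2 = vsucc n3" "n3 \<in> elts omega" "vsucc (vset {}) \<le>\<^sub>V n3"
    using down[OF n2(2)] n2(3) by blast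
  have "vpred n = n1" "vpred n1 = n2" "vpred n2 = n3"
    using vpred_vsucc omega_Ord n1 n2 n3 by metis+
  then have "vminus n 3 = n3" "vminus n 2 = vsucc n3"
    using n3(1) by (simp_all add: vminus_def numeral_3_eq_3 numeral_2_eq_2)
  then show ?thesis
    using that n3 n2 n unfolding mem_elts by blast
qed

theorem theorem4p1:
  fixes K :: "'v::zfc set" and C :: "'v \<Rightarrow> 'v" and n :: 'v
  assumes "\<not> (\<exists>(W::'v set) \<kappa>. inner_model W \<and>
                 mitchell_order W \<kappa> (card_succ W (card_succ W \<kappa>)))"
    and "inner_model K"
    and "global_square K C"
    and "n \<in>\<^sub>V omega" and "vnat 3 \<in>\<^sub>V n"
    and "stationary {\<alpha>. \<alpha> \<in>\<^sub>V aleph n \<and> \<alpha> \<in> Cof (aleph (vminus n 2)) \<and> \<alpha> \<in> Sing K} (aleph n)"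
  shows "stationary {\<beta>. \<beta> \<in> Cof (aleph (vnat 1)) \<and> \<beta> \<in>\<^sub>V aleph n \<and> \<beta> \<in> Sing K \<and>
                        aleph (vminus n 3) \<le>\<^sub>V ot UNIV (C \<beta>)} (aleph n)"
  unfolding stationary_def
proof (intro conjI allI impI)
  show "{\<beta>. \<beta> \<in> Cof (aleph (vnat 1)) \<and> \<beta> \<in>\<^sub>V aleph n \<and> \<beta> \<in> Sing K \<and>
      aleph (vminus n 3) \<le>\<^sub>V ot UNIV (C \<beta>)} \<subseteq> elts (aleph n)"
    by (auto simp: mem_elts)
next
  fix d assume d: "club d (aleph n)"
  obtain m where m: "vminus n 3 = m" "vminus n 2 = vsucc m" "vsucc (vset {}) \<le>\<^sub>V m" "vsucc m \<in> elts omega"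
    "n \<in> elts omega"
    by (rule vminus_cases[OF assms(4,5)])
  have Ln: "Limit (aleph n)"
    using inf_cardinal_Limit aleph_inf_cardinal m(5) by blast
  \<comment> \<open>A mere member of \<open>d\<close> would not suffice: \<open>d\<close> might be
    bounded below it, leaving no common limit points near it.\<close>
  have "\<exists>\<alpha>\<in>{\<alpha>. \<alpha> \<in>\<^sub>V aleph n \<and> \<alpha> \<in> Cof (aleph (vminus n 2)) \<and> \<alpha> \<in> Sing K}. limit_point \<alpha> d"
    by (rule stationary_limit_point[OF assms(6) _ Ln d]) (simp add: Sing_def)
  then obtain \<alpha> where a: "\<alpha> \<in> elts (aleph n)" "\<alpha> \<in> Cof (aleph (vsucc m))" "\<alpha> \<in> Sing K" "limit_point \<alpha> d"
    using m(2) unfolding mem_elts by auto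
  have sq: "club (C \<alpha>) \<alpha>"
    "\<And>\<delta>. \<delta> \<in> elts \<alpha> \<Longrightarrow> limit_point \<delta> (C \<alpha>) \<Longrightarrow> \<delta> \<in> Sing K \<and> elts (C \<delta>) = elts (C \<alpha>) \<inter> elts \<delta>"
    using assms(3) a(3) unfolding global_square_def by blast+
  have La: "Limit \<alpha>"
    using a(3) unfolding Sing_def by blast
  have mm: "m \<in> elts (vsucc m)"
    by (simp add: elts_vsucc)
  have om: "Ord (aleph (vsucc m))"
    using aleph_inf_cardinal[OF m(4)] inf_cardinal_Ord by blast
  have "vsucc (vset {}) \<in> elts (vsucc m)"
    using m(3) unfolding mem_vsucc .
  then have o1: "omega1 \<in> elts (aleph (vsucc m))"
    by (rule aleph_mono[OF _ m(4)])
  have da: "\<delta> \<in> elts d" if "\<delta> \<in> elts \<alpha>" "limit_point \<delta> d" for \<delta>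
    using d that Ord_trans[OF Limit_Ord[OF Ln] that(1) a(1)] unfolding club_def mem_elts by blast
  \<comment> \<open>Here \<mu> and \<nu> are the alephs of m+1 and of m, that is, of n-2 and of
    n-3.\<close>
  obtain \<beta> where b: "\<beta> \<in> elts \<alpha>" "\<beta> \<in> elts d" "limit_point \<beta> (C \<alpha>)" "\<beta> \<in> Cof omega1"
    "\<forall>e. elts e = elts (C \<alpha>) \<inter> elts \<beta> \<longrightarrow> aleph m \<le>\<^sub>V ot UNIV e"
    using square_reflection[OF sq(1) La a(2) om o1 aleph_mono[OF mm m(4)] a(4) da] by blast
  have v1: "vnat 1 = vsucc (vset {} :: 'v)"
    by (simp add: vnat_def)
  have "\<beta> \<in> elts (aleph n)"
    using Ord_trans[OF Limit_Ord[OF Ln] b(1) a(1)] .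
  \<comment> \<open>Coherence at the limit point \<beta> yields both that \<beta> is singular in K,
    so that its square set is meaningful, and that this set is the initial segment just
    measured.\<close>
  moreover have "\<beta> \<in> Sing K" "aleph m \<le>\<^sub>V ot UNIV (C \<beta>)"
    using sq(2)[OF b(1,3)] b(5) by blast+
  ultimately show "{\<beta>. \<beta> \<in> Cof (aleph (vnat 1)) \<and> \<beta> \<in>\<^sub>V aleph n \<and> \<beta> \<in> Sing K \<and>
      aleph (vminus n 3) \<le>\<^sub>V ot UNIV (C \<beta>)} \<inter> elts d \<noteq> {}"
    using b(2,4) unfolding v1 m(1) mem_elts by blast
qed

end
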